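(* Let $1\le p<\infty$, let $\varphi$ be a non-elliptic automorphism of $\mathbb{D}$ in normalized form (hyperbolic with parameter $\alpha>1$, or parabolic with parameter $t>0$), let $J\subset\partial\mathbb{D}$ be the associated set, and let $\lambda>0$. There is an outer function $$F(z)=\exp\left(\int_{-\pi}^{\pi}\frac{e^{i\theta}+z}{e^{i\theta}-z}\,\log f(e^{i\theta})\,\frac{d\theta}{2\pi}\right)\in H^p$$ (with $f\ge0$ on $\partial\mathbb{D}$, $f\in L^p(\partial\mathbb{D})$, $\log f\in L^1(\partial\mathbb{D})$) such that $F\circ\varphi=\gamma\lambda F$ for some $\gamma\in\partial\mathbb{D}$ if and only if (1) $\alpha^{-1/p}<\lambda<\alpha^{1/p}$, in the hyperbolic case; (2) $\lambda=1$, in the parabolic case; and the outer functions $F$ with this property are exactly those for which $f$ is (almost everywhere) of the form $$f(z)=\sum_{n\in\mathbb{Z}}\chi_{\varphi^{(n)}(J)}(z)\,\lambda^n f_0(\varphi^{(-n)}(z)),$$ where $f_0\ge0$ belongs to $L^p(J)$ and $\log f_0\in L^1(J)$. Moreover, $\gamma$ depends on $\varphi$ and $f_0$ but is independent of $\lambda$ in both cases.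
   Context: $\mathbb{D}$ is the open unit disc in $\mathbb{C}$ and $H^p$ the classical Hardy space. For $n\in\mathbb{Z}$, $\varphi^{(n)}$ is the $|n|$-th iterate of $\varphi$ if $n>0$, of $\varphi^{-1}$ if $n<0$, and the identity if $n=0$. $L^p$ and $L^1$ are with respect to arc-length (Lebesgue) measure on $\partial\mathbb{D}$; $\chi_A$ is the characteristic function of $A$. Normalization: let $h(z)=i\frac{1+z}{1-z}$, which maps $\mathbb{D}$ conformally onto the upper half-plane $\mathbb{C}_+$, with $h^{-1}(v)=\frac{v-i}{v+i}$. The hyperbolic automorphism (fixed points $\pm1$, with $1$ attractive) is $\varphi=h^{-1}\circ\tilde\varphi\circ h$ with $\tilde\varphi(w)=\alpha w$, $\alpha>1$; the parabolic automorphism (fixed point $1$) is $\varphi=h^{-1}\circ\tilde\varphi\circ h$ with $\tilde\varphi(w)=w+t$, $t>0$. The set $J$: in the hyperbolic case, $J=(\varphi(i),i]\cup[-i,\varphi(-i))$, the union of two half-open circular arcs of $\partial\mathbb{D}$ not containing $\pm1$ (equivalently $h(J)=(-\alpha,-1]\cup[1,\alpha)$); in the parabolic case, $J=[-1,\varphi(-1))$, the half-open circular arc of $\partial\mathbb{D}$ not containing $1$ (equivalently $h(J)=[0,t)$). The sets $\varphi^{(n)}(J)$, $n\in\mathbb{Z}$, are pairwise disjoint and cover $\partial\mathbb{D}$ except for the fixed points of $\varphi$. *)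

theory Defs
  imports "HOL-Complex_Analysis.Complex_Analysis"
begin

section \<open>Function spaces\<close>

text \<open>Arc-length measure on the unit circle, complete (its measurable sets are the images of the
  Lebesgue measurable subsets of the interval).\<close>

definition circle_measure :: "complex measure" where
  "circle_measure = embed_measure (lebesgue_on {-pi<..pi}) cis"

definition in_Lp :: "real \<Rightarrow> 'a measure \<Rightarrow> ('a \<Rightarrow> real) \<Rightarrow> bool" where
  "in_Lp p M f \<longleftrightarrow> f \<in> borel_measurable M \<and> integrable M (\<lambda>x. \<bar>f x\<bar> powr p)"

text \<open>For \<open>f \<ge> 0\<close>, integrability of \<open>log f\<close> entails \<open>f > 0\<close> almost everywhere. This has to be
  required separately, because \<open>ln 0 = 0\<close> here instead of \<open>- \<infinity>\<close>.\<close>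

definition log_in_L1 :: "'a measure \<Rightarrow> ('a \<Rightarrow> real) \<Rightarrow> bool" where
  "log_in_L1 M f \<longleftrightarrow> (AE x in M. 0 < f x) \<and> integrable M (\<lambda>x. ln (f x))"

definition hardy_space :: "real \<Rightarrow> (complex \<Rightarrow> complex) set" where
  "hardy_space p = {F. F holomorphic_on ball 0 1 \<and>
     bdd_above ((\<lambda>r. (LINT \<theta>|lebesgue_on {-pi..pi}. norm (F (of_real r * cis \<theta>)) powr p / (2 * pi)))
       ` {0..<1})}"

definition outer_fun :: "(complex \<Rightarrow> real) \<Rightarrow> complex \<Rightarrow> complex" where
  "outer_fun f z = exp (LINT \<theta>|lebesgue_on {-pi..pi}.
     (cis \<theta> + z) / (cis \<theta> - z) * of_real (ln (f (cis \<theta>))) / of_real (2 * pi))"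

text \<open>Only the values of \<open>F\<close> on the open disc and those of \<open>f\<close> on the unit circle matter.\<close>

definition is_outer :: "real \<Rightarrow> (complex \<Rightarrow> complex) \<Rightarrow> (complex \<Rightarrow> real) \<Rightarrow> bool" where
  "is_outer p F f \<longleftrightarrow>
     (\<forall>z\<in>sphere 0 1. 0 \<le> f z) \<and> in_Lp p circle_measure f \<and> log_in_L1 circle_measure f \<and>
     (\<forall>z\<in>ball 0 1. F z = outer_fun f z) \<and> F \<in> hardy_space p"


section \<open>Normalized non-elliptic automorphisms\<close>

definition cayley :: "complex \<Rightarrow> complex" where
  "cayley z = \<i> * (1 + z) / (1 - z)"

definition cayley_inv :: "complex \<Rightarrow> complex" where
  "cayley_inv v = (v - \<i>) / (v + \<i>)"

text \<open>Conjugation of a self-map \<open>\<tau>\<close> of the closed half-plane fixing \<open>\<infinity>\<close> to a self-map of the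
  closed disc. The point \<open>1\<close>, which corresponds to \<open>\<infinity>\<close>, needs a separate clause because
  \<open>cayley 1 = 0\<close> by the convention on division by zero.\<close>

definition disc_conj :: "(complex \<Rightarrow> complex) \<Rightarrow> complex \<Rightarrow> complex" where
  "disc_conj \<tau> z = (if z = 1 then 1 else cayley_inv (\<tau> (cayley z)))"

definition hyperbolic_aut :: "real \<Rightarrow> complex \<Rightarrow> complex" where
  "hyperbolic_aut \<alpha> = disc_conj (\<lambda>w. of_real \<alpha> * w)"

definition parabolic_aut :: "real \<Rightarrow> complex \<Rightarrow> complex" where
  "parabolic_aut t = disc_conj (\<lambda>w. w + of_real t)"

definition int_iter :: "(complex \<Rightarrow> complex) \<Rightarrow> int \<Rightarrow> complex \<Rightarrow> complex" where
  "int_iter \<phi> n = (if 0 \<le> n then \<phi> ^^ nat n else inv_into (cball 0 1) \<phi> ^^ nat (-n))"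

text \<open>The arcs \<open>(\<phi>(i), i] \<union> [-i, \<phi>(-i))\<close> and \<open>[-1, \<phi>(-1))\<close>, given by angles in \<open>[-\<pi>, \<pi>]\<close>: the
  former lie in the upper and lower half-plane; the latter starts at angle \<open>-\<pi>\<close> and runs
  counterclockwise through the lower half-plane.\<close>

definition hyperbolic_arcs :: "real \<Rightarrow> complex set" where
  "hyperbolic_arcs \<alpha> =
     cis ` {Arg (hyperbolic_aut \<alpha> \<i>)<..pi/2} \<union> cis ` {-pi/2..<Arg (hyperbolic_aut \<alpha> (-\<i>))}"

definition parabolic_arc :: "real \<Rightarrow> complex set" where
  "parabolic_arc t = cis ` {-pi..<Arg (parabolic_aut t (-1))}"

definition orbit_sum ::
    "(complex \<Rightarrow> complex) \<Rightarrow> complex set \<Rightarrow> real \<Rightarrow> (complex \<Rightarrow> real) \<Rightarrow> complex \<Rightarrow> real" where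
  "orbit_sum \<phi> J \<mu> f\<^sub>0 z =
     (\<Sum>\<^sub>\<infinity>n. indicator (int_iter \<phi> n ` J) z * \<mu> powi n * f\<^sub>0 (int_iter \<phi> (-n) z))"

definition admissible_datum :: "real \<Rightarrow> complex set \<Rightarrow> (complex \<Rightarrow> real) \<Rightarrow> bool" where
  "admissible_datum p J f\<^sub>0 \<longleftrightarrow>
     (\<forall>z\<in>J. 0 \<le> f\<^sub>0 z) \<and> in_Lp p (restrict_space circle_measure J) f\<^sub>0 \<and>
     log_in_L1 (restrict_space circle_measure J) f\<^sub>0"


section \<open>The arcs in half-plane coordinates\<close>


lemma cis_2_arctan: 
  assumes "s \<noteq> 0" shows "cis (2 * arctan s) = cayley_inv (of_real (-1/s))"
proof -
  have c: "cos (2 * arctan s) = (1 - s\<^sup>2) / (1 + s\<^sup>2)" "sin (2 * arctan s) = 2 * s / (1 + s\<^sup>2)"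
    using cos_tan_half[of "arctan s"] sin_tan_half[of "arctan s"] by (auto simp: tan_arctan)
  have n: "1 + s * s \<noteq> 0" by (metis sum_squares_eq_zero_iff power2_eq_square power_one mult_1 zero_neq_one)
  have nz: "of_real (-1/s) + \<i> \<noteq> 0" by (simp add: complex_eq_iff)
  have "cis (2 * arctan s) * (of_real (-1/s) + \<i>) = of_real (-1/s) - \<i>"
  proof -
    have "cos (2 * arctan s) + sin (2 * arctan s) * s = 1"
         "cos (2 * arctan s) * s - sin (2 * arctan s) = - s"
      unfolding c power2_eq_square using n by (simp_all add: divide_simps) (simp_all add: algebra_simps)
    moreover have "Re (cis (2 * arctan s) * (of_real (-1/s) + \<i>))
          = - (cos (2 * arctan s) + sin (2 * arctan s) * s) / s"
        "Im (cis (2 * arctan s) * (of_real (-1/s) + \<i>))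
          = (cos (2 * arctan s) * s - sin (2 * arctan s)) / s"
      using assms by (simp_all add: add_divide_distrib diff_divide_distrib)
    ultimately show ?thesis using assms by (simp add: complex_eq_iff)
  qed
  then show ?thesis
    unfolding cayley_inv_def nonzero_eq_divide_eq[OF nz] .
qed

lemma cayley_cayley_inv: assumes "v + \<i> \<noteq> 0" shows "cayley (cayley_inv v) = v"
proof -
  have "1 + (v - \<i>) / (v + \<i>) = 2 * v / (v + \<i>)" "1 - (v - \<i>) / (v + \<i>) = 2 * \<i> / (v + \<i>)"
    using assms by (auto simp: divide_simps)
  then show ?thesis using assms by (simp add: cayley_def cayley_inv_def)
qed

lemma real_i_nz: "complex_of_real x + \<i> \<noteq> 0" by (simp add: complex_eq_iff)

lemma Arg_cis_2_arctan: "Arg (cis (2 * arctan s)) = 2 * arctan s"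
  using arctan_bounded[of s] by (intro Arg_cis) auto

lemma two_arctan_img_gt: "{2 * arctan a<..2 * arctan b} = (\<lambda>s. 2 * arctan s) ` {a<..b}"
proof (intro set_eqI iffI)
  fix x assume x: "x \<in> {2 * arctan a<..2 * arctan b}"
  have "-pi/2 < x/2" "x/2 < pi/2" using x arctan_bounded[of a] arctan_bounded[of b] by auto
  then have "x = 2 * arctan (tan (x/2))" by (simp add: arctan_tan)
  then show "x \<in> (\<lambda>s. 2 * arctan s) ` {a<..b}" using x
    by (metis arctan_le_iff arctan_less_iff greaterThanAtMost_iff imageI mult_le_cancel_left_pos mult_less_cancel_left_pos zero_less_numeral)
qed (auto simp: arctan_le_iff arctan_less_iff)

lemma two_arctan_img_lt: "{2 * arctan a..<2 * arctan b} = (\<lambda>s. 2 * arctan s) ` {a..<b}"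
proof (intro set_eqI iffI)
  fix x assume x: "x \<in> {2 * arctan a..<2 * arctan b}"
  have "-pi/2 < x/2" "x/2 < pi/2" using x arctan_bounded[of a] arctan_bounded[of b] by auto
  then have "x = 2 * arctan (tan (x/2))" by (simp add: arctan_tan)
  then show "x \<in> (\<lambda>s. 2 * arctan s) ` {a..<b}" using x
    by (metis arctan_le_iff arctan_less_iff atLeastLessThan_iff imageI mult_le_cancel_left_pos mult_less_cancel_left_pos zero_less_numeral)
qed (auto simp: arctan_le_iff arctan_less_iff)

lemma cayley_cis: "s \<noteq> 0 \<Longrightarrow> cayley (cis (2 * arctan s)) = of_real (-1/s)"
  by (metis cis_2_arctan cayley_cayley_inv real_i_nz)

lemma minus_inverse_img:
  assumes "0 < a" "a < (b::real)" shows "(\<lambda>s. -1/s) ` {a<..b} = {-1/a<..-1/b}"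
proof (intro set_eqI iffI)
  fix x assume x: "x \<in> {-1/a<..-1/b}"
  have "-1/b < 0" using assms by simp
  then have neg: "x < 0" using x by (simp only: greaterThanAtMost_iff) linarith
  have "a < -1/x" "-1/x \<le> b" using x neg assms by (simp_all add: field_simps)
  then show "x \<in> (\<lambda>s. -1/s) ` {a<..b}" by (intro image_eqI[of _ _ "-1/x"]) auto
next
  fix x assume "x \<in> (\<lambda>s. -1/s) ` {a<..b}"
  then obtain s where s: "x = -1/s" "a < s" "s \<le> b" by auto
  with assms have "1/s < 1/a" "1/b \<le> 1/s" by (auto intro: divide_strict_left_mono divide_left_mono)
  with s show "x \<in> {-1/a<..-1/b}" by simp
qed

lemma cayley_hyperbolic_arcs:
  assumes "1 < \<alpha>" shows "cayley ` hyperbolic_arcs \<alpha> = of_real ` ({-\<alpha><..-1} \<union> {1..<\<alpha>})"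
proof -
  have ci: "cayley \<i> = -1" "cayley (-\<i>) = 1"
    by (auto simp: cayley_def complex_eq_iff Re_divide Im_divide)
  have "hyperbolic_aut \<alpha> \<i> = cis (2 * arctan (1/\<alpha>))"
       "hyperbolic_aut \<alpha> (-\<i>) = cis (2 * arctan (-1/\<alpha>))"
    using assms cis_2_arctan[of "1/\<alpha>"] cis_2_arctan[of "-1/\<alpha>"]
    by (auto simp: hyperbolic_aut_def disc_conj_def ci complex_eq_iff)
  then have A: "Arg (hyperbolic_aut \<alpha> \<i>) = 2 * arctan (1/\<alpha>)"
     "Arg (hyperbolic_aut \<alpha> (-\<i>)) = 2 * arctan (-1/\<alpha>)" by (simp_all only: Arg_cis_2_arctan)
  have p: "pi/2 = 2 * arctan 1" "-pi/2 = 2 * arctan (-1)" by (auto simp: arctan_minus arctan_one)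
  have 1: "cayley ` cis ` {2 * arctan (1/\<alpha>)<..2 * arctan 1} = of_real ` (\<lambda>s. -1/s) ` {1/\<alpha><..1}"
    unfolding two_arctan_img_gt image_image using assms
    by (intro image_cong refl cayley_cis) (auto simp: field_simps)
  have 2: "cayley ` cis ` {2 * arctan (-1)..<2 * arctan (-1/\<alpha>)} = of_real ` (\<lambda>s. -1/s) ` {-1..<-1/\<alpha>}"
    unfolding two_arctan_img_lt image_image using assms
    by (intro image_cong refl cayley_cis) (auto simp: field_simps)
  have 3: "(\<lambda>s. -1/s) ` {1/\<alpha><..1} = {-\<alpha><..-1}"
    using minus_inverse_img[of "1/\<alpha>" 1] assms by simp
  have "{-1..<-1/\<alpha>} = uminus ` {1/\<alpha><..1}" by simp
  then have "(\<lambda>s. -1/s) ` {-1..<-1/\<alpha>} = uminus ` ((\<lambda>s. -1/s) ` {1/\<alpha><..1})"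
    by (simp only: image_image) (simp add: image_def)
  also have "\<dots> = {1..<\<alpha>}" unfolding 3 by simp
  finally show ?thesis unfolding hyperbolic_arcs_def A p image_Un 1 2 3 by simp
qed

lemma cayley_parabolic_arc:
  assumes "0 < t" shows "cayley ` parabolic_arc t = of_real ` {0..<t}"
proof -
  have "parabolic_aut t (-1) = cis (2 * arctan (-1/t))"
    using assms cis_2_arctan[of "-1/t"]
    by (auto simp: parabolic_aut_def disc_conj_def cayley_def)
  then have A: "Arg (parabolic_aut t (-1)) = 2 * arctan (-1/t)" by (simp only: Arg_cis_2_arctan)
  have "{-pi..<2 * arctan (-1/t)} = insert (-pi) ((\<lambda>s. 2 * arctan s) ` {..<-1/t})"
  proof (intro set_eqI iffI)
    fix x assume x: "x \<in> {-pi..<2 * arctan (-1/t)}"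
    show "x \<in> insert (-pi) ((\<lambda>s. 2 * arctan s) ` {..<-1/t})"
    proof (cases "x = -pi")
      case False
      have "-pi/2 < x/2" "x/2 < pi/2" using x False arctan_bounded[of "-1/t"] by auto
      then have "x = 2 * arctan (tan (x/2))" by (simp add: arctan_tan)
      then show ?thesis using x
        by (metis arctan_less_iff atLeastLessThan_iff imageI insertI2 lessThan_iff mult_less_cancel_left_pos zero_less_numeral)
    qed auto
  next
    fix x assume "x \<in> insert (-pi) ((\<lambda>s. 2 * arctan s) ` {..<-1/t})"
    moreover have "-pi < 2 * arctan s" for s using arctan_lbound[of s] by simp
    ultimately show "x \<in> {-pi..<2 * arctan (-1/t)}"
      by (auto simp: arctan_less_iff less_imp_le)
  qed
  moreover have "cis (-pi) = -1" by (simp add: complex_eq_iff)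
  then have m: "cayley (cis (-pi)) = 0" by (simp only: cayley_def) simp
  ultimately have "cayley ` parabolic_arc t = insert 0 ((\<lambda>s. cayley (cis (2 * arctan s))) ` {..<-1/t})"
    using m by (simp add: parabolic_arc_def A image_image)
  also have "(\<lambda>s. cayley (cis (2 * arctan s))) ` {..<-1/t} = (\<lambda>s. of_real (-1/s)) ` {..<-1/t}"
    using assms by (intro image_cong refl cayley_cis) (auto simp: field_simps)
  also have "\<dots> = of_real ` (\<lambda>s. -1/s) ` {..<-1/t}" by (simp add: image_image)
  also have "(\<lambda>s. -1/s) ` {..<-1/t} = {0<..<t}"
  proof (intro set_eqI iffI)
    fix x assume "x \<in> {0<..<t}"
    then show "x \<in> (\<lambda>s. -1/s) ` {..<-1/t}" using assms
      by (intro image_eqI[of _ _ "-1/x"]) (auto simp: field_simps)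
  next
    fix x assume "x \<in> (\<lambda>s. -1/s) ` {..<-1/t}"
    then obtain s where s: "x = -1/s" "s < -1/t" by auto
    have "-1/t < 0" using assms by simp
    with s have "s < 0" by linarith
    then have "0 < x" using s by simp
    moreover have "x < t" using s(2) assms \<open>s < 0\<close> unfolding s(1) by (simp add: field_simps)
    ultimately show "x \<in> {0<..<t}" by simp
  qed
  also have "insert 0 (of_real ` {0<..<t}) = (of_real ` insert 0 {0<..<t} :: complex set)" by simp
  also have "insert 0 {0<..<t} = {0..<t}" using assms by auto
  finally show ?thesis .
qed

end

theory Submission
  imports Defs "HOL-Real_Asymp.Real_Asymp"
begin

text \<open>
  Let \<open>F\<close> be outer with boundary function \<open>f\<close>. Since \<open>log \<bar>F\<bar>\<close> is the Poisson integral of \<open>log f\<close> and the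
  Poisson kernel is conformally invariant, \<open>log \<bar>F \<circ> \<phi>\<bar>\<close> is the Poisson integral of \<open>log f \<circ> \<phi>\<close>. So
  \<open>\<bar>F \<circ> \<phi>\<bar> = \<mu> \<bar>F\<bar>\<close> in the disc if and only if \<open>f \<circ> \<phi> = \<mu> f\<close> almost everywhere on the circle, because a Poisson
  integral determines its boundary function (\<open>poisson_integral_zero_imp_AE_zero\<close>). Equality of the moduli is
  the same as \<open>F \<circ> \<phi> = \<gamma> \<mu> F\<close> for a unimodular constant \<open>\<gamma>\<close>, by the maximum principle; together this is
  \<open>functional_equation_iff\<close>. The iterates of \<open>J\<close> tile the circle, so the solutions of the functional equation
  are the functions obtained from an arbitrary \<open>f\<^sub>0\<close> on \<open>J\<close> by an orbit sum
  (\<open>functional_equation_iff_orbit_sum\<close>).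

  What remains is integrability. In the coordinate \<open>x = h(\<zeta>)\<close> of the upper half-plane, arc length becomes
  \<open>2 dx/(1 + x\<^sup>2)\<close> and \<open>\<phi>\<close> becomes \<open>x \<mapsto> \<alpha>x\<close> or \<open>x \<mapsto> x + t\<close>. The \<open>n\<close>-th iterate then contracts arc length on
  \<open>J\<close> by a factor comparable with \<open>\<rho>\<^sub>n = \<alpha>\<^sup>-\<^sup>\<bar>\<^sup>n\<^sup>\<bar>\<close> in the hyperbolic and \<open>\<rho>\<^sub>n = 1/(1 + n\<^sup>2)\<close> in the parabolic case.
  Consequently the integral of \<open>f\<^sup>p\<close> is comparable with the integral of \<open>f\<^sub>0\<^sup>p\<close> over \<open>J\<close>, times the sum over
  \<open>n \<in> \<int>\<close> of \<open>\<mu>\<^sup>p\<^sup>n \<rho>\<^sub>n\<close> (\<open>integrable_weight_if_dominated\<close>, \<open>summable_if_integrable_weight\<close>). The sum is finite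
  exactly for \<open>\<alpha>\<^sup>-\<^sup>1 < \<mu>\<^sup>p < \<alpha>\<close> in the hyperbolic and for \<open>\<mu> = 1\<close> in the parabolic case. For such \<open>\<mu>\<close> the logarithm
  of the orbit sum, which is \<open>n log \<mu> + log f\<^sub>0\<close> on the \<open>n\<close>-th tile, is integrable too, and Jensen's inequality
  places the outer function in \<open>H\<^sup>p\<close> (\<open>outer_fun_hardy\<close>).

  The constant \<open>\<gamma>\<close> is the unimodular part of \<open>F(\<phi>(0))\<close>, as \<open>F(0) > 0\<close>. Only the hyperbolic case allows more than
  one \<open>\<mu>\<close>. There, passing from \<open>1\<close> to \<open>\<mu>\<close> adds to \<open>log f\<close> a multiple of the tile index, which is symmetric under
  \<open>x \<mapsto> -x\<close>, whereas the kernel for the argument of \<open>F\<close> at \<open>\<phi>(0)\<close>, a point of the imaginary axis of the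
  half-plane, is odd. So \<open>\<gamma>\<close> does not change (\<open>phase_orbit_sum\<close>).

  Both kinds of automorphism are instances of a locale for an affine map and a tile of the line; the common
  result is \<open>eigenvalue_description\<close>.
\<close>

section \<open>Arc length in half-plane coordinates\<close>

definition bdry :: "real \<Rightarrow> complex" where
  "bdry x = cayley_inv (of_real x)"

text \<open>The density of arc length in the boundary coordinate \<open>x = h(e\<^sup>i\<^sup>\<theta>) = - cot (\<theta>/2)\<close>; its total
  mass is \<open>2\<pi>\<close>.\<close>

definition cauchy_weight :: "real \<Rightarrow> real" where
  "cauchy_weight x = 2 / (1 + x\<^sup>2)"

lemma one_plus_square_pos [simp]: "0 < 1 + (x::real)\<^sup>2"
  by (simp add: add_pos_nonneg)

lemma cauchy_weight_pos [simp]: "0 < cauchy_weight x"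
  by (simp add: cauchy_weight_def)

lemma cauchy_weight_nonzero [simp]: "cauchy_weight x \<noteq> 0"
  using cauchy_weight_pos[of x] by linarith

lemma cauchy_weight_nonneg [simp]: "0 \<le> cauchy_weight x"
  by (simp add: less_imp_le)

lemma borel_measurable_cauchy_weight [measurable]: "cauchy_weight \<in> borel_measurable borel"
  unfolding cauchy_weight_def by measurable

lemma cis_bdry_angle: "x \<noteq> 0 \<Longrightarrow> cis (2 * arctan (-1/x)) = bdry x"
  using cis_2_arctan[of "-1/x"] by (simp add: bdry_def)

text \<open>With values in \<open>(-\<pi>, \<pi>]\<close> the angle jumps at \<open>x = 0\<close>, so the change of variables is made off \<open>0\<close>;
  on the side of the angle this leaves out \<open>0\<close> (the point \<open>1 = h\<^sup>-\<^sup>1(\<infinity>)\<close>) and \<open>\<plusminus>\<pi>\<close>.\<close>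

lemma angle_image: "(\<lambda>x. 2 * arctan (-1/x)) ` (UNIV - {0}) = {-pi<..<pi} - {0}"
proof (intro set_eqI iffI)
  fix y assume y: "y \<in> {-pi<..<pi} - {0}"
  then have r: "-pi/2 < y/2" "y/2 < pi/2" by auto
  then have y2: "y = 2 * arctan (tan (y/2))" by (simp add: arctan_tan)
  moreover have "tan (y/2) \<noteq> 0"
  proof
    assume "tan (y/2) = 0"
    then have "y = 2 * arctan 0" using y2 by metis
    then show False using y by simp
  qed
  ultimately show "y \<in> (\<lambda>x. 2 * arctan (-1/x)) ` (UNIV - {0})"
    by (intro image_eqI[of _ _ "-1 / tan (y/2)"]) auto
next
  fix y assume "y \<in> (\<lambda>x. 2 * arctan (-1/x)) ` (UNIV - {0})"
  then obtain x where x: "y = 2 * arctan (-1/x)" "x \<noteq> 0" by auto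
  then have "arctan (-1/x) \<noteq> arctan 0" by (simp only: arctan_eq_iff) simp
  then show "y \<in> {-pi<..<pi} - {0}" using x(1) arctan_bounded[of "-1/x"] by auto
qed

lemma angle_inj: "inj_on (\<lambda>x. 2 * arctan (-1/x)) (UNIV - {0::real})"
  by (rule inj_onI) (simp add: arctan_eq_iff)

lemma angle_deriv:
  assumes "x \<noteq> 0"
  shows "((\<lambda>x. 2 * arctan (-1/x)) has_field_derivative cauchy_weight x) (at x within S)"
proof -
  have "((\<lambda>x. 2 * arctan (-1/x)) has_field_derivative
      (2 * ((1 / x\<^sup>2) / (1 + (-1/x)\<^sup>2)))) (at x within S)"
    using assms by (auto intro!: derivative_eq_intros simp: power2_eq_square divide_simps)
  also have "2 * ((1 / x\<^sup>2) / (1 + (-1/x)\<^sup>2)) = cauchy_weight x"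
  proof -
    have "x\<^sup>2 * (1 + (-1/x)\<^sup>2) = 1 + x\<^sup>2" using assms by (simp add: field_simps power2_eq_square)
    then show ?thesis by (simp add: cauchy_weight_def)
  qed
  finally show ?thesis .
qed

text \<open>One formula for every way to cut the circle open: intervals of angles that differ in finitely
  many points give the same integrals. The closed interval occurs in the definition of an outer
  function, a half-open one in that of the measure on the circle.\<close>

lemma angle_integrable_iff:
  fixes G :: "complex \<Rightarrow> 'a :: euclidean_space"
  assumes E: "sym_diff E {-pi<..<pi} \<subseteq> N" "finite N" "E \<in> sets lebesgue"
  shows "integrable (lebesgue_on E) (\<lambda>\<theta>. G (cis \<theta>)) \<longleftrightarrow>
           integrable lebesgue (\<lambda>x. cauchy_weight x *\<^sub>R G (bdry x))"
    and "(LINT \<theta>|lebesgue_on E. G (cis \<theta>)) =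
           (LINT x|lebesgue. cauchy_weight x *\<^sub>R G (bdry x))"
proof -
  let ?g = "\<lambda>x::real. 2 * arctan (-1/x)" and ?S = "UNIV - {0::real}"
  let ?h = "\<lambda>x. cauchy_weight x *\<^sub>R G (bdry x)" and ?f = "\<lambda>\<theta>. G (cis \<theta>)"
  have S: "?S \<in> sets lebesgue" by simp
  have "(\<lambda>x. \<bar>cauchy_weight x\<bar> *\<^sub>R ?f (?g x)) absolutely_integrable_on ?S \<and>
       integral ?S (\<lambda>x. \<bar>cauchy_weight x\<bar> *\<^sub>R ?f (?g x)) = b
      \<longleftrightarrow> ?f absolutely_integrable_on (?g ` ?S) \<and> integral (?g ` ?S) ?f = b" for b
    by (rule has_absolute_integral_change_of_variables_real[OF S angle_deriv angle_inj]) auto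
  moreover have "(\<lambda>x. \<bar>cauchy_weight x\<bar> *\<^sub>R ?f (?g x)) absolutely_integrable_on ?S \<longleftrightarrow>
      ?h absolutely_integrable_on ?S"
    unfolding set_integrable_def
  proof (intro Bochner_Integration.integrable_cong refl)
    fix x show "indicat_real ?S x *\<^sub>R \<bar>cauchy_weight x\<bar> *\<^sub>R ?f (?g x) = indicat_real ?S x *\<^sub>R ?h x"
      by (cases "x = 0") (simp_all add: cis_bdry_angle del: divide_minus_left)
  qed
  moreover have "integral ?S (\<lambda>x. \<bar>cauchy_weight x\<bar> *\<^sub>R ?f (?g x)) = integral ?S ?h"
    by (intro Henstock_Kurzweil_Integration.integral_cong) (auto simp: cis_bdry_angle simp del: divide_minus_left)
  ultimately have cv: "?h absolutely_integrable_on ?S \<and> integral ?S ?h = b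
      \<longleftrightarrow> ?f absolutely_integrable_on (?g ` ?S) \<and> integral (?g ` ?S) ?f = b" for b
    by simp
  have n1: "negligible {x \<in> E - ?g ` ?S. ?f x \<noteq> 0}" "negligible {x \<in> ?g ` ?S - E. ?f x \<noteq> 0}"
    unfolding angle_image using E(1)
    by (auto intro!: negligible_finite finite_subset[OF _ finite.insertI[OF E(2), of 0]])
  have n2: "negligible {x \<in> UNIV - ?S. ?h x \<noteq> 0}" "negligible {x \<in> ?S - UNIV. ?h x \<noteq> 0}"
    by (auto intro!: negligible_finite intro: finite_subset[of _ "{0}"])
  have a: "integrable (lebesgue_on E) ?f \<longleftrightarrow> ?f absolutely_integrable_on E"
    using E(3) by (simp add: integrable_restrict_space set_integrable_def)
  have b: "integrable lebesgue ?h \<longleftrightarrow> ?h absolutely_integrable_on UNIV"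
    by (simp add: set_integrable_def)
  have ai: "?f absolutely_integrable_on E \<longleftrightarrow> ?f absolutely_integrable_on (?g ` ?S)"
    by (rule absolutely_integrable_spike_set_eq[OF n1])
  have bi: "?h absolutely_integrable_on UNIV \<longleftrightarrow> ?h absolutely_integrable_on ?S"
    by (rule absolutely_integrable_spike_set_eq[OF n2])
  show i: "integrable (lebesgue_on E) ?f \<longleftrightarrow> integrable lebesgue ?h"
    using a b ai bi cv by blast
  show "(LINT \<theta>|lebesgue_on E. ?f \<theta>) = (LINT x|lebesgue. ?h x)"
  proof (cases "integrable (lebesgue_on E) ?f")
    case I: True
    have "(LINT \<theta>|lebesgue_on E. ?f \<theta>) = integral E ?f"
      using I E(3) a by (simp add: integral_restrict_space set_lebesgue_integral_eq_integral(2)[symmetric]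
         set_lebesgue_integral_def)
    also have "\<dots> = integral (?g ` ?S) ?f" by (rule integral_spike_set[OF n1])
    also have "\<dots> = integral ?S ?h" using cv I a ai by blast
    also have "\<dots> = integral UNIV ?h" by (rule integral_spike_set[OF n2, symmetric])
    also have "\<dots> = (LINT x|lebesgue. ?h x)"
      using I i b by (simp add: set_lebesgue_integral_eq_integral(2)[symmetric] set_lebesgue_integral_def)
    finally show ?thesis .
  qed (use i in \<open>simp add: not_integrable_integral_eq\<close>)
qed

lemma angle_integral:
  fixes G :: "complex \<Rightarrow> 'a :: euclidean_space"
  shows "(LINT \<theta>|lebesgue_on {-pi..pi}. G (cis \<theta>)) = (LINT x|lebesgue. cauchy_weight x *\<^sub>R G (bdry x))"
  by (rule angle_integrable_iff(2)[of _ "{-pi, pi}"]) auto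

lemma angle_integrable:
  fixes G :: "complex \<Rightarrow> 'a :: euclidean_space"
  shows "integrable (lebesgue_on {-pi..pi}) (\<lambda>\<theta>. G (cis \<theta>)) \<longleftrightarrow>
           integrable lebesgue (\<lambda>x. cauchy_weight x *\<^sub>R G (bdry x))"
  by (rule angle_integrable_iff(1)[of _ "{-pi, pi}"]) auto

lemma cis_inj_on_half_open: "inj_on cis (space (lebesgue_on {-pi<..pi}))"
proof (rule inj_onI)
  fix x y assume x: "x \<in> space (lebesgue_on {-pi<..pi})" and y: "y \<in> space (lebesgue_on {-pi<..pi})"
    and eq: "cis x = cis y"
  have "x = Arg (cis x)" using Arg_cis[of x] x by simp
  also have "\<dots> = Arg (cis y)" by (simp only: eq)
  also have "\<dots> = y" using Arg_cis[of y] y by simp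
  finally show "x = y" .
qed

lemma space_circle_measure: "space circle_measure = sphere 0 1"
proof -
  have "z \<in> cis ` {-pi<..pi}" if "norm z = 1" for z
  proof (rule image_eqI)
    show "z = cis (Arg z)" using that cis_Arg[of z] by (cases "z = 0") (auto simp: sgn_eq)
  qed (use Arg_bounded[of z] in auto)
  then show ?thesis
    by (auto simp: circle_measure_def space_embed_measure)
qed

lemma circle_integrable_iff:
  fixes G :: "complex \<Rightarrow> 'a :: euclidean_space"
  shows "integrable circle_measure G \<longleftrightarrow> integrable lebesgue (\<lambda>x. cauchy_weight x *\<^sub>R G (bdry x))"
proof -
  let ?L = "lebesgue_on {-pi<..pi}"
  have "integrable circle_measure G \<longleftrightarrow> integrable ?L (\<lambda>\<theta>. G (cis \<theta>))"
  proof
    assume "integrable circle_measure G"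
    then show "integrable ?L (\<lambda>\<theta>. G (cis \<theta>))"
      unfolding circle_measure_def
      by (subst (asm) embed_measure_eq_distr'[OF cis_inj_on_half_open])
        (rule integrable_distr[OF measurable_embed_measure2'[OF cis_inj_on_half_open]])
  next
    assume I: "integrable ?L (\<lambda>\<theta>. G (cis \<theta>))"
    then have "G \<in> borel_measurable circle_measure"
      unfolding circle_measure_def by (intro measurable_embed_measure1) auto
    with I show "integrable circle_measure G"
      unfolding circle_measure_def
      by (subst embed_measure_eq_distr'[OF cis_inj_on_half_open])
         (subst integrable_distr_eq[OF measurable_embed_measure2'[OF cis_inj_on_half_open]], auto)
  qed
  also have "\<dots> \<longleftrightarrow> integrable lebesgue (\<lambda>x. cauchy_weight x *\<^sub>R G (bdry x))"
    by (rule angle_integrable_iff(1)[of _ "{-pi, pi}"]) auto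
  finally show ?thesis .
qed

lemma integrable_cauchy_weight: "integrable lebesgue cauchy_weight"
  and integral_cauchy_weight: "(LINT x|lebesgue. cauchy_weight x) = 2 * pi"
  using angle_integrable[of "\<lambda>_. 1::real"] angle_integral[of "\<lambda>_. 1::real"]
  by (auto simp: finite_measure.integrable_const finite_measure_lebesgue_on measure_restrict_space)

lemma AE_lebesgue_negligible: "(AE x in lebesgue. P x) \<longleftrightarrow> negligible {x. \<not> P x}"
  using completion.AE_iff_null_sets[of P lborel] by (simp add: negligible_iff_null_sets)

lemma negligible_up_to_finite:
  "A - B \<subseteq> F \<Longrightarrow> B - A \<subseteq> F \<Longrightarrow> finite F \<Longrightarrow> negligible A \<longleftrightarrow> negligible B"
  by (meson Diff_subset_conv negligible_Un negligible_finite negligible_subset)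

text \<open>Null sets correspond because both changes of coordinates, \<open>\<theta> \<mapsto> - cot (\<theta>/2)\<close> and its inverse, are
  differentiable off finitely many points.\<close>

lemma circle_AE_iff: "(AE z in circle_measure. P z) \<longleftrightarrow> (AE x in lebesgue. P (bdry x))"
proof -
  let ?g = "\<lambda>x::real. 2 * arctan (-1/x)" and ?k = "\<lambda>\<theta>. - cos (\<theta>/2) / sin (\<theta>/2)"
  define N where "N = {\<theta> \<in> {-pi<..<pi} - {0}. \<not> P (cis \<theta>)}"
  define M where "M = {x \<in> UNIV - {0}. \<not> P (bdry x)}"
  have gM: "N = ?g ` M"
  proof -
    have "N = {\<theta> \<in> ?g ` (UNIV - {0}). \<not> P (cis \<theta>)}" unfolding angle_image N_def ..
    also have "\<dots> = ?g ` M" by (auto simp: M_def cis_bdry_angle simp del: divide_minus_left)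
    finally show ?thesis .
  qed
  have kN: "M = ?k ` N"
  proof -
    have "?k (?g x) = x" if "x \<in> M" for x
    proof -
      have "x \<noteq> 0" using that by (simp add: M_def)
      have "?k (?g x) = - inverse (tan (arctan (-1/x)))" by (simp add: tan_def)
      also have "\<dots> = x" using \<open>x \<noteq> 0\<close> by (simp add: tan_arctan)
      finally show ?thesis .
    qed
    then have "(\<lambda>x. ?k (?g x)) ` M = (\<lambda>x. x) ` M" by (rule image_cong[OF refl])
    then show ?thesis unfolding gM image_image by (simp only: image_ident)
  qed
  have "(AE z in circle_measure. P z) \<longleftrightarrow> (AE \<theta> in lebesgue_on {-pi<..pi}. P (cis \<theta>))"
    unfolding circle_measure_def by (rule AE_embed_measure'[OF cis_inj_on_half_open])
  also have "\<dots> \<longleftrightarrow> negligible {\<theta>. \<not> (\<theta> \<in> {-pi<..pi} \<longrightarrow> P (cis \<theta>))}"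
    by (subst AE_restrict_space_iff) (auto simp: AE_lebesgue_negligible)
  also have "\<dots> \<longleftrightarrow> negligible N"
    by (rule negligible_up_to_finite[of _ _ "{0, pi}"]) (auto simp: N_def)
  also have "\<dots> \<longleftrightarrow> negligible M"
  proof
    assume "negligible N"
    moreover have "?k differentiable_on N"
      unfolding differentiable_on_def
    proof
      fix \<theta> assume "\<theta> \<in> N"
      then have "sin (\<theta>/2) \<noteq> 0"
        using sin_eq_0_pi[of "\<theta>/2"] by (auto simp: N_def)
      then have "((\<lambda>\<theta>. - cos (\<theta>/2) / sin (\<theta>/2)) has_real_derivative
           (sin (\<theta>/2) * (1/2) * sin (\<theta>/2) - - cos (\<theta>/2) * (cos (\<theta>/2) * (1/2))) / (sin (\<theta>/2) * sin (\<theta>/2)))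
           (at \<theta> within N)"
        by (auto intro!: derivative_eq_intros simp del: divide_minus_left)
      then show "?k differentiable (at \<theta> within N)"
        by (intro differentiableI[OF has_field_derivative_imp_has_derivative])
    qed
    ultimately show "negligible M"
      unfolding kN by (intro negligible_differentiable_image_negligible) auto
  next
    assume "negligible M"
    moreover have "?g differentiable_on M"
      unfolding differentiable_on_def
    proof
      fix x assume "x \<in> M"
      then show "?g differentiable (at x within M)"
        using angle_deriv[of x M] unfolding M_def by (intro differentiableI[OF has_field_derivative_imp_has_derivative]) auto
    qed
    ultimately show "negligible N"
      unfolding gM by (intro negligible_differentiable_image_negligible) auto
  qed
  also have "\<dots> \<longleftrightarrow> negligible {x. \<not> P (bdry x)}"
    by (rule negligible_up_to_finite[of _ _ "{0}"]) (auto simp: M_def)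
  also have "\<dots> \<longleftrightarrow> (AE x in lebesgue. P (bdry x))"
    by (simp add: AE_lebesgue_negligible)
  finally show ?thesis .
qed

text \<open>Measurability reduces to integrability, for which the change of variables is available: composing
  with \<open>arctan\<close> makes a function bounded without changing whether it is measurable, and a bounded
  function is measurable if and only if it is integrable against a finite measure.\<close>

lemma circle_measurable_iff:
  fixes G :: "complex \<Rightarrow> real"
  shows "G \<in> borel_measurable circle_measure \<longleftrightarrow> (\<lambda>x. G (bdry x)) \<in> borel_measurable lebesgue"
proof -
  have c: "integrable circle_measure (\<lambda>_. 2::real)"
    using integrable_cauchy_weight by (simp add: circle_integrable_iff)
  \<comment> \<open>A rational bound for \<open>\<pi>/2\<close>.\<close>
  have le: "\<bar>arctan u\<bar> \<le> 2" for u
    using arctan_bounded[of u] pi_less_4 by (simp add: abs_le_iff)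
  have "G \<in> borel_measurable circle_measure \<longleftrightarrow> integrable circle_measure (\<lambda>z. arctan (G z))"
  proof
    assume [measurable]: "G \<in> borel_measurable circle_measure"
    show "integrable circle_measure (\<lambda>z. arctan (G z))"
      by (rule Bochner_Integration.integrable_bound[OF c]) (use le in auto)
  next
    assume "integrable circle_measure (\<lambda>z. arctan (G z))"
    then have "(\<lambda>z. tan (arctan (G z))) \<in> borel_measurable circle_measure"
      unfolding tan_def by measurable
    then show "G \<in> borel_measurable circle_measure" by (simp add: tan_arctan)
  qed
  also have "\<dots> \<longleftrightarrow> integrable lebesgue (\<lambda>x. cauchy_weight x * arctan (G (bdry x)))"
    by (simp add: circle_integrable_iff)
  also have "\<dots> \<longleftrightarrow> (\<lambda>x. G (bdry x)) \<in> borel_measurable lebesgue"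
  proof
    assume [measurable]: "(\<lambda>x. G (bdry x)) \<in> borel_measurable lebesgue"
    have [measurable]: "cauchy_weight \<in> borel_measurable lebesgue"
      using integrable_cauchy_weight by auto
    show "integrable lebesgue (\<lambda>x. cauchy_weight x * arctan (G (bdry x)))"
      by (rule Bochner_Integration.integrable_bound[OF integrable_mult_right[OF integrable_cauchy_weight, of 2]])
         (use le in \<open>auto simp: abs_mult mult.commute intro!: mult_right_mono\<close>)
  next
    have [measurable]: "cauchy_weight \<in> borel_measurable lebesgue"
      using integrable_cauchy_weight by auto
    assume I: "integrable lebesgue (\<lambda>x. cauchy_weight x * arctan (G (bdry x)))"
    then have "(\<lambda>x. tan ((cauchy_weight x * arctan (G (bdry x))) / cauchy_weight x)) \<in> borel_measurable lebesgue"
      unfolding tan_def by measurable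
    moreover have "cauchy_weight x * u / cauchy_weight x = u" for x u
      by simp
    ultimately show "(\<lambda>x. G (bdry x)) \<in> borel_measurable lebesgue"
      by (simp only: tan_arctan)
  qed
  finally show ?thesis .
qed

lemma in_Lp_circle_iff:
  "in_Lp p circle_measure f \<longleftrightarrow> (\<lambda>x. f (bdry x)) \<in> borel_measurable lebesgue \<and>
     integrable lebesgue (\<lambda>x. cauchy_weight x * \<bar>f (bdry x)\<bar> powr p)"
  by (simp add: in_Lp_def circle_integrable_iff circle_measurable_iff)

lemma log_in_L1_circle_iff:
  "log_in_L1 circle_measure f \<longleftrightarrow> (AE x in lebesgue. 0 < f (bdry x)) \<and>
     integrable lebesgue (\<lambda>x. cauchy_weight x * ln (f (bdry x)))"
  by (simp add: log_in_L1_def circle_integrable_iff circle_AE_iff)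

section \<open>Herglotz and Poisson kernels of the half-plane\<close>

definition hp_poisson :: "complex \<Rightarrow> real \<Rightarrow> real" where
  "hp_poisson w x = Im w / (pi * (norm (w - of_real x))\<^sup>2)"

text \<open>The kernel of an outer function, moved to the half-plane together with the measure, so that it is
  integrated against Lebesgue measure. Its real part is the Poisson kernel of the half-plane.\<close>

definition hp_herglotz :: "complex \<Rightarrow> real \<Rightarrow> complex" where
  "hp_herglotz w x = \<i> * (1 + of_real x * w) / ((w - of_real x) * of_real (pi * (1 + x\<^sup>2)))"

lemma cayley_inv_cayley: "z \<noteq> 1 \<Longrightarrow> cayley_inv (cayley z) = z"
proof -
  assume "z \<noteq> 1"
  then have "cayley z - \<i> = \<i> * 2 * z / (1 - z)" "cayley z + \<i> = \<i> * 2 / (1 - z)"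
    by (auto simp: cayley_def divide_simps algebra_simps)
  then show ?thesis using \<open>z \<noteq> 1\<close> by (simp add: cayley_inv_def)
qed

lemma Im_cayley: "Im (cayley z) = (1 - (norm z)\<^sup>2) / (norm (1 - z))\<^sup>2"
proof -
  have "cayley z = (\<i> * (1 + z)) * cnj (1 - z) / of_real ((norm (1 - z))\<^sup>2)"
    unfolding cayley_def complex_div_cnj[of "\<i> * (1 + z)"] by simp
  then have "Im (cayley z) = Im ((\<i> * (1 + z)) * cnj (1 - z)) / (norm (1 - z))\<^sup>2"
    by (simp only: Im_divide_of_real)
  also have "Im ((\<i> * (1 + z)) * cnj (1 - z)) = 1 - (norm z)\<^sup>2"
    unfolding cmod_power2 by (simp add: algebra_simps power2_eq_square)
  finally show ?thesis .
qed

lemma norm_cayley_inv_less_1: "0 < Im w \<Longrightarrow> norm (cayley_inv w) < 1"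
proof -
  assume w: "0 < Im w"
  have "(norm (w - \<i>))\<^sup>2 < (norm (w + \<i>))\<^sup>2"
    unfolding cmod_power2 using w by (simp add: power2_eq_square algebra_simps)
  then have "norm (w - \<i>) < norm (w + \<i>)" by (rule power_less_imp_less_base) simp
  then show ?thesis by (simp add: cayley_inv_def norm_divide divide_less_eq)
qed

lemma norm_bdry: "norm (bdry x) = 1"
proof -
  have "(norm (of_real x - \<i>))\<^sup>2 = (norm (of_real x + \<i>))\<^sup>2"
    unfolding cmod_power2 by (simp add: power2_eq_square algebra_simps)
  then show ?thesis using real_i_nz[of x] by (simp add: bdry_def cayley_inv_def norm_divide)
qed

lemma bdry_ne_1: "bdry x \<noteq> 1"
proof
  assume "bdry x = 1"
  then have "of_real x - \<i> = of_real x + \<i>" using real_i_nz[of x] by (simp add: bdry_def cayley_inv_def)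
  then show False by (simp add: complex_eq_iff)
qed

lemma cayley_bdry: "cayley (bdry x) = of_real x"
  unfolding bdry_def by (rule cayley_cayley_inv[OF real_i_nz])

lemma upper_ne: "0 < Im w \<Longrightarrow> w \<noteq> of_real x" "0 < Im w \<Longrightarrow> w + \<i> \<noteq> 0"
  by (auto simp: complex_eq_iff)

text \<open>For \<open>\<zeta> = h\<^sup>-\<^sup>1(x)\<close> and \<open>z = h\<^sup>-\<^sup>1(w)\<close> the kernel \<open>(\<zeta> + z)/(\<zeta> - z)\<close> equals \<open>\<i>(1 + xw)/(w - x)\<close>.\<close>

lemma herglotz_kernel_cayley:
  assumes w: "0 < Im w"
  shows "cauchy_weight x *\<^sub>R ((bdry x + cayley_inv w) / (bdry x - cayley_inv w) * c / of_real (2 * pi))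
           = hp_herglotz w x * c"
proof -
  let ?x = "of_real x :: complex"
  have n: "?x + \<i> \<noteq> 0" "w + \<i> \<noteq> 0" "w - ?x \<noteq> 0" using real_i_nz upper_ne[OF w] by auto
  have 1: "bdry x + cayley_inv w = 2 * (1 + ?x * w) / ((?x + \<i>) * (w + \<i>))"
    using n by (simp add: bdry_def cayley_inv_def divide_simps) (simp add: algebra_simps)
  have 2: "bdry x - cayley_inv w = - 2 * \<i> * (w - ?x) / ((?x + \<i>) * (w + \<i>))"
    using n by (simp add: bdry_def cayley_inv_def divide_simps) (simp add: algebra_simps)
  have "(bdry x + cayley_inv w) / (bdry x - cayley_inv w) = 2 * (1 + ?x * w) / (- 2 * \<i> * (w - ?x))"
    unfolding 1 2 using n by simp
  also have "\<dots> = \<i> * (1 + ?x * w) / (w - ?x)"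
    using n by (simp add: divide_simps)
  finally have 3: "(bdry x + cayley_inv w) / (bdry x - cayley_inv w) = \<i> * (1 + ?x * w) / (w - ?x)" .
  have gen: "2 / P * (A / D * c / (2 * p)) = A / (D * (p * P)) * c" for A D p P :: complex
    by simp
  show ?thesis
    unfolding 3 hp_herglotz_def cauchy_weight_def scaleR_conv_of_real
    using gen[of "of_real (1 + x\<^sup>2)" "\<i> * (1 + ?x * w)" "w - ?x" "of_real pi"] by simp
qed

lemma Re_hp_herglotz: "Re (hp_herglotz w x) = hp_poisson w x"
proof -
  have "hp_herglotz w x = (\<i> * (1 + of_real x * w) / (w - of_real x)) / of_real (pi * (1 + x\<^sup>2))"
    by (simp add: hp_herglotz_def)
  also have "\<dots> = (\<i> * (1 + of_real x * w) * cnj (w - of_real x)) / of_real ((norm (w - of_real x))\<^sup>2) / of_real (pi * (1 + x\<^sup>2))"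
    unfolding complex_div_cnj[of "\<i> * (1 + of_real x * w)"] by simp
  finally have "Re (hp_herglotz w x) = Re (\<i> * (1 + of_real x * w) * cnj (w - of_real x)) / (norm (w - of_real x))\<^sup>2 / (pi * (1 + x\<^sup>2))"
    by (simp only: Re_divide_of_real)
  also have "Re (\<i> * (1 + of_real x * w) * cnj (w - of_real x)) = Im w * (1 + x\<^sup>2)"
    by (simp add: algebra_simps power2_eq_square)
  finally show ?thesis
    using one_plus_square_pos[of x] by (simp add: hp_poisson_def)
qed

text \<open>As \<open>(1 + xw)/(w - x) = (1 + w\<^sup>2)/(w - x) - w\<close> and \<open>\<bar>w - x\<bar> \<ge> Im w\<close>, the kernel is a bounded
  multiple of the density of arc length. This makes all integrals below converge.\<close>

lemma hp_herglotz_bound: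
  assumes w: "0 < Im w"
  obtains C where "0 \<le> C" "\<And>x. norm (hp_herglotz w x) \<le> C * cauchy_weight x"
proof
  let ?C = "(norm w + norm (1 + w\<^sup>2) / Im w) / (2 * pi)"
  show "0 \<le> ?C" using w by simp
  fix x
  let ?x = "of_real x :: complex"
  have n: "w - ?x \<noteq> 0" using upper_ne[OF w] by simp
  have im: "Im w \<le> norm (w - ?x)" using abs_Im_le_cmod[of "w - ?x"] by simp
  have "(1 + ?x * w) / (w - ?x) = (1 + w\<^sup>2) / (w - ?x) - w"
    using n by (simp add: divide_simps) (simp add: algebra_simps power2_eq_square)
  then have "norm ((1 + ?x * w) / (w - ?x)) \<le> norm (1 + w\<^sup>2) / norm (w - ?x) + norm w"
    by (metis norm_divide norm_triangle_ineq4)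
  also have "\<dots> \<le> norm (1 + w\<^sup>2) / Im w + norm w"
    using im w by (intro add_right_mono divide_left_mono mult_pos_pos) auto
  finally have b: "norm ((1 + ?x * w) / (w - ?x)) \<le> norm w + norm (1 + w\<^sup>2) / Im w" by simp
  have "hp_herglotz w x = ((1 + ?x * w) / (w - ?x)) * (\<i> / of_real (pi * (1 + x\<^sup>2)))"
    by (simp add: hp_herglotz_def)
  then have "norm (hp_herglotz w x) = norm ((1 + ?x * w) / (w - ?x)) * (cauchy_weight x / (2 * pi))"
    by (simp add: norm_mult norm_divide cauchy_weight_def del: of_real_mult of_real_add)
  also have "\<dots> \<le> (norm w + norm (1 + w\<^sup>2) / Im w) * (cauchy_weight x / (2 * pi))"
    by (intro mult_right_mono b) simp
  finally show "norm (hp_herglotz w x) \<le> ?C * cauchy_weight x" by simp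
qed

lemma borel_measurable_kernels [measurable]:
  "hp_herglotz w \<in> borel_measurable borel" "hp_poisson w \<in> borel_measurable borel"
  unfolding hp_herglotz_def hp_poisson_def by measurable

lemma lebesgue_weight_measurable_iff:
  fixes u :: "real \<Rightarrow> real"
  shows "(\<lambda>x. cauchy_weight x * u x) \<in> borel_measurable lebesgue \<longleftrightarrow> u \<in> borel_measurable lebesgue"
proof
  have [measurable]: "cauchy_weight \<in> borel_measurable lebesgue"
    using integrable_cauchy_weight by auto
  assume [measurable]: "(\<lambda>x. cauchy_weight x * u x) \<in> borel_measurable lebesgue"
  have "(\<lambda>x. (cauchy_weight x * u x) / cauchy_weight x) \<in> borel_measurable lebesgue" by measurable
  then show "u \<in> borel_measurable lebesgue" by simp
next
  have [measurable]: "cauchy_weight \<in> borel_measurable lebesgue"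
    using integrable_cauchy_weight by auto
  assume [measurable]: "u \<in> borel_measurable lebesgue"
  show "(\<lambda>x. cauchy_weight x * u x) \<in> borel_measurable lebesgue" by measurable
qed

lemma borel_imp_lebesgue_measurable: "f \<in> borel_measurable borel \<Longrightarrow> f \<in> borel_measurable lebesgue"
  by (auto intro: measurable_completion)

lemma integrable_hp_herglotz:
  assumes w: "0 < Im w" and u: "integrable lebesgue (\<lambda>x. cauchy_weight x * u x)"
  shows "integrable lebesgue (\<lambda>x. hp_herglotz w x * of_real (u x))"
    and "integrable lebesgue (\<lambda>x. hp_poisson w x * u x)"
proof -
  obtain C where C: "0 \<le> C" "\<And>x. norm (hp_herglotz w x) \<le> C * cauchy_weight x"
    using hp_herglotz_bound[OF w] by blast
  have [measurable]: "u \<in> borel_measurable lebesgue" "hp_herglotz w \<in> borel_measurable lebesgue"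
    using u lebesgue_weight_measurable_iff[of u] by (auto intro: borel_imp_lebesgue_measurable)
  show 1: "integrable lebesgue (\<lambda>x. hp_herglotz w x * of_real (u x))"
  proof (rule Bochner_Integration.integrable_bound)
    show "integrable lebesgue (\<lambda>x. C * (cauchy_weight x * u x))" using u by simp
    show "AE x in lebesgue. norm (hp_herglotz w x * of_real (u x)) \<le> norm (C * (cauchy_weight x * u x))"
      using C by (intro AE_I2) (auto simp: norm_mult abs_mult mult.assoc[symmetric] intro!: mult_right_mono)
  qed measurable
  show "integrable lebesgue (\<lambda>x. hp_poisson w x * u x)"
    using integrable_Re[OF 1] by (simp add: Re_hp_herglotz)
qed

lemma outer_fun_cayley_inv:
  assumes "0 < Im w"
  shows "outer_fun f (cayley_inv w) = exp (LINT x|lebesgue. hp_herglotz w x * of_real (ln (f (bdry x))))"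
  unfolding outer_fun_def
  by (subst angle_integral) (simp only: herglotz_kernel_cayley[OF assms])

text \<open>The modulus of an outer function is controlled by a real Poisson integral; all arguments about
  \<open>\<bar>F\<bar>\<close> use only this.\<close>

lemma norm_outer_fun_cayley_inv:
  assumes w: "0 < Im w" and u: "integrable lebesgue (\<lambda>x. cauchy_weight x * ln (f (bdry x)))"
  shows "norm (outer_fun f (cayley_inv w)) = exp (LINT x|lebesgue. hp_poisson w x * ln (f (bdry x)))"
  unfolding outer_fun_cayley_inv[OF w]
  by (simp add: integral_Re[OF integrable_hp_herglotz(1)[OF w u], symmetric] Re_hp_herglotz)

text \<open>Conformal invariance of the Poisson kernel, for the affine maps of the half-plane. For the modulus of
  an outer function, composition with \<open>\<phi>\<close> thereby amounts to composing the boundary function with \<open>\<phi>\<close>.\<close>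

lemma hp_poisson_affine:
  assumes "0 < a"
  shows "a * hp_poisson (of_real a * w + of_real t) (t + a * x) = hp_poisson w x"
proof -
  have "of_real a * w + of_real t - of_real (t + a * x) = of_real a * (w - of_real x)"
    by (simp add: algebra_simps)
  then have "norm (of_real a * w + of_real t - of_real (t + a * x)) = a * norm (w - of_real x)"
    using assms by (simp only: norm_mult norm_of_real abs_of_pos)
  then show ?thesis using assms by (simp add: hp_poisson_def power2_eq_square)
qed

text \<open>By affine invariance it suffices to treat \<open>w = \<i>\<close>, where the kernel is the normalized density of
  arc length.\<close>

lemma integral_hp_poisson:
  assumes w: "0 < Im w"
  shows "integrable lebesgue (hp_poisson w)" "(LINT x|lebesgue. hp_poisson w x) = 1"
proof -
  show "integrable lebesgue (hp_poisson w)"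
    using integrable_hp_herglotz(2)[OF w, of "\<lambda>_. 1"] integrable_cauchy_weight by simp
  \<comment> \<open>The affine map \<open>s \<mapsto> Re w + Im w * s\<close> takes \<open>\<i>\<close> to \<open>w\<close>.\<close>
  have k: "Im w * hp_poisson w (Re w + Im w * s) = cauchy_weight s / (2 * pi)" for s
  proof -
    have "of_real (Im w) * \<i> + of_real (Re w) = w" by (simp add: complex_eq_iff)
    then have "Im w * hp_poisson w (Re w + Im w * s) = hp_poisson \<i> s"
      using hp_poisson_affine[OF w, of \<i> "Re w" s] by simp
    also have "\<dots> = cauchy_weight s / (2 * pi)"
      by (simp add: hp_poisson_def cauchy_weight_def cmod_power2 add.commute)
    finally show ?thesis .
  qed
  have "(LINT x|lebesgue. hp_poisson w x) = (LINT s|lebesgue. Im w * hp_poisson w (Re w + Im w * s))"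
    using w by (subst lebesgue_integral_real_affine[of "Im w" _ "Re w"]) auto
  also have "\<dots> = 1" unfolding k by (simp add: integral_cauchy_weight)
  finally show "(LINT x|lebesgue. hp_poisson w x) = 1" .
qed

text \<open>On the imaginary axis the imaginary part of the kernel is odd in \<open>x\<close>. The unimodular factor does
  not depend on the eigenvalue for this reason.\<close>

lemma hp_herglotz_reflect: "Re w = 0 \<Longrightarrow> hp_herglotz w (- x) = cnj (hp_herglotz w x)"
proof -
  assume "Re w = 0"
  then have "cnj w = - w" by (simp add: complex_eq_iff)
  then have "cnj (hp_herglotz w x) = (- \<i> * (1 - of_real x * w)) / ((- w - of_real x) * of_real (pi * (1 + x\<^sup>2)))"
    by (simp add: hp_herglotz_def)
  also have "\<dots> = (\<i> * (1 - of_real x * w)) / ((w + of_real x) * of_real (pi * (1 + x\<^sup>2)))"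
  proof -
    have "(- w - of_real x) * of_real (pi * (1 + x\<^sup>2)) = - ((w + of_real x) * of_real (pi * (1 + x\<^sup>2)))"
      by (simp add: algebra_simps)
    then show ?thesis by (simp only: minus_mult_left[symmetric] divide_minus_left divide_minus_right minus_minus)
  qed
  finally show ?thesis by (simp add: hp_herglotz_def)
qed

section \<open>Outer functions in the Hardy space\<close>

text \<open>The exponent is differentiated under the integral sign. The difference quotient of the kernel
  \<open>(\<zeta> + z)/(\<zeta> - z)\<close> between \<open>w\<close> and \<open>z\<close> is exactly \<open>2\<zeta>/((\<zeta> - w)(\<zeta> - z))\<close>, which is bounded
  uniformly in \<open>\<zeta>\<close> for \<open>w\<close> near \<open>z\<close>, so dominated convergence applies.\<close>

lemma outer_fun_holomorphic:
  assumes u: "integrable (lebesgue_on {-pi..pi}) (\<lambda>\<theta>. ln (f (cis \<theta>)))"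
  shows "outer_fun f holomorphic_on ball 0 1"
proof -
  let ?M = "lebesgue_on {-pi..pi}"
  define u where "u \<theta> = ln (f (cis \<theta>))" for \<theta>
  have ui: "integrable ?M u" using u by (simp add: u_def[abs_def])
  have [measurable]: "cis \<in> borel_measurable ?M"
    by (intro measurable_restrict_space1 borel_imp_lebesgue_measurable borel_measurable_continuous_onI) (intro continuous_intros)
  have [measurable]: "u \<in> borel_measurable ?M" using ui by auto
  define K where "K z \<theta> = (cis \<theta> + z) / (cis \<theta> - z) * of_real (u \<theta>) / of_real (2 * pi)" for z \<theta>
  have nz: "1 - norm z \<le> norm (cis \<theta> - z)" for z \<theta>
    using norm_triangle_ineq2[of "cis \<theta>" z] by simp
  have Kint: "integrable ?M (K z)" if z: "norm z < 1" for z
  proof (rule Bochner_Integration.integrable_bound)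
    show "integrable ?M (\<lambda>\<theta>. (2 / (1 - norm z)) * u \<theta>)" using ui by simp
    show "K z \<in> borel_measurable ?M" unfolding K_def by measurable
    show "AE \<theta> in ?M. norm (K z \<theta>) \<le> norm ((2 / (1 - norm z)) * u \<theta>)"
    proof (intro AE_I2)
      fix \<theta>
      have "norm (cis \<theta> + z) / norm (cis \<theta> - z) \<le> 2 / (1 - norm z)"
        using z nz[of z \<theta>] norm_triangle_ineq[of "cis \<theta>" z] by (intro frac_le) auto
      then have "norm (cis \<theta> + z) / norm (cis \<theta> - z) * \<bar>u \<theta>\<bar> \<le> 2 / (1 - norm z) * \<bar>u \<theta>\<bar>"
        by (intro mult_right_mono) auto
      also have "norm (cis \<theta> + z) / norm (cis \<theta> - z) * \<bar>u \<theta>\<bar> / (2 * pi) \<le> norm (cis \<theta> + z) / norm (cis \<theta> - z) * \<bar>u \<theta>\<bar> / 1"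
        using pi_ge_two by (intro divide_left_mono mult_nonneg_nonneg divide_nonneg_nonneg) auto
      ultimately show "norm (K z \<theta>) \<le> norm ((2 / (1 - norm z)) * u \<theta>)"
        using z by (simp add: K_def norm_mult norm_divide abs_mult)
    qed
  qed
  define H where "H z = (LINT \<theta>|?M. K z \<theta>)" for z
  have "(\<lambda>z. H z) field_differentiable (at z within ball 0 1)" if z: "z \<in> ball 0 1" for z
  proof -
    \<comment> \<open>Points within \<open>r\<close> of \<open>z\<close> keep the distance \<open>r\<close> from the circle.\<close>
    define r where "r = (1 - norm z) / 2"
    have r: "0 < r" "norm z < 1" using z by (auto simp: r_def)
    \<comment> \<open>The difference quotient of \<open>K\<close>, which also makes sense for \<open>w = z\<close>.\<close>
    define D where "D w \<theta> = 2 * cis \<theta> / ((cis \<theta> - w) * (cis \<theta> - z)) * of_real (u \<theta>) / of_real (2 * pi)" for w \<theta>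
    have lim: "((\<lambda>w. LINT \<theta>|?M. D w \<theta>) \<longlongrightarrow> (LINT \<theta>|?M. D z \<theta>)) (at z within ball 0 1)"
      unfolding tendsto_at_iff_sequentially
    proof (intro allI impI)
      fix X assume X: "\<forall>i. X i \<in> ball 0 1 - {z}" "X \<longlonglongrightarrow> z"
      have "\<forall>\<^sub>F n in sequentially. X n \<in> ball z r" using X(2) r by (auto simp: tendsto_iff dist_commute)
      then obtain N where N: "\<And>n. N \<le> n \<Longrightarrow> X n \<in> ball z r" by (auto simp: eventually_sequentially)
      have "(\<lambda>n. LINT \<theta>|?M. D (X (n + N)) \<theta>) \<longlonglongrightarrow> (LINT \<theta>|?M. D z \<theta>)"
      proof (rule integral_dominated_convergence)
        show "integrable ?M (\<lambda>\<theta>. (2 / (r * r)) * \<bar>u \<theta>\<bar>)" using ui by simp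
        show "D z \<in> borel_measurable ?M" "\<And>n. D (X (n + N)) \<in> borel_measurable ?M"
          unfolding D_def by measurable
        have X': "(\<lambda>n. X (n + N)) \<longlonglongrightarrow> z" using X(2) by (rule LIMSEQ_ignore_initial_segment)
        show "AE \<theta> in ?M. (\<lambda>n. D (X (n + N)) \<theta>) \<longlonglongrightarrow> D z \<theta>"
          unfolding D_def using r nz[of z] by (intro AE_I2 tendsto_intros X') force+
        show "AE \<theta> in ?M. norm (D (X (n + N)) \<theta>) \<le> (2 / (r * r)) * \<bar>u \<theta>\<bar>" for n
        proof (intro AE_I2)
          fix \<theta>
          have "norm (X (n + N)) \<le> norm z + r"
            using N[of "n + N"] norm_triangle_ineq2[of "X (n + N)" z] by (auto simp: dist_norm norm_minus_commute)
          then have d: "r \<le> norm (cis \<theta> - X (n + N))" "r \<le> norm (cis \<theta> - z)"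
            using nz[of "X (n + N)" \<theta>] nz[of z \<theta>] r by (auto simp: r_def field_simps)
          have "2 / (norm (cis \<theta> - X (n + N)) * norm (cis \<theta> - z)) \<le> 2 / (r * r)"
            using d r by (intro frac_le mult_mono) auto
          then have "2 / (norm (cis \<theta> - X (n + N)) * norm (cis \<theta> - z)) * \<bar>u \<theta>\<bar> \<le> 2 / (r * r) * \<bar>u \<theta>\<bar>"
            by (intro mult_right_mono) auto
          moreover have "2 / (norm (cis \<theta> - X (n + N)) * norm (cis \<theta> - z)) * \<bar>u \<theta>\<bar> / (2 * pi)
              \<le> 2 / (norm (cis \<theta> - X (n + N)) * norm (cis \<theta> - z)) * \<bar>u \<theta>\<bar> / 1"
            using pi_ge_two by (intro divide_left_mono mult_nonneg_nonneg divide_nonneg_nonneg) auto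
          ultimately show "norm (D (X (n + N)) \<theta>) \<le> (2 / (r * r)) * \<bar>u \<theta>\<bar>"
            by (simp add: D_def norm_mult norm_divide abs_mult)
        qed
      qed
      then show "((\<lambda>w. LINT \<theta>|?M. D w \<theta>) \<circ> X) \<longlonglongrightarrow> (LINT \<theta>|?M. D z \<theta>)"
        unfolding comp_def by (rule LIMSEQ_offset)
    qed
    have eq: "(H w - H z) / (w - z) = (LINT \<theta>|?M. D w \<theta>)" if w: "w \<in> ball 0 1" "w \<noteq> z" for w
    proof -
      have "(K w \<theta> - K z \<theta>) / (w - z) = D w \<theta>" for \<theta>
      proof -
        have n: "cis \<theta> - w \<noteq> 0" "cis \<theta> - z \<noteq> 0" "w - z \<noteq> 0"
          using nz[of w \<theta>] nz[of z \<theta>] w r by auto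
        have "(c + w) / (c - w) - (c + z) / (c - z) = (w - z) * (2 * c / ((c - w) * (c - z)))"
          if "c - w \<noteq> 0" "c - z \<noteq> 0" for c
          using that by (simp add: divide_simps) (simp add: algebra_simps)
        from this[OF n(1,2)] have "K w \<theta> - K z \<theta> = (w - z) * (2 * cis \<theta> / ((cis \<theta> - w) * (cis \<theta> - z))) * of_real (u \<theta>) / of_real (2 * pi)"
          unfolding K_def by (simp only: diff_divide_distrib[symmetric] left_diff_distrib[symmetric])
        then show ?thesis using n(3) by (simp add: D_def)
      qed
      then show ?thesis
        unfolding H_def using Kint[of w] Kint[of z] w r
        by (simp flip: Bochner_Integration.integral_diff Bochner_Integration.integral_divide)
    qed
    have "((\<lambda>w. (H w - H z) / (w - z)) \<longlongrightarrow> (LINT \<theta>|?M. D z \<theta>)) (at z within ball 0 1)"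
      by (rule Lim_transform_eventually[OF lim])
         (auto simp: eventually_at_filter eq intro!: always_eventually)
    then show ?thesis
      unfolding field_differentiable_def has_field_derivative_iff by blast
  qed
  then have "H holomorphic_on ball 0 1" by (simp add: holomorphic_on_def)
  moreover have "outer_fun f = (\<lambda>z. exp (H z))"
    by (simp add: outer_fun_def[abs_def] H_def K_def u_def)
  ultimately show ?thesis by (auto intro!: holomorphic_intros)
qed

lemma hp_poisson_nonneg: "0 < Im w \<Longrightarrow> 0 \<le> hp_poisson w x"
  by (simp add: hp_poisson_def)

text \<open>Jensen's inequality for the probability density \<open>P\<^sub>w\<close>: integrate the tangent line inequality
  \<open>e\<^sup>m (1 + u - m) \<le> e\<^sup>u\<close> at the mean value \<open>m\<close> of \<open>u\<close>.\<close>

lemma jensen_hp_poisson: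
  assumes w: "0 < Im w" and u: "integrable lebesgue (\<lambda>x. cauchy_weight x * u x)"
    and eu: "integrable lebesgue (\<lambda>x. cauchy_weight x * exp (u x))"
  shows "exp (LINT x|lebesgue. hp_poisson w x * u x) \<le> (LINT x|lebesgue. hp_poisson w x * exp (u x))"
proof -
  define m where "m = (LINT x|lebesgue. hp_poisson w x * u x)"
  note P = integral_hp_poisson[OF w] and Pu = integrable_hp_herglotz(2)[OF w u]
  \<comment> \<open>The tangent line at \<open>m\<close>, as a combination of functions with known integrals.\<close>
  have eq: "hp_poisson w x * (exp m * (1 + (u x - m))) =
      exp m * (1 - m) * hp_poisson w x + exp m * (hp_poisson w x * u x)" for x
    by (simp add: algebra_simps)
  have "exp m = (LINT x|lebesgue. hp_poisson w x * (exp m * (1 + (u x - m))))"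
    unfolding eq using P Pu by (simp add: m_def[symmetric]) (simp add: algebra_simps)
  also have "\<dots> \<le> (LINT x|lebesgue. hp_poisson w x * exp (u x))"
  proof (rule integral_mono)
    show "integrable lebesgue (\<lambda>x. hp_poisson w x * (exp m * (1 + (u x - m))))"
      unfolding eq using P Pu by simp
    show "integrable lebesgue (\<lambda>x. hp_poisson w x * exp (u x))"
      by (rule integrable_hp_herglotz(2)[OF w eu])
    fix x
    have "exp m * (1 + (u x - m)) \<le> exp m * exp (u x - m)"
      by (intro mult_left_mono exp_ge_add_one_self) simp
    also have "\<dots> = exp (u x)" by (simp flip: exp_add)
    finally show "hp_poisson w x * (exp m * (1 + (u x - m))) \<le> hp_poisson w x * exp (u x)"
      by (intro mult_left_mono hp_poisson_nonneg w)
  qed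
  finally show ?thesis by (simp add: m_def)
qed

text \<open>The Poisson kernel of the disc, normalized to have integral \<open>1\<close> with respect to the angle.\<close>

definition disc_poisson :: "complex \<Rightarrow> complex \<Rightarrow> real" where
  "disc_poisson z \<zeta> = (1 - (norm z)\<^sup>2) / (2 * pi * (norm (\<zeta> - z))\<^sup>2)"

lemma disc_poisson_cayley:
  assumes w: "0 < Im w"
  shows "cauchy_weight x * disc_poisson (cayley_inv w) (bdry x) = hp_poisson w x"
proof -
  define z \<zeta> where "z = cayley_inv w" and "\<zeta> = bdry x"
  have "Re ((\<zeta> + z) / (\<zeta> - z)) = (1 - (norm z)\<^sup>2) / (norm (\<zeta> - z))\<^sup>2"
  proof -
    have "(\<zeta> + z) / (\<zeta> - z) = (\<zeta> + z) * cnj (\<zeta> - z) / of_real ((norm (\<zeta> - z))\<^sup>2)"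
      unfolding complex_div_cnj[of "\<zeta> + z"] by simp
    then have "Re ((\<zeta> + z) / (\<zeta> - z)) = Re ((\<zeta> + z) * cnj (\<zeta> - z)) / (norm (\<zeta> - z))\<^sup>2"
      by (simp only: Re_divide_of_real)
    also have "Re ((\<zeta> + z) * cnj (\<zeta> - z)) = (norm \<zeta>)\<^sup>2 - (norm z)\<^sup>2"
      unfolding cmod_power2 by (simp add: algebra_simps power2_eq_square)
    finally show ?thesis by (simp add: \<zeta>_def norm_bdry)
  qed
  then have "cauchy_weight x * disc_poisson z \<zeta> = Re (cauchy_weight x *\<^sub>R ((\<zeta> + z) / (\<zeta> - z) * 1 / of_real (2 * pi)))"
    unfolding scaleR_complex.sel Re_divide_of_real by (simp add: disc_poisson_def)
  also have "\<dots> = hp_poisson w x"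
    unfolding z_def \<zeta>_def herglotz_kernel_cayley[OF w] by (simp add: Re_hp_herglotz)
  finally show ?thesis by (simp add: z_def \<zeta>_def)
qed

text \<open>The distances \<open>\<bar>e\<^sup>i\<^sup>\<theta> - r e\<^sup>i\<^sup>\<phi>\<bar>\<close> and \<open>\<bar>e\<^sup>i\<^sup>\<phi> - r e\<^sup>i\<^sup>\<theta>\<bar>\<close> agree, since both depend only on the
  difference of the angles. Hence the kernel has integral \<open>1\<close> in the other variable as well.\<close>

lemma disc_poisson_swap: "disc_poisson (of_real r * cis \<phi>) (cis \<theta>) = disc_poisson (of_real r * cis \<theta>) (cis \<phi>)"
proof -
  have "(norm (cis \<theta> - of_real r * cis \<phi>))\<^sup>2 = 1 + r\<^sup>2 - 2 * r * (cos \<theta> * cos \<phi> + sin \<theta> * sin \<phi>)" for \<theta> \<phi>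
  proof -
    have "(norm (cis \<theta> - of_real r * cis \<phi>))\<^sup>2 = ((cos \<theta>)\<^sup>2 + (sin \<theta>)\<^sup>2) + r\<^sup>2 * ((cos \<phi>)\<^sup>2 + (sin \<phi>)\<^sup>2)
        - 2 * r * (cos \<theta> * cos \<phi> + sin \<theta> * sin \<phi>)"
      unfolding cmod_power2 unfolding power2_eq_square by (simp add: algebra_simps del: sin_cos_squared_add3)
    then show ?thesis by (simp only: sin_cos_squared_add2 mult_1_right)
  qed
  from this[of \<theta> \<phi>] this[of \<phi> \<theta>]
  have "(norm (cis \<theta> - of_real r * cis \<phi>))\<^sup>2 = (norm (cis \<phi> - of_real r * cis \<theta>))\<^sup>2"
    by (simp only: mult.commute[of "cos \<theta>"] mult.commute[of "sin \<theta>"])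
  then show ?thesis unfolding disc_poisson_def by (simp only: norm_mult norm_cis)
qed

lemma ball_cayley_inv:
  assumes "z \<in> ball 0 1" obtains w where "0 < Im w" "z = cayley_inv w"
proof
  have "z \<noteq> 1" using assms by auto
  then show "z = cayley_inv (cayley z)" by (simp add: cayley_inv_cayley)
  have "(norm z)\<^sup>2 < 1" using assms by (simp add: power_less_one_iff)
  then show "0 < Im (cayley z)" using \<open>z \<noteq> 1\<close> by (simp add: Im_cayley)
qed

lemma integral_disc_poisson:
  assumes "z \<in> ball 0 1"
  shows "integrable (lebesgue_on {-pi..pi}) (\<lambda>\<theta>. disc_poisson z (cis \<theta>))"
    "(LINT \<theta>|lebesgue_on {-pi..pi}. disc_poisson z (cis \<theta>)) = 1"
proof -
  obtain w where w: "0 < Im w" "z = cayley_inv w" using ball_cayley_inv[OF assms] .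
  show "integrable (lebesgue_on {-pi..pi}) (\<lambda>\<theta>. disc_poisson z (cis \<theta>))"
    "(LINT \<theta>|lebesgue_on {-pi..pi}. disc_poisson z (cis \<theta>)) = 1"
    using integral_hp_poisson[OF w(1)]
    by (simp_all add: angle_integrable angle_integral w(2) disc_poisson_cayley[OF w(1)])
qed

text \<open>Jensen's inequality for \<open>u = p log f\<close>.\<close>

lemma norm_outer_fun_powr_le:
  assumes f: "log_in_L1 circle_measure f" "in_Lp p circle_measure f" and z: "z \<in> ball 0 1"
  shows "norm (outer_fun f z) powr p
     \<le> (LINT \<theta>|lebesgue_on {-pi..pi}. disc_poisson z (cis \<theta>) * \<bar>f (cis \<theta>)\<bar> powr p)" (is "_ \<le> ?I")
    and "integrable (lebesgue_on {-pi..pi}) (\<lambda>\<theta>. disc_poisson z (cis \<theta>) * \<bar>f (cis \<theta>)\<bar> powr p)" (is ?A)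
proof -
  obtain w where w: "0 < Im w" "z = cayley_inv w" using ball_cayley_inv[OF z] .
  have u: "integrable lebesgue (\<lambda>x. cauchy_weight x * ln (f (bdry x)))" "AE x in lebesgue. 0 < f (bdry x)"
    using f(1) by (auto simp: log_in_L1_circle_iff)
  have fp: "integrable lebesgue (\<lambda>x. cauchy_weight x * \<bar>f (bdry x)\<bar> powr p)"
    using f(2) by (auto simp: in_Lp_def circle_integrable_iff)
  have [measurable]: "cauchy_weight \<in> borel_measurable lebesgue" "hp_poisson w \<in> borel_measurable lebesgue"
      "(\<lambda>x. ln (f (bdry x))) \<in> borel_measurable lebesgue" "(\<lambda>x. \<bar>f (bdry x)\<bar> powr p) \<in> borel_measurable lebesgue"
    using lebesgue_weight_measurable_iff[of "\<lambda>x. ln (f (bdry x))"] u(1)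
      lebesgue_weight_measurable_iff[of "\<lambda>x. \<bar>f (bdry x)\<bar> powr p"] fp
    by (auto intro: borel_imp_lebesgue_measurable)
  have ae: "AE x in lebesgue. \<bar>f (bdry x)\<bar> powr p = exp (p * ln (f (bdry x)))"
    using u(2) by eventually_elim (simp add: powr_def)
  have eu: "integrable lebesgue (\<lambda>x. cauchy_weight x * exp (p * ln (f (bdry x))))"
    by (rule integrable_cong_AE_imp[OF fp]) (use ae in \<open>auto elim: eventually_mono\<close>)
  have pu: "integrable lebesgue (\<lambda>x. cauchy_weight x * (p * ln (f (bdry x))))"
    using integrable_mult_right[OF u(1), of p] by (simp add: ac_simps)
  have "norm (outer_fun f z) powr p = exp (LINT x|lebesgue. hp_poisson w x * (p * ln (f (bdry x))))"
    unfolding w(2) norm_outer_fun_cayley_inv[OF w(1) u(1)]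
    by (simp add: powr_def mult.left_commute[of _ p])
  also have "\<dots> \<le> (LINT x|lebesgue. hp_poisson w x * exp (p * ln (f (bdry x))))"
    by (rule jensen_hp_poisson[OF w(1) pu eu])
  also have "\<dots> = (LINT x|lebesgue. hp_poisson w x * \<bar>f (bdry x)\<bar> powr p)"
    by (rule integral_cong_AE) (use ae in \<open>auto elim: eventually_mono\<close>)
  also have "\<dots> = ?I"
    using angle_integral[of "\<lambda>\<zeta>. disc_poisson z \<zeta> * \<bar>f \<zeta>\<bar> powr p"]
    by (simp add: mult.assoc[symmetric] w(2) disc_poisson_cayley[OF w(1)])
  finally show "norm (outer_fun f z) powr p \<le> ?I" .
  show ?A
    using integrable_hp_herglotz(2)[OF w(1) fp] angle_integrable[of "\<lambda>\<zeta>. disc_poisson z \<zeta> * \<bar>f \<zeta>\<bar> powr p"]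
    by (simp add: mult.assoc[symmetric] w(2) disc_poisson_cayley[OF w(1)])
qed

text \<open>By Jensen's inequality \<open>\<bar>F\<bar>\<^sup>p\<close> is at most the Poisson integral of \<open>f\<^sup>p\<close>. Integrating over a circle
  of radius \<open>r\<close> and exchanging the order of integration bounds the means of \<open>\<bar>F\<bar>\<^sup>p\<close> by the integral of
  \<open>f\<^sup>p\<close>, independently of \<open>r\<close>.\<close>

lemma outer_fun_hardy:
  assumes f: "log_in_L1 circle_measure f" "in_Lp p circle_measure f"
  shows "outer_fun f \<in> hardy_space p"
proof -
  let ?M = "lebesgue_on {-pi..pi}"
  interpret M: finite_measure ?M by (intro finite_measure_lebesgue_on) simp
  interpret MM: pair_sigma_finite ?M ?M ..
  have [measurable]: "cis \<in> borel_measurable ?M"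
    by (intro measurable_restrict_space1 borel_imp_lebesgue_measurable borel_measurable_continuous_onI) (intro continuous_intros)
  define g where "g \<theta> = \<bar>f (cis \<theta>)\<bar> powr p" for \<theta>
  have gi: "integrable ?M g"
    using f(2) angle_integrable[of "\<lambda>\<zeta>. \<bar>f \<zeta>\<bar> powr p"] unfolding g_def
    by (simp add: in_Lp_def circle_integrable_iff)
  have [measurable]: "g \<in> borel_measurable ?M" using gi by auto
  have g0: "0 \<le> g \<theta>" for \<theta> by (simp add: g_def)
  have bound: "(LINT \<phi>|?M. norm (outer_fun f (of_real r * cis \<phi>)) powr p / (2 * pi)) \<le> (LINT \<theta>|?M. g \<theta>)"
    if r: "0 \<le> r" "r < 1" for r
  proof (rule integral_real_bounded)
    have b: "of_real r * cis \<phi> \<in> ball 0 1" for \<phi> using r by (simp add: norm_mult)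
    have dp0: "0 \<le> disc_poisson (of_real r * cis \<phi>) (cis \<theta>)" for \<phi> \<theta>
      using r by (simp add: disc_poisson_def norm_mult power_le_one)
    have "norm (outer_fun f (of_real r * cis \<phi>)) powr p / (2 * pi) \<le>
        (LINT \<theta>|?M. disc_poisson (of_real r * cis \<phi>) (cis \<theta>) * g \<theta>)" for \<phi>
    proof -
      have "norm (outer_fun f (of_real r * cis \<phi>)) powr p / (2 * pi) \<le> norm (outer_fun f (of_real r * cis \<phi>)) powr p / 1"
        using pi_ge_two by (intro divide_left_mono) auto
      then show ?thesis
        using norm_outer_fun_powr_le(1)[OF f b[of \<phi>]] by (simp add: g_def)
    qed
    then have "(\<integral>\<^sup>+ \<phi>. ennreal (norm (outer_fun f (of_real r * cis \<phi>)) powr p / (2 * pi)) \<partial>?M) \<le>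
        (\<integral>\<^sup>+ \<phi>. ennreal (LINT \<theta>|?M. disc_poisson (of_real r * cis \<phi>) (cis \<theta>) * g \<theta>) \<partial>?M)"
      by (intro nn_integral_mono ennreal_leI)
    also have "\<dots> = (\<integral>\<^sup>+ \<phi>. (\<integral>\<^sup>+ \<theta>. ennreal (disc_poisson (of_real r * cis \<phi>) (cis \<theta>) * g \<theta>) \<partial>?M) \<partial>?M)"
      using norm_outer_fun_powr_le(2)[OF f b] dp0 g0
      by (subst nn_integral_eq_integral) (auto simp: g_def)
    also have "\<dots> = (\<integral>\<^sup>+ \<theta>. (\<integral>\<^sup>+ \<phi>. ennreal (disc_poisson (of_real r * cis \<phi>) (cis \<theta>) * g \<theta>) \<partial>?M) \<partial>?M)"
      unfolding disc_poisson_def by (rule MM.Fubini') measurable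
    also have "\<dots> = (\<integral>\<^sup>+ \<theta>. (\<integral>\<^sup>+ \<phi>. ennreal (g \<theta>) * ennreal (disc_poisson (of_real r * cis \<theta>) (cis \<phi>)) \<partial>?M) \<partial>?M)"
    proof (intro nn_integral_cong)
      fix \<theta> \<phi>
      show "ennreal (disc_poisson (of_real r * cis \<phi>) (cis \<theta>) * g \<theta>)
          = ennreal (g \<theta>) * ennreal (disc_poisson (of_real r * cis \<theta>) (cis \<phi>))"
        unfolding disc_poisson_swap[of r \<phi> \<theta>] using dp0 g0 by (simp add: ennreal_mult mult.commute)
    qed
    also have "\<dots> = (\<integral>\<^sup>+ \<theta>. ennreal (g \<theta>) * (\<integral>\<^sup>+ \<phi>. ennreal (disc_poisson (of_real r * cis \<theta>) (cis \<phi>)) \<partial>?M) \<partial>?M)"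
      unfolding disc_poisson_def by (subst nn_integral_cmult) measurable
    also have "\<dots> = (\<integral>\<^sup>+ \<theta>. ennreal (g \<theta>) \<partial>?M)"
      using integral_disc_poisson[OF b] dp0 by (subst nn_integral_eq_integral) auto
    also have "\<dots> = ennreal (LINT \<theta>|?M. g \<theta>)"
      using gi g0 by (intro nn_integral_eq_integral) auto
    finally show "(\<integral>\<^sup>+ \<phi>. ennreal (norm (outer_fun f (of_real r * cis \<phi>)) powr p / (2 * pi)) \<partial>?M) \<le> ennreal (LINT \<theta>|?M. g \<theta>)" .
  qed (simp add: g0)
  have "integrable ?M (\<lambda>\<theta>. ln (f (cis \<theta>)))"
    using f(1)[unfolded log_in_L1_circle_iff] angle_integrable[of "\<lambda>\<zeta>. ln (f \<zeta>)"] by simp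
  then show ?thesis
    using bound outer_fun_holomorphic[of f]
    by (auto simp: hardy_space_def bdd_above_def intro!: exI[of _ "LINT \<theta>|?M. g \<theta>"])
qed

text \<open>The quotient \<open>F/G\<close> has constant modulus \<open>1\<close>, hence is constant by the maximum principle.\<close>

lemma equal_modulus_imp_unimodular_multiple:
  assumes F: "F holomorphic_on ball 0 1" and G: "G holomorphic_on ball 0 1"
    and nz: "\<And>z. z \<in> ball 0 1 \<Longrightarrow> G z \<noteq> 0"
    and eq: "\<And>z. z \<in> ball 0 1 \<Longrightarrow> norm (F z) = norm (G z)"
  shows "\<exists>\<gamma>\<in>sphere 0 1. \<forall>z\<in>ball 0 1. F z = \<gamma> * G z"
proof -
  let ?q = "\<lambda>z. F z / G z"
  have 1: "norm (?q z) = 1" if "z \<in> ball 0 1" for z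
    using eq[OF that] nz[OF that] by (simp add: norm_divide)
  have "?q constant_on ball 0 1"
    by (rule maximum_modulus_principle[where U = "ball 0 1" and \<xi> = 0])
       (use 1 nz in \<open>auto intro!: holomorphic_intros F G\<close>)
  then obtain \<gamma> where \<gamma>: "\<And>z. z \<in> ball 0 1 \<Longrightarrow> ?q z = \<gamma>" by (auto simp: constant_on_def)
  have "norm \<gamma> = 1" using 1[of 0] \<gamma>[of 0] by simp
  moreover have "F z = \<gamma> * G z" if "z \<in> ball 0 1" for z
    using \<gamma>[OF that] nz[OF that] by (simp add: field_simps)
  ultimately show ?thesis by (intro bexI[of _ \<gamma>]) auto
qed

section \<open>Uniqueness for Poisson integrals\<close>

text \<open>The Poisson kernel has an explicit antiderivative in the real part of the point. Integrating a
  Poisson integral over a horizontal segment therefore gives an integral against a difference of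
  arctangents, which approximates an indicator function near the boundary.\<close>

lemma arctan_scaled_deriv:
  assumes "0 < y"
  shows "((\<lambda>x. arctan ((x - s) / y)) has_real_derivative pi * hp_poisson (Complex x y) s) (at x within S)"
proof -
  have "((\<lambda>x. arctan ((x - s) / y)) has_real_derivative inverse (1 + ((x - s) / y)\<^sup>2) * (1 / y)) (at x within S)"
    using assms by (auto intro!: derivative_eq_intros simp: field_simps)
  also have "inverse (1 + ((x - s) / y)\<^sup>2) * (1 / y) = pi * hp_poisson (Complex x y) s"
  proof -
    have "y\<^sup>2 * (1 + ((x - s) / y)\<^sup>2) = (x - s)\<^sup>2 + y\<^sup>2"
      using assms by (simp add: field_simps)
    then have "pi * hp_poisson (Complex x y) s = y / (y\<^sup>2 * (1 + ((x - s) / y)\<^sup>2))"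
      by (simp add: hp_poisson_def cmod_power2)
    also have "\<dots> = 1 / (y * (1 + ((x - s) / y)\<^sup>2))"
      using assms by (simp add: power2_eq_square)
    finally show ?thesis by (simp add: field_simps)
  qed
  finally show ?thesis .
qed

lemma one_plus_square_le:
  fixes x s R :: real
  assumes "\<bar>x\<bar> \<le> R" shows "1 + s\<^sup>2 \<le> 1 + 2 * R\<^sup>2 + 2 * (x - s)\<^sup>2"
proof -
  have "x\<^sup>2 \<le> R\<^sup>2" using power_mono[OF assms abs_ge_zero, of 2] by simp
  moreover have "0 \<le> (s - 2 * x)\<^sup>2" by simp
  ultimately show ?thesis by (simp add: power2_eq_square algebra_simps)
qed

text \<open>A bound that does not depend on \<open>x\<close> in a bounded set, as needed to exchange integrals; it degenerates
  for \<open>y \<rightarrow> 0\<close>.\<close>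

lemma hp_poisson_bound_uniform:
  assumes y: "0 < y" and x: "\<bar>x\<bar> \<le> R"
  shows "hp_poisson (Complex x y) s \<le> y * (2 + (1 + 2 * R\<^sup>2) / y\<^sup>2) / (2 * pi) * cauchy_weight s"
proof -
  let ?C = "2 + (1 + 2 * R\<^sup>2) / y\<^sup>2"
  have pos: "0 < (x - s)\<^sup>2 + y\<^sup>2" using y by (simp add: add_nonneg_pos)
  have "1 + s\<^sup>2 \<le> (1 + 2 * R\<^sup>2) / y\<^sup>2 * y\<^sup>2 + 2 * (x - s)\<^sup>2"
    using one_plus_square_le[OF x, of s] y by simp
  also have "\<dots> \<le> ?C * ((x - s)\<^sup>2 + y\<^sup>2)"
  proof -
    have "K * y\<^sup>2 + 2 * (x - s)\<^sup>2 \<le> (2 + K) * ((x - s)\<^sup>2 + y\<^sup>2)" if "0 \<le> K" for K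
      unfolding distrib_left distrib_right using that by simp
    from this[of "(1 + 2 * R\<^sup>2) / y\<^sup>2"] show ?thesis by simp
  qed
  finally have "1 + s\<^sup>2 \<le> ?C * ((x - s)\<^sup>2 + y\<^sup>2)" .
  then have "1 / ((x - s)\<^sup>2 + y\<^sup>2) \<le> ?C / (1 + s\<^sup>2)"
    using pos by (simp add: field_simps)
  then have "(y / pi) * (1 / ((x - s)\<^sup>2 + y\<^sup>2)) \<le> (y / pi) * (?C / (1 + s\<^sup>2))"
    using y by (intro mult_left_mono) auto
  then show ?thesis by (simp add: hp_poisson_def cmod_power2 cauchy_weight_def)
qed

text \<open>Here the constant has to be independent of \<open>y\<close>. Near the interval the difference is bounded by
  \<open>\<pi>\<close>; far from it, the mean value theorem expresses it by the Poisson kernel at a point of distance at least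
  \<open>1\<close> from \<open>s\<close>.\<close>

lemma arctan_difference_bound:
  assumes ab: "a < (b::real)"
  obtains C where "0 \<le> C"
    "\<And>s y. 0 < y \<Longrightarrow> y \<le> 1 \<Longrightarrow> \<bar>arctan ((b - s) / y) - arctan ((a - s) / y)\<bar> \<le> C * cauchy_weight s"
proof -
  \<comment> \<open>The two entries of the maximum serve \<open>\<bar>s\<bar> > R + 1\<close> and \<open>\<bar>s\<bar> \<le> R + 1\<close>; the division by \<open>2\<close> cancels
    the numerator of the weight.\<close>
  define R where "R = \<bar>a\<bar> + \<bar>b\<bar>"
  define C where "C = max ((b - a) * (3 + 2 * R\<^sup>2)) (pi * (1 + (R + 1)\<^sup>2)) / 2"
  have "0 \<le> C" by (simp add: C_def le_max_iff_disj)
  moreover have "\<bar>arctan ((b - s) / y) - arctan ((a - s) / y)\<bar> \<le> C * cauchy_weight s"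
    if y: "0 < y" "y \<le> 1" for s y
  proof (cases "\<bar>s\<bar> \<le> R + 1")
    case True
    then have "s\<^sup>2 \<le> (R + 1)\<^sup>2" using power_mono[OF True abs_ge_zero, of 2] by simp
    then have "pi * (1 + s\<^sup>2) \<le> pi * (1 + (R + 1)\<^sup>2)" by simp
    also have "\<dots> \<le> 2 * C" by (simp add: C_def)
    finally have "pi \<le> C * cauchy_weight s" by (simp add: cauchy_weight_def field_simps)
    then show ?thesis using arctan_bounded[of "(b - s) / y"] arctan_bounded[of "(a - s) / y"] by linarith
  next
    case False
    obtain x where x: "a < x" "x < b"
      "arctan ((b - s) / y) - arctan ((a - s) / y) = (b - a) * (pi * hp_poisson (Complex x y) s)"
      using MVT2[OF ab, of "\<lambda>x. arctan ((x - s) / y)" "\<lambda>x. pi * hp_poisson (Complex x y) s"]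
        arctan_scaled_deriv[OF y(1)] by blast
    have xR: "\<bar>x\<bar> \<le> R" using x by (auto simp: R_def)
    then have "1 \<le> \<bar>x - s\<bar>" using False by linarith
    then have d: "1 \<le> (x - s)\<^sup>2" by (metis abs_le_square_iff abs_one one_power2)
    have "1 + s\<^sup>2 \<le> (1 + 2 * R\<^sup>2) * 1 + 2 * (x - s)\<^sup>2"
      using one_plus_square_le[OF xR, of s] by simp
    also have "\<dots> \<le> (1 + 2 * R\<^sup>2) * (x - s)\<^sup>2 + 2 * (x - s)\<^sup>2"
      by (intro add_right_mono mult_left_mono d) auto
    finally have e: "1 + s\<^sup>2 \<le> (3 + 2 * R\<^sup>2) * (x - s)\<^sup>2" by (simp add: algebra_simps)
    have "pi * hp_poisson (Complex x y) s = y / ((x - s)\<^sup>2 + y\<^sup>2)"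
      by (simp add: hp_poisson_def cmod_power2)
    also have "\<dots> \<le> 1 / (x - s)\<^sup>2"
      using y d by (intro frac_le) auto
    also have "\<dots> \<le> (3 + 2 * R\<^sup>2) / (1 + s\<^sup>2)"
      using e d by (simp add: divide_simps)
    finally have "(b - a) * (pi * hp_poisson (Complex x y) s) \<le> (b - a) * ((3 + 2 * R\<^sup>2) / (1 + s\<^sup>2))"
      using ab by (intro mult_left_mono) auto
    also have "\<dots> = ((b - a) * (3 + 2 * R\<^sup>2)) / 2 * cauchy_weight s"
      by (simp add: cauchy_weight_def)
    also have "\<dots> \<le> C * cauchy_weight s"
      unfolding C_def by (intro mult_right_mono divide_right_mono) auto
    finally show ?thesis
      using x(3) ab y by (simp add: hp_poisson_def)
  qed
  ultimately show ?thesis using that by blast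
qed

lemma arctan_difference_tendsto:
  assumes "s \<noteq> a" "s \<noteq> (b::real)" "a < b"
  shows "(\<lambda>n. arctan ((b - s) / inverse (real (Suc n))) - arctan ((a - s) / inverse (real (Suc n))))
     \<longlonglongrightarrow> pi * indicator {a..b} s"
proof -
  have e: "c / inverse (real (Suc n)) = c * real (Suc n)" for c n
    by (simp only: divide_inverse inverse_inverse_eq)
  have lim: "(\<lambda>n. arctan (c / inverse (real (Suc n)))) \<longlonglongrightarrow> (if 0 < c then pi/2 else -pi/2)" if "c \<noteq> 0" for c
  proof (cases "0 < c")
    case True
    then have "filterlim (\<lambda>n. c * real (Suc n)) at_top sequentially"
      by (intro filterlim_tendsto_pos_mult_at_top[OF tendsto_const] filterlim_compose[OF filterlim_real_sequentially] filterlim_Suc)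
    then have "(\<lambda>n. arctan (c * real (Suc n))) \<longlonglongrightarrow> pi/2"
      by (rule filterlim_compose[OF tendsto_arctan_at_top])
    then show ?thesis unfolding e using True by (simp del: of_nat_Suc)
  next
    case False
    then have "filterlim (\<lambda>n. (-c) * real (Suc n)) at_top sequentially" using that
      by (intro filterlim_tendsto_pos_mult_at_top[OF tendsto_const] filterlim_compose[OF filterlim_real_sequentially] filterlim_Suc) auto
    then have "(\<lambda>n. arctan ((-c) * real (Suc n))) \<longlonglongrightarrow> pi/2"
      by (rule filterlim_compose[OF tendsto_arctan_at_top])
    then have "(\<lambda>n. - arctan ((-c) * real (Suc n))) \<longlonglongrightarrow> -(pi/2)" by (rule tendsto_minus)
    then show ?thesis unfolding e using False by (simp add: arctan_minus del: of_nat_Suc)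
  qed
  have "(\<lambda>n. arctan ((b - s) / inverse (real (Suc n))) - arctan ((a - s) / inverse (real (Suc n))))
     \<longlonglongrightarrow> (if 0 < b - s then pi/2 else -pi/2) - (if 0 < a - s then pi/2 else -pi/2)"
    by (intro tendsto_diff lim) (use assms in auto)
  moreover have "(if 0 < b - s then pi/2 else -pi/2) - (if 0 < a - s then pi/2 else -pi/2) = pi * indicator {a..b} s"
    using assms by (auto simp: indicator_def)
  ultimately show ?thesis by simp
qed

text \<open>The positive and the negative part of \<open>g\<close>, restricted to a bounded interval, are densities of finite
  measures that agree on all half-lines, hence are equal; so the parts agree almost everywhere.\<close>

lemma AE_zero_if_interval_integrals_zero:
  fixes g :: "real \<Rightarrow> real"
  assumes [measurable]: "g \<in> borel_measurable borel"
    and int: "\<And>a b. set_integrable lborel {a..b} g"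
    and zero: "\<And>a b. a < b \<Longrightarrow> (LINT s:{a..b}|lborel. g s) = 0"
  shows "AE s in lborel. g s = 0"
proof -
  have "AE s in lborel. s \<in> {-real R..real R} \<longrightarrow> g s = 0" for R :: nat
  proof -
    define h where "h s = indicator {-real R..real R} s * g s" for s
    have [measurable]: "h \<in> borel_measurable borel" unfolding h_def by measurable
    have hi: "integrable lborel h"
      using int[of "-real R" "real R"] by (simp add: set_integrable_def h_def[abs_def])
    \<comment> \<open>A half-line meets \<open>[-R, R]\<close> in an interval, up to an endpoint, or in a null set.\<close>
    have tail: "(LINT s|lborel. indicator {x<..} s * h s) = 0" for x
    proof (cases "max x (- real R) < real R")
      case True
      have "(LINT s|lborel. indicator {x<..} s * h s) = (LINT s:{max x (-real R)..real R}|lborel. g s)"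
        unfolding set_lebesgue_integral_def
      proof (rule integral_cong_AE)
        show "AE s in lborel. indicator {x<..} s * h s = indicator {max x (-real R)..real R} s *\<^sub>R g s"
          using AE_lborel_singleton[of x] by eventually_elim (auto simp: h_def indicator_def)
      qed measurable
      also have "\<dots> = 0" by (rule zero[OF True])
      finally show ?thesis .
    next
      case False
      have "AE s in lborel. indicator {x<..} s * h s = 0"
        using AE_lborel_singleton[of "real R"] AE_lborel_singleton[of "-real R"]
        by eventually_elim (use False in \<open>auto simp: h_def indicator_def\<close>)
      then show ?thesis by (rule integral_eq_zero_AE)
    qed
    have gt_sets: "{x<..} \<in> sets lborel" for x :: real by simp
    let ?M = "density lborel (\<lambda>s. ennreal (h s))" and ?N = "density lborel (\<lambda>s. ennreal (- h s))"
    have em: "emeasure (density lborel (\<lambda>s. ennreal (k s))) {x<..} =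
        ennreal (LINT s|lborel. indicator {x<..} s * max 0 (k s))"
      if "integrable lborel k" for k :: "real \<Rightarrow> real" and x
    proof -
      have [measurable]: "k \<in> borel_measurable borel" using that by auto
      have "emeasure (density lborel (\<lambda>s. ennreal (k s))) {x<..} = (\<integral>\<^sup>+s. ennreal (k s) * indicator {x<..} s \<partial>lborel)"
        by (subst emeasure_density) auto
      also have "\<dots> = (\<integral>\<^sup>+s. ennreal (indicator {x<..} s * max 0 (k s)) \<partial>lborel)"
        by (intro nn_integral_cong) (auto simp: indicator_def max_def ennreal_neg)
      also have "\<dots> = ennreal (LINT s|lborel. indicator {x<..} s * max 0 (k s))"
        using gt_sets integrable_mult_indicator[of "{x<..}" lborel "\<lambda>s. max 0 (k s)"] that
        by (intro nn_integral_eq_integral) (auto simp: borel_open)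
      finally show ?thesis .
    qed
    have "?M = ?N"
    proof (rule measure_eqI_lessThan)
      fix x
      have "integrable lborel (\<lambda>s. indicator {x<..} s * max 0 (h s))" "integrable lborel (\<lambda>s. indicator {x<..} s * max 0 (- h s))"
        using gt_sets hi integrable_mult_indicator[of "{x<..}" lborel "\<lambda>s. max 0 (h s)"]
          integrable_mult_indicator[of "{x<..}" lborel "\<lambda>s. max 0 (- h s)"] by auto
      then have "(LINT s|lborel. indicator {x<..} s * max 0 (h s)) - (LINT s|lborel. indicator {x<..} s * max 0 (- h s)) =
          (LINT s|lborel. indicator {x<..} s * max 0 (h s) - indicator {x<..} s * max 0 (- h s))"
        by simp
      also have "\<dots> = (LINT s|lborel. indicator {x<..} s * h s)"
        by (intro Bochner_Integration.integral_cong) (auto simp: indicator_def max_def)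
      finally show "emeasure ?M {x<..} = emeasure ?N {x<..}"
        using hi tail[of x] by (simp add: em)
      show "emeasure ?M {x<..} < \<infinity>" using hi by (simp add: em)
    qed auto
    then have "AE s in lborel. ennreal (h s) = ennreal (- h s)"
      by (subst (asm) sigma_finite_measure.density_unique_iff[OF sigma_finite_lborel]) auto
    then show ?thesis
    proof eventually_elim
      case (elim s)
      then have "h s = 0"
        by (cases "0 \<le> h s") (auto simp: ennreal_neg dest: sym)
      then show ?case by (auto simp: h_def)
    qed
  qed
  then have "AE s in lborel. \<forall>R. s \<in> {-real R..real R} \<longrightarrow> g s = 0"
    unfolding AE_all_countable by blast
  then show ?thesis
  proof eventually_elim
    case (elim s)
    obtain R where "\<bar>s\<bar> \<le> real R" using real_arch_simple by blast
    then show ?case using elim by (auto simp: abs_le_iff dest: spec[of _ R])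
  qed
qed

text \<open>Integrate the vanishing Poisson integrals over a segment of height \<open>y\<close> and exchange the order of
  integration.\<close>

lemma poisson_smoothed_zero:
  fixes g :: "real \<Rightarrow> real"
  assumes g: "integrable lborel (\<lambda>s. cauchy_weight s * g s)" and [measurable]: "g \<in> borel_measurable borel"
    and zero: "\<And>x y. 0 < y \<Longrightarrow> (LINT s|lborel. hp_poisson (Complex x y) s * g s) = 0"
    and ab: "a < b" and y: "0 < y"
  shows "(LINT s|lborel. (arctan ((b - s) / y) - arctan ((a - s) / y)) * g s) = 0"
proof -
  define R where "R = \<bar>a\<bar> + \<bar>b\<bar>"
  define C where "C = y * (2 + (1 + 2 * R\<^sup>2) / y\<^sup>2) / (2 * pi)"
  define f where "f x s = indicator {a..b} x * (hp_poisson (Complex x y) s * g s)" for x s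
  have fm: "case_prod f \<in> borel_measurable (lborel \<Otimes>\<^sub>M lborel)"
    unfolding f_def hp_poisson_def complex_norm complex.sel minus_complex.code by measurable
  have bnd: "norm (f x s) \<le> C * indicator {a..b} x * (cauchy_weight s * \<bar>g s\<bar>)" for x s
  proof (cases "x \<in> {a..b}")
    case True
    then have "\<bar>x\<bar> \<le> R" by (auto simp: R_def)
    then have "hp_poisson (Complex x y) s \<le> C * cauchy_weight s"
      using hp_poisson_bound_uniform[OF y] by (simp add: C_def)
    then have "hp_poisson (Complex x y) s * \<bar>g s\<bar> \<le> C * cauchy_weight s * \<bar>g s\<bar>"
      by (intro mult_right_mono) auto
    then show ?thesis using True y by (simp add: f_def abs_mult hp_poisson_nonneg mult.assoc)
  qed (simp add: f_def)
  have "integrable (lborel \<Otimes>\<^sub>M lborel) (\<lambda>(x, s). C * indicator {a..b} x * (cauchy_weight s * \<bar>g s\<bar>))"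
  proof (rule lborel_pair.Fubini_integrable)
    have "integrable lborel (\<lambda>s. cauchy_weight s * \<bar>g s\<bar>)"
      using integrable_abs[OF g] by (simp add: abs_mult)
    then show "AE x in lborel. integrable lborel (\<lambda>s. case (x, s) of (x, s) \<Rightarrow> C * indicator {a..b} x * (cauchy_weight s * \<bar>g s\<bar>))"
      by simp
    have "C \<ge> 0" using y by (simp add: C_def)
    have "integrable lborel (indicat_real {a..b})"
      by (rule integrable_real_indicator) (auto simp: emeasure_lborel_Icc_eq)
    then
    show "integrable lborel (\<lambda>x. LINT s|lborel. norm (case (x, s) of (x, s) \<Rightarrow> C * indicator {a..b} x * (cauchy_weight s * \<bar>g s\<bar>)))"
      using \<open>C \<ge> 0\<close> by (simp add: abs_mult)
  qed measurable
  then have "integrable (lborel \<Otimes>\<^sub>M lborel) (case_prod f)"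
    by (rule Bochner_Integration.integrable_bound[OF _ fm]) (auto intro!: AE_I2 order_trans[OF bnd[unfolded real_norm_def] abs_ge_self])
  note lborel_pair.Fubini_integral[OF this]
  moreover have "(LINT s|lborel. f x s) = 0" for x
    using zero[OF y, of x] by (simp add: f_def)
  moreover have "(LINT x|lborel. f x s) = (arctan ((b - s) / y) - arctan ((a - s) / y)) * g s / pi" for s
  proof -
    have "(LINT x|lborel. (pi * hp_poisson (Complex x y) s) * indicator {a..b} x) = arctan ((b - s) / y) - arctan ((a - s) / y)"
    proof (rule integral_FTC_Icc_real)
      show "isCont (\<lambda>x. pi * hp_poisson (Complex x y) s) x" for x
      proof -
        have "y\<^sup>2 + (x - s)\<^sup>2 \<noteq> 0" using y by (simp add: add_pos_nonneg less_imp_neq[symmetric])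
        then show ?thesis unfolding hp_poisson_def cmod_power2
          by (simp add: add.commute)
      qed
    qed (use ab in \<open>auto intro: arctan_scaled_deriv[OF y]\<close>)
    moreover have "(LINT x|lborel. f x s) = (LINT x|lborel. (g s / pi) * ((pi * hp_poisson (Complex x y) s) * indicator {a..b} x))"
      by (intro Bochner_Integration.integral_cong) (auto simp: f_def)
    ultimately have "(LINT x|lborel. f x s) = (g s / pi) * (arctan ((b - s) / y) - arctan ((a - s) / y))"
      by (simp only: integral_mult_right_zero)
    then show ?thesis by simp
  qed
  ultimately show ?thesis by simp
qed

text \<open>Uniqueness for Poisson integrals: for \<open>y \<rightarrow> 0\<close> the smoothed integrals of the preceding lemma converge,
  by dominated convergence, to \<open>\<pi>\<close> times the integrals over intervals, which therefore vanish. This recovers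
  the boundary function of an outer function from its modulus inside the disc.\<close>

lemma poisson_integral_zero_imp_AE_zero:
  fixes g :: "real \<Rightarrow> real"
  assumes g: "integrable lebesgue (\<lambda>s. cauchy_weight s * g s)"
    and zero: "\<And>w. 0 < Im w \<Longrightarrow> (LINT s|lebesgue. hp_poisson w s * g s) = 0"
  shows "AE s in lebesgue. g s = 0"
proof -
  have "g \<in> borel_measurable lebesgue" using g lebesgue_weight_measurable_iff[of g] by auto
  then obtain g' where g'[measurable]: "g' \<in> borel_measurable borel" and ae: "AE s in lborel. g s = g' s"
    using completion_ex_borel_measurable_real[of g lborel] by auto
  have ae': "AE s in lebesgue. g s = g' s" using ae by (rule AE_completion)
  have [measurable]: "g \<in> borel_measurable lebesgue" "g' \<in> borel_measurable lebesgue"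
     "cauchy_weight \<in> borel_measurable lebesgue" "hp_poisson w \<in> borel_measurable lebesgue" for w
    by (auto intro: borel_imp_lebesgue_measurable \<open>g \<in> borel_measurable lebesgue\<close>)
  have "integrable lebesgue (\<lambda>s. cauchy_weight s * g' s)"
    by (rule integrable_cong_AE_imp[OF g]) (use ae' in \<open>auto elim: eventually_mono\<close>)
  then have gi: "integrable lborel (\<lambda>s. cauchy_weight s * g' s)"
    by (subst (asm) integrable_completion) auto
  have z: "(LINT s|lborel. hp_poisson (Complex x y) s * g' s) = 0" if "0 < y" for x y
  proof -
    have "(LINT s|lborel. hp_poisson (Complex x y) s * g' s) = (LINT s|lebesgue. hp_poisson (Complex x y) s * g' s)"
      by (subst integral_completion) auto
    also have "\<dots> = (LINT s|lebesgue. hp_poisson (Complex x y) s * g s)"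
      by (rule integral_cong_AE) (use ae' in \<open>auto elim: eventually_mono\<close>)
    finally show ?thesis using zero[of "Complex x y"] that by simp
  qed
  have "AE s in lborel. g' s = 0"
  proof (rule AE_zero_if_interval_integrals_zero)
    show "set_integrable lborel {a..b} g'" for a b
      unfolding set_integrable_def
    proof (rule Bochner_Integration.integrable_bound)
      define R where "R = \<bar>a\<bar> + \<bar>b\<bar>"
      show "integrable lborel (\<lambda>s. (1 + R\<^sup>2) * (cauchy_weight s * g' s))" using gi by simp
      show "AE s in lborel. norm (indicator {a..b} s *\<^sub>R g' s) \<le> norm ((1 + R\<^sup>2) * (cauchy_weight s * g' s))"
      proof (intro AE_I2)
        fix s
        show "norm (indicator {a..b} s *\<^sub>R g' s) \<le> norm ((1 + R\<^sup>2) * (cauchy_weight s * g' s))"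
        proof (cases "s \<in> {a..b}")
          case True
          then have "\<bar>s\<bar> \<le> R" by (auto simp: R_def)
          from power_mono[OF this abs_ge_zero, of 2] have "1 \<le> (1 + R\<^sup>2) * cauchy_weight s"
            by (simp add: cauchy_weight_def divide_simps, use zero_le_power2[of R] in linarith)
          then have "1 * \<bar>g' s\<bar> \<le> (1 + R\<^sup>2) * cauchy_weight s * \<bar>g' s\<bar>" by (intro mult_right_mono) auto
          then show ?thesis using True by (simp add: abs_mult mult.assoc)
        qed simp
      qed
    qed measurable
    fix a b :: real assume ab: "a < b"
    \<comment> \<open>The heights \<open>y = 1/(n + 1)\<close> tend to \<open>0\<close>.\<close>
    define A where "A n s = arctan ((b - s) / inverse (real (Suc n))) - arctan ((a - s) / inverse (real (Suc n)))" for n s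
    obtain C where C: "0 \<le> C"
      "\<And>s y. 0 < y \<Longrightarrow> y \<le> 1 \<Longrightarrow> \<bar>arctan ((b - s) / y) - arctan ((a - s) / y)\<bar> \<le> C * cauchy_weight s"
      using arctan_difference_bound[OF ab] by blast
    have "(\<lambda>n. LINT s|lborel. A n s * g' s) \<longlonglongrightarrow> (LINT s|lborel. pi * indicator {a..b} s * g' s)"
    proof (rule integral_dominated_convergence)
      show "integrable lborel (\<lambda>s. C * \<bar>cauchy_weight s * g' s\<bar>)" using gi by simp
      show "AE s in lborel. (\<lambda>n. A n s * g' s) \<longlonglongrightarrow> pi * indicator {a..b} s * g' s"
        using AE_lborel_singleton[of a] AE_lborel_singleton[of b]
        by eventually_elim (unfold A_def, intro tendsto_mult arctan_difference_tendsto ab tendsto_const)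
      show "AE s in lborel. norm (A n s * g' s) \<le> C * \<bar>cauchy_weight s * g' s\<bar>" for n
      proof (intro AE_I2)
        fix s
        have "\<bar>A n s\<bar> \<le> C * cauchy_weight s"
          unfolding A_def by (rule C(2)) (auto simp: inverse_le_1_iff)
        from mult_right_mono[OF this abs_ge_zero[of "g' s"]]
        show "norm (A n s * g' s) \<le> C * \<bar>cauchy_weight s * g' s\<bar>" by (simp add: abs_mult mult.assoc)
      qed
    qed (auto simp: A_def)
    moreover have "(LINT s|lborel. A n s * g' s) = 0" for n
      unfolding A_def by (rule poisson_smoothed_zero[OF gi g' z ab]) auto
    ultimately have "(LINT s|lborel. pi * (indicator {a..b} s * g' s)) = 0"
      by (simp add: LIMSEQ_const_iff mult.assoc)
    then show "(LINT s:{a..b}|lborel. g' s) = 0" by (simp add: set_lebesgue_integral_def)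
  qed fact
  then have "AE s in lebesgue. g' s = 0" by (rule AE_completion)
  with ae' show ?thesis by eventually_elim simp
qed

section \<open>Tilings of the line by affine iterates\<close>

text \<open>The \<open>n\<close>-th iterate of \<open>x \<mapsto> a x + t\<close> in the two cases \<open>t = 0\<close> and \<open>a = 1\<close>; treating them by one formula
  lets the hyperbolic and the parabolic case share the argument.\<close>

definition affine_iter :: "real \<Rightarrow> real \<Rightarrow> int \<Rightarrow> real \<Rightarrow> real" where
  "affine_iter a t n x = of_int n * t + a powi n * x"

lemma affine_iter_measurable [measurable]: "affine_iter a t n \<in> borel_measurable borel"
  unfolding affine_iter_def by measurable

lemma affine_iter_lebesgue_measurable: "0 < a \<Longrightarrow> affine_iter a t n \<in> lebesgue \<rightarrow>\<^sub>M lebesgue"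
  using lebesgue_affine_measurable[of "\<lambda>_::real. a powi n" "of_int n * t"]
  by (simp add: affine_iter_def[abs_def])

lemma AE_affine_iter:
  assumes "0 < a" "AE x in lebesgue. P x" shows "AE x in lebesgue. P (affine_iter a t n x)"
proof -
  define b where "b = a powi n"
  have b: "b \<noteq> 0" using assms(1) by (simp add: b_def)
  have "{x. \<not> P (affine_iter a t n x)} = (\<lambda>y. (y - of_int n * t) / b) ` {x. \<not> P x}"
  proof (intro set_eqI iffI)
    fix x assume "x \<in> {x. \<not> P (affine_iter a t n x)}"
    then show "x \<in> (\<lambda>y. (y - of_int n * t) / b) ` {x. \<not> P x}"
      using b by (intro image_eqI[of _ _ "affine_iter a t n x"]) (auto simp: affine_iter_def b_def)
  qed (use b in \<open>auto simp: affine_iter_def b_def\<close>)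
  moreover have "negligible ((\<lambda>y. (y - of_int n * t) / b) ` {x. \<not> P x})"
    using assms(2) b
    by (intro negligible_differentiable_image_negligible)
       (auto simp: AE_lebesgue_negligible divide_inverse differentiable_on_def)
  ultimately show ?thesis by (simp add: AE_lebesgue_negligible)
qed

text \<open>The set \<open>T\<close> is the boundary set \<open>J\<close> in half-plane coordinates: its iterates tile the line, except for the
  fixed point \<open>0\<close> if the map is a dilation. Up to constants, \<open>\<rho> n\<close> is the factor by which the \<open>n\<close>-th iterate
  contracts arc length, uniformly on \<open>T\<close>. All convergence questions reduce to series with the terms \<open>\<rho> n\<close>.\<close>

locale line_tiling =
  fixes a t :: real and T :: "real set" and \<rho> :: "int \<Rightarrow> real" and c C :: real
  assumes a: "0 < a" and a_or_t: "a = 1 \<or> t = 0"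
    and T: "T \<in> sets borel" and T_not_null: "\<not> negligible T"
    and cover: "\<And>x. x \<noteq> 0 \<Longrightarrow> \<exists>n. affine_iter a t (-n) x \<in> T"
    and disjoint: "\<And>m n x. affine_iter a t m x \<in> T \<Longrightarrow> affine_iter a t n x \<in> T \<Longrightarrow> m = n"
    and c: "0 < c" and \<rho>: "\<And>n. 0 \<le> \<rho> n"
    and decay_lower: "\<And>n x. x \<in> T \<Longrightarrow> c * \<rho> n * cauchy_weight x \<le> a powi n * cauchy_weight (affine_iter a t n x)"
    and decay_upper: "\<And>n x. x \<in> T \<Longrightarrow> a powi n * cauchy_weight (affine_iter a t n x) \<le> C * \<rho> n * cauchy_weight x"
begin

abbreviation iter :: "int \<Rightarrow> real \<Rightarrow> real" where "iter \<equiv> affine_iter a t"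

lemma iter_iter: "iter m (iter n x) = iter (m + n) x"
  using a a_or_t by (auto simp: affine_iter_def power_int_add algebra_simps)

lemma iter_0 [simp]: "iter 0 x = x"
  by (simp add: affine_iter_def)

definition tiled :: "real set" where "tiled = {x. \<exists>n. iter (-n) x \<in> T}"

text \<open>The value \<open>0\<close> off the tiles is arbitrary; it concerns at most the point \<open>0\<close>.\<close>

definition tile_index :: "real \<Rightarrow> int" where
  "tile_index x = (if x \<in> tiled then (THE n. iter (-n) x \<in> T) else 0)"

lemma tile_index_eq_iff: "x \<in> tiled \<Longrightarrow> tile_index x = n \<longleftrightarrow> iter (-n) x \<in> T"
proof -
  assume x: "x \<in> tiled"
  then have "\<exists>!n. iter (-n) x \<in> T"
  proof (intro ex_ex1I)
    fix m n assume "iter (-m) x \<in> T" "iter (-n) x \<in> T"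
    from disjoint[OF this] show "m = n" by simp
  qed (simp add: tiled_def)
  from theI'[OF this] have "iter (- tile_index x) x \<in> T" using x by (simp add: tile_index_def)
  then show ?thesis using disjoint[of "- tile_index x" x "-n"] by auto
qed

lemma iter_tile_index: "x \<in> tiled \<Longrightarrow> iter (- tile_index x) x \<in> T"
  using tile_index_eq_iff by blast

lemma AE_tiled: "AE x in lebesgue. x \<in> tiled"
proof -
  have "negligible {x. x \<notin> tiled}"
    by (rule negligible_subset[of "{0}"]) (use cover in \<open>auto simp: tiled_def\<close>)
  then show ?thesis by (simp add: AE_lebesgue_negligible)
qed

lemma iter_tiled_iff: "iter n x \<in> tiled \<longleftrightarrow> x \<in> tiled"
proof -
  have "x \<in> tiled \<Longrightarrow> iter n x \<in> tiled" for n x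
  proof -
    assume "x \<in> tiled"
    then obtain k where "iter (-k) x \<in> T" by (auto simp: tiled_def)
    then have "iter (- (n + k)) (iter n x) \<in> T" by (simp add: iter_iter)
    then show "iter n x \<in> tiled" unfolding tiled_def by blast
  qed
  from this[of x n] this[of "iter n x" "-n"] show ?thesis by (auto simp: iter_iter)
qed

lemma tile_index_iter: "x \<in> tiled \<Longrightarrow> tile_index (iter n x) = n + tile_index x"
  using iter_tile_index[of x] by (simp add: tile_index_eq_iff iter_tiled_iff iter_iter)

lemma T_tiled: "x \<in> T \<Longrightarrow> x \<in> tiled"
  by (auto simp: tiled_def intro!: exI[of _ 0])

lemma tile_index_T: "x \<in> T \<Longrightarrow> tile_index x = 0"
  by (simp add: tile_index_eq_iff T_tiled)

lemma sets_iter_T: "{x. iter n x \<in> T} \<in> sets borel"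
  using measurable_sets[OF affine_iter_measurable T, of a t n] by (simp add: vimage_def)

lemma sets_tiled [measurable]: "tiled \<in> sets borel"
proof -
  have "tiled = (\<Union>n. {x. iter (-n) x \<in> T})" by (auto simp: tiled_def)
  also have "\<dots> \<in> sets borel" using sets_iter_T by (intro sets.countable_UN) auto
  finally show ?thesis .
qed

lemma tile_index_measurable [measurable]: "tile_index \<in> lebesgue \<rightarrow>\<^sub>M count_space UNIV"
proof (subst measurable_count_space_eq2_countable, safe)
  fix n :: int
  have "tile_index x = n \<longleftrightarrow> x \<in> (tiled \<inter> {x. iter (-n) x \<in> T}) \<union> (if n = 0 then - tiled else {})" for x
    by (cases "x \<in> tiled") (auto simp: tile_index_eq_iff, auto simp: tile_index_def)
  then have "tile_index -` {n} = (tiled \<inter> {x. iter (-n) x \<in> T}) \<union> (if n = 0 then - tiled else {})"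
    by blast
  also have "\<dots> \<in> sets borel" using sets_iter_T sets_tiled T by auto
  finally show "tile_index -` {n} \<inter> space lebesgue \<in> sets lebesgue" by auto
qed auto

text \<open>Only the summand of the tile that contains \<open>x\<close> can be nonzero in an orbit sum.\<close>

definition line_orbit_sum :: "real \<Rightarrow> (real \<Rightarrow> real) \<Rightarrow> real \<Rightarrow> real" where
  "line_orbit_sum \<mu> g x = indicator tiled x * (\<mu> powi tile_index x * g (iter (- tile_index x) x))"

lemma line_orbit_sum_iter:
  assumes "\<mu> \<noteq> 0" shows "line_orbit_sum \<mu> g (iter n x) = \<mu> powi n * line_orbit_sum \<mu> g x"
  using assms by (cases "x \<in> tiled")
    (simp_all add: line_orbit_sum_def iter_tiled_iff tile_index_iter power_int_add iter_iter)

lemma line_orbit_sum_T: "x \<in> T \<Longrightarrow> line_orbit_sum \<mu> g x = g x"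
  by (simp add: line_orbit_sum_def T_tiled tile_index_T)

lemma line_orbit_sum_measurable:
  assumes g: "(\<lambda>x. indicator T x * g x) \<in> borel_measurable lebesgue"
  shows "line_orbit_sum \<mu> g \<in> borel_measurable lebesgue"
proof -
  have [measurable]: "tiled \<in> sets lebesgue" using sets_tiled by auto
  have [measurable]: "(\<lambda>x. indicator T (iter n x) * g (iter n x)) \<in> borel_measurable lebesgue" for n
    using measurable_compose[OF affine_iter_lebesgue_measurable[OF a] g] by simp
  have "(\<lambda>x. (\<lambda>n x. indicator tiled x * (\<mu> powi n * (indicator T (iter (-n) x) * g (iter (-n) x)))) (tile_index x) x)
      \<in> borel_measurable lebesgue"
    by (rule measurable_compose_countable'[where I = UNIV]) (auto intro: tile_index_measurable)
  also have "(\<lambda>x. (\<lambda>n x. indicator tiled x * (\<mu> powi n * (indicator T (iter (-n) x) * g (iter (-n) x)))) (tile_index x) x)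
      = line_orbit_sum \<mu> g"
    by (auto simp: line_orbit_sum_def indicator_def iter_tile_index)
  finally show ?thesis .
qed

text \<open>Split the line into the tiles and move each of them to \<open>T\<close> by an affine change of variables.\<close>

lemma nn_integral_tiles:
  fixes G :: "real \<Rightarrow> ennreal"
  assumes G[measurable]: "G \<in> borel_measurable lebesgue"
  shows "(\<integral>\<^sup>+x. G x \<partial>lebesgue) =
    (\<integral>\<^sup>+n. (\<integral>\<^sup>+x. indicator T x * (ennreal (a powi n) * G (iter n x)) \<partial>lebesgue) \<partial>count_space UNIV)"
proof -
  have ind[measurable]: "(\<lambda>x. indicator T (iter n x) :: ennreal) \<in> borel_measurable lebesgue" for n
  proof (rule borel_imp_lebesgue_measurable)
    show "(\<lambda>x. indicator T (iter n x) :: ennreal) \<in> borel_measurable borel"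
      using T by measurable
  qed
  have "(\<integral>\<^sup>+x. G x \<partial>lebesgue) = (\<integral>\<^sup>+x. (\<integral>\<^sup>+n. indicator T (iter (-n) x) * G x \<partial>count_space UNIV) \<partial>lebesgue)"
  proof (rule nn_integral_cong_AE)
    show "AE x in lebesgue. G x = (\<integral>\<^sup>+n. indicator T (iter (-n) x) * G x \<partial>count_space UNIV)"
      using AE_tiled
    proof eventually_elim
      case (elim x)
      have "indicator T (iter (-n) x) = (indicator {tile_index x} n :: ennreal)" for n
        using tile_index_eq_iff[OF elim, of n] by (auto simp: indicator_def)
      then have "(\<integral>\<^sup>+n. indicator T (iter (-n) x) * G x \<partial>count_space UNIV) = (\<integral>\<^sup>+n. G x * indicator {tile_index x} n \<partial>count_space UNIV)"
        by (simp add: mult.commute)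
      also have "\<dots> = G x" by (subst nn_integral_cmult_indicator) auto
      finally show ?case by simp
    qed
  qed
  also have "\<dots> = (\<integral>\<^sup>+n. (\<integral>\<^sup>+x. indicator T (iter (-n) x) * G x \<partial>lebesgue) \<partial>count_space UNIV)"
    by (rule nn_integral_count_space_nn_integral) auto
  also have "\<dots> = (\<integral>\<^sup>+n. (\<integral>\<^sup>+x. indicator T x * (ennreal (a powi n) * G (iter n x)) \<partial>lebesgue) \<partial>count_space UNIV)"
  proof (rule nn_integral_cong)
    fix n :: int
    have p: "0 < a powi n" using a by simp
    have [measurable]: "(\<lambda>x. G (iter n x)) \<in> borel_measurable lebesgue"
      by (rule measurable_compose[OF affine_iter_lebesgue_measurable[OF a] G])
    have [measurable]: "(indicator T :: real \<Rightarrow> ennreal) \<in> borel_measurable lebesgue"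
      using ind[of 0] by simp
    have "(\<integral>\<^sup>+x. indicator T (iter (-n) x) * G x \<partial>lebesgue)
        = ennreal \<bar>a powi n\<bar> * (\<integral>\<^sup>+x. indicator T (iter (-n) (iter n x)) * G (iter n x) \<partial>lebesgue)"
      using p unfolding affine_iter_def[of a t n]
      by (subst nn_integral_real_affine_lebesgue[where c = "a powi n" and t = "of_int n * t"])
         (use a in auto)
    also have "\<dots> = (\<integral>\<^sup>+x. ennreal (a powi n) * (indicator T x * G (iter n x)) \<partial>lebesgue)"
      using p by (subst nn_integral_cmult) (auto simp: iter_iter)
    finally show "(\<integral>\<^sup>+x. indicator T (iter (-n) x) * G x \<partial>lebesgue)
        = (\<integral>\<^sup>+x. indicator T x * (ennreal (a powi n) * G (iter n x)) \<partial>lebesgue)"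
      by (simp add: ac_simps)
  qed
  finally show ?thesis .
qed

text \<open>If \<open>\<bar>G\<bar>\<close> on the \<open>n\<close>-th tile is at most \<open>s n\<close> times a fixed function \<open>h\<close> on \<open>T\<close>, then the integral of
  \<open>\<bar>G\<bar>\<close> over that tile is at most a constant times \<open>s n * \<rho> n\<close>.\<close>

lemma integrable_weight_if_dominated:
  fixes G h :: "real \<Rightarrow> real"
  assumes G: "G \<in> borel_measurable lebesgue"
    and dom: "\<And>n x. x \<in> T \<Longrightarrow> \<bar>G (iter n x)\<bar> \<le> s n * h x"
    and h: "integrable lebesgue (\<lambda>x. indicator T x * (cauchy_weight x * h x))" "\<And>x. x \<in> T \<Longrightarrow> 0 \<le> h x"
    and s: "integrable (count_space UNIV) (\<lambda>n. s n * \<rho> n)" "\<And>n. 0 \<le> s n"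
  shows "integrable lebesgue (\<lambda>x. cauchy_weight x * G x)"
proof (rule integrableI_bounded)
  show m: "(\<lambda>x. cauchy_weight x * G x) \<in> borel_measurable lebesgue"
    using G by (simp add: lebesgue_weight_measurable_iff)
  define I where "I = (LINT x|lebesgue. indicator T x * (cauchy_weight x * h x))"
  have I: "0 \<le> I" unfolding I_def by (rule Bochner_Integration.integral_nonneg) (auto simp: indicator_def h)
  \<comment> \<open>The upper bound for \<open>n = 0\<close> at a point of \<open>T\<close> would fail for a negative constant.\<close>
  have C: "0 \<le> C"
  proof (rule ccontr)
    assume "\<not> 0 \<le> C"
    obtain x where x: "x \<in> T" using T_not_null by fastforce
    have "0 < a powi 0 * cauchy_weight (iter 0 x)" by simp
    also have "\<dots> \<le> C * (\<rho> 0 * cauchy_weight x)" using decay_upper[OF x, of 0] by (simp add: mult.assoc)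
    also have "\<dots> \<le> 0" using \<open>\<not> 0 \<le> C\<close> \<rho>[of 0] by (intro mult_nonpos_nonneg) auto
    finally show False by simp
  qed
  have hm: "integrable lebesgue (\<lambda>x. K * (indicator T x * (cauchy_weight x * h x)))" for K using h by simp
  have "(\<integral>\<^sup>+x. ennreal (norm (cauchy_weight x * G x)) \<partial>lebesgue) =
    (\<integral>\<^sup>+n. (\<integral>\<^sup>+x. indicator T x * (ennreal (a powi n) * ennreal (norm (cauchy_weight (iter n x) * G (iter n x)))) \<partial>lebesgue) \<partial>count_space UNIV)"
    by (rule nn_integral_tiles) (use m in measurable)
  also have "\<dots> \<le> (\<integral>\<^sup>+n. ennreal (C * (s n * \<rho> n)) * ennreal I \<partial>count_space UNIV)"
  proof (intro nn_integral_mono)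
    fix n :: int
    have "(\<integral>\<^sup>+x. indicator T x * (ennreal (a powi n) * ennreal (norm (cauchy_weight (iter n x) * G (iter n x)))) \<partial>lebesgue)
      \<le> (\<integral>\<^sup>+x. ennreal (C * (s n * \<rho> n) * (indicator T x * (cauchy_weight x * h x))) \<partial>lebesgue)"
    proof (intro nn_integral_mono)
      fix x
      show "indicator T x * (ennreal (a powi n) * ennreal (norm (cauchy_weight (iter n x) * G (iter n x))))
          \<le> ennreal (C * (s n * \<rho> n) * (indicator T x * (cauchy_weight x * h x)))"
      proof (cases "x \<in> T")
        case True
        have "a powi n * norm (cauchy_weight (iter n x) * G (iter n x)) = (a powi n * cauchy_weight (iter n x)) * \<bar>G (iter n x)\<bar>"
          by (simp add: abs_mult)
        also have "\<dots> \<le> (C * \<rho> n * cauchy_weight x) * (s n * h x)"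
          using C \<rho>[of n] by (intro mult_mono[OF decay_upper[OF True, of n] dom[OF True, of n]]) auto
        finally have le: "a powi n * norm (cauchy_weight (iter n x) * G (iter n x)) \<le> C * \<rho> n * cauchy_weight x * (s n * h x)" .
        have "indicator T x * (ennreal (a powi n) * ennreal (norm (cauchy_weight (iter n x) * G (iter n x))))
            = ennreal (a powi n * norm (cauchy_weight (iter n x) * G (iter n x)))"
          using True a by (simp add: ennreal_mult)
        also have "\<dots> \<le> ennreal (C * \<rho> n * cauchy_weight x * (s n * h x))" by (rule ennreal_leI[OF le])
        finally show ?thesis using True by (simp add: ac_simps)
      qed simp
    qed
    also have "\<dots> = ennreal (C * (s n * \<rho> n) * I)"
      unfolding I_def using hm[of "C * (s n * \<rho> n)"] C s(2) \<rho> h(2)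
      by (subst nn_integral_eq_integral) (auto simp: indicator_def)
    also have "\<dots> = ennreal (C * (s n * \<rho> n)) * ennreal I"
      using I C s(2) \<rho> by (intro ennreal_mult) auto
    finally show "(\<integral>\<^sup>+x. indicator T x * (ennreal (a powi n) * ennreal (norm (cauchy_weight (iter n x) * G (iter n x)))) \<partial>lebesgue)
       \<le> ennreal (C * (s n * \<rho> n)) * ennreal I" .
  qed
  also have "\<dots> = (\<integral>\<^sup>+n. ennreal (C * (s n * \<rho> n)) \<partial>count_space UNIV) * ennreal I"
    by (rule nn_integral_multc) auto
  also have "\<dots> < \<infinity>"
  proof -
    have "(\<integral>\<^sup>+n. ennreal (C * (s n * \<rho> n)) \<partial>count_space UNIV) = ennreal (LINT n|count_space UNIV. C * (s n * \<rho> n))"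
      using s \<rho> C by (intro nn_integral_eq_integral) auto
    then show ?thesis by (simp add: ennreal_mult_less_top)
  qed
  finally show "(\<integral>\<^sup>+x. ennreal (norm (cauchy_weight x * G x)) \<partial>lebesgue) < \<infinity>" .
qed

text \<open>The converse estimate; \<open>h\<close> has to be positive for its integral over \<open>T\<close> to be nonzero.\<close>

lemma summable_if_integrable_weight:
  fixes G h :: "real \<Rightarrow> real"
  assumes G: "integrable lebesgue (\<lambda>x. cauchy_weight x * G x)"
    and dom: "\<And>n x. x \<in> T \<Longrightarrow> s n * h x \<le> \<bar>G (iter n x)\<bar>"
    and h[measurable]: "h \<in> borel_measurable lebesgue" "\<And>x. 0 \<le> h x" and hpos: "AE x in lebesgue. x \<in> T \<longrightarrow> 0 < h x"
    and s: "\<And>n. 0 \<le> s n"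
  shows "integrable (count_space UNIV) (\<lambda>n. s n * \<rho> n)"
proof (rule integrableI_bounded)
  have [measurable]: "T \<in> sets lebesgue" using T by auto
  have [measurable]: "cauchy_weight \<in> borel_measurable lebesgue" by (auto intro: borel_imp_lebesgue_measurable)
  define I where "I = (\<integral>\<^sup>+x. ennreal (indicator T x * (cauchy_weight x * h x)) \<partial>lebesgue)"
  have I: "I \<noteq> 0"
  proof
    assume "I = 0"
    then have "AE x in lebesgue. ennreal (indicator T x * (cauchy_weight x * h x)) = 0"
      unfolding I_def by (subst (asm) nn_integral_0_iff_AE) auto
    then have "AE x in lebesgue. x \<notin> T" using hpos
    proof eventually_elim
      case (elim x)
      then show ?case by (auto simp: ennreal_eq_0_iff indicator_def mult_le_0_iff dest: leD)
    qed
    then show False using T_not_null by (simp add: AE_lebesgue_negligible)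
  qed
  have "(\<integral>\<^sup>+n. ennreal (c * (s n * \<rho> n)) \<partial>count_space UNIV) * I = (\<integral>\<^sup>+n. ennreal (c * (s n * \<rho> n)) * I \<partial>count_space UNIV)"
    by (rule nn_integral_multc[symmetric]) auto
  also have "\<dots> \<le> (\<integral>\<^sup>+n. (\<integral>\<^sup>+x. indicator T x * (ennreal (a powi n) * ennreal (norm (cauchy_weight (iter n x) * G (iter n x)))) \<partial>lebesgue) \<partial>count_space UNIV)"
  proof (intro nn_integral_mono)
    fix n :: int
    have "ennreal (c * (s n * \<rho> n)) * I = (\<integral>\<^sup>+x. ennreal (c * (s n * \<rho> n)) * ennreal (indicator T x * (cauchy_weight x * h x)) \<partial>lebesgue)"
      unfolding I_def by (rule nn_integral_cmult[symmetric]) measurable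
    also have "\<dots> \<le> (\<integral>\<^sup>+x. indicator T x * (ennreal (a powi n) * ennreal (norm (cauchy_weight (iter n x) * G (iter n x)))) \<partial>lebesgue)"
    proof (intro nn_integral_mono)
      fix x
      show "ennreal (c * (s n * \<rho> n)) * ennreal (indicator T x * (cauchy_weight x * h x))
         \<le> indicator T x * (ennreal (a powi n) * ennreal (norm (cauchy_weight (iter n x) * G (iter n x))))"
      proof (cases "x \<in> T")
        case True
        have "(c * \<rho> n * cauchy_weight x) * (s n * h x) \<le> (a powi n * cauchy_weight (iter n x)) * \<bar>G (iter n x)\<bar>"
          using a h(2) s by (intro mult_mono[OF decay_lower[OF True, of n] dom[OF True, of n]]) auto
        also have "\<dots> = a powi n * norm (cauchy_weight (iter n x) * G (iter n x))"
          by (simp add: abs_mult)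
        finally show ?thesis using True a c s \<rho> h(2) by (simp add: ennreal_mult[symmetric] ac_simps)
      qed simp
    qed
    finally show "ennreal (c * (s n * \<rho> n)) * I \<le> (\<integral>\<^sup>+x. indicator T x * (ennreal (a powi n) * ennreal (norm (cauchy_weight (iter n x) * G (iter n x)))) \<partial>lebesgue)" .
  qed
  also have "\<dots> = (\<integral>\<^sup>+x. ennreal (norm (cauchy_weight x * G x)) \<partial>lebesgue)"
    by (rule nn_integral_tiles[symmetric]) (use G in measurable)
  also have "\<dots> < \<infinity>" using G by (simp add: integrable_iff_bounded)
  finally have "(\<integral>\<^sup>+n. ennreal (c * (s n * \<rho> n)) \<partial>count_space UNIV) < \<infinity>"
    using I by (auto simp: ennreal_mult_less_top)
  moreover have "(\<integral>\<^sup>+n. ennreal (c * (s n * \<rho> n)) \<partial>count_space UNIV) = ennreal c * (\<integral>\<^sup>+n. ennreal (norm (s n * \<rho> n)) \<partial>count_space UNIV)"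
    using c s \<rho> by (subst nn_integral_cmult[symmetric]) (auto simp: ennreal_mult abs_mult)
  ultimately show "(\<integral>\<^sup>+n. ennreal (norm (s n * \<rho> n)) \<partial>count_space UNIV) < \<infinity>"
    using c by (auto simp: ennreal_mult_less_top)
qed auto

end

section \<open>The functional equation on the boundary\<close>

lemma bdry_inj: "bdry x = bdry y \<longleftrightarrow> x = y"
  by (metis cayley_bdry of_real_eq_iff)

lemma hp_poisson_i: "hp_poisson \<i> x = cauchy_weight x / (2 * pi)"
  by (simp add: hp_poisson_def cauchy_weight_def cmod_power2 add.commute)

text \<open>The tiling transported to the disc. Injectivity on the closed disc ensures that the negative iterates
  of \<open>\<phi>\<close>, which are formed with a choice of preimages, belong to the negative iterates of the affine map.\<close>

locale circle_tiling = line_tiling a t T \<rho> c C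
  for a t :: real and T :: "real set" and \<rho> :: "int \<Rightarrow> real" and c C :: real +
  fixes \<phi> :: "complex \<Rightarrow> complex" and J :: "complex set"
  assumes \<phi>_bdry: "\<And>x. \<phi> (bdry x) = bdry (affine_iter a t 1 x)"
    and \<phi>_cayley_inv: "\<And>w. 0 < Im w \<Longrightarrow> \<phi> (cayley_inv w) = cayley_inv (of_real a * w + of_real t)"
    and \<phi>_inj: "inj_on \<phi> (cball 0 1)"
    and J: "J = bdry ` T"
begin

lemma iter_1: "iter 1 x = t + a * x"
  by (simp add: affine_iter_def)

lemma int_iter_bdry: "int_iter \<phi> n (bdry x) = bdry (iter n x)"
proof -
  have inv: "inv_into (cball 0 1) \<phi> (bdry x) = bdry (iter (-1) x)" for x
    by (rule inv_into_f_eq[OF \<phi>_inj]) (auto simp: norm_bdry \<phi>_bdry iter_iter)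
  have "(\<phi> ^^ k) (bdry x) = bdry (iter (int k) x)" for k
    by (induction k) (auto simp: \<phi>_bdry iter_iter)
  moreover have "(inv_into (cball 0 1) \<phi> ^^ k) (bdry x) = bdry (iter (- int k) x)" for k
    by (induction k) (auto simp: inv iter_iter)
  ultimately show ?thesis by (simp add: int_iter_def)
qed

lemma indicator_int_iter_image: "indicator (int_iter \<phi> n ` J) (bdry x) = (indicator T (iter (-n) x) :: real)"
proof -
  have "bdry x \<in> int_iter \<phi> n ` J \<longleftrightarrow> (\<exists>y\<in>T. x = iter n y)"
    by (auto simp: J int_iter_bdry bdry_inj image_iff)
  also have "\<dots> \<longleftrightarrow> iter (-n) x \<in> T"
    by (auto simp: iter_iter intro!: bexI[of _ "iter (-n) x"])
  finally show ?thesis by (simp add: indicator_def)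
qed

text \<open>The tiles are disjoint, so at most one summand is nonzero; the infinite sum is then finite and needs no
  convergence.\<close>

lemma orbit_sum_bdry: "orbit_sum \<phi> J \<mu> f (bdry x) = line_orbit_sum \<mu> (\<lambda>x. f (bdry x)) x"
proof (cases "x \<in> tiled")
  case True
  have "orbit_sum \<phi> J \<mu> f (bdry x) = (\<Sum>\<^sub>\<infinity>n\<in>{tile_index x}. \<mu> powi n * f (bdry (iter (-n) x)))"
    unfolding orbit_sum_def indicator_int_iter_image int_iter_bdry
    by (rule infsum_cong_neutral) (auto simp: indicator_def tile_index_eq_iff[OF True, symmetric])
  then show ?thesis using True by (simp add: line_orbit_sum_def)
next
  case False
  then have "indicator T (iter (-n) x) = (0::real)" for n by (auto simp: tiled_def indicator_def)
  then show ?thesis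
    using False unfolding orbit_sum_def indicator_int_iter_image by (simp add: line_orbit_sum_def)
qed

lemma indicator_J: "indicator J (bdry x) = (indicator T x :: real)"
  by (auto simp: J indicator_def bdry_inj)

lemma sets_J: "J \<in> sets circle_measure"
proof -
  have "(indicator J :: complex \<Rightarrow> real) \<in> borel_measurable circle_measure"
    unfolding circle_measurable_iff indicator_J
    by (rule borel_imp_lebesgue_measurable) (use T in measurable)
  then have "J \<inter> space circle_measure \<in> sets circle_measure"
    by (simp only: borel_measurable_indicator_iff)
  moreover have "J \<subseteq> space circle_measure"
    by (auto simp: space_circle_measure J norm_bdry)
  ultimately show ?thesis by (simp add: Int_absorb2)
qed

lemma admissible_datum_iff:
  "admissible_datum p J f \<longleftrightarrow>
     (\<forall>x\<in>T. 0 \<le> f (bdry x)) \<and>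
     (\<lambda>x. indicator T x * f (bdry x)) \<in> borel_measurable lebesgue \<and>
     integrable lebesgue (\<lambda>x. indicator T x * (cauchy_weight x * \<bar>f (bdry x)\<bar> powr p)) \<and>
     (AE x in lebesgue. x \<in> T \<longrightarrow> 0 < f (bdry x)) \<and>
     integrable lebesgue (\<lambda>x. indicator T x * (cauchy_weight x * ln (f (bdry x))))"
proof -
  have J': "J \<inter> space circle_measure \<in> sets circle_measure"
    using sets_J sets.Int_space_eq2 by auto
  have T': "bdry x \<in> J \<longleftrightarrow> x \<in> T" for x by (auto simp: J bdry_inj)
  show ?thesis
    unfolding admissible_datum_def in_Lp_def log_in_L1_def
      borel_measurable_restrict_space_iff[OF J'] integrable_restrict_space[OF J'] AE_restrict_space_iff[OF J']
      circle_integrable_iff circle_AE_iff real_scaleR_def circle_measurable_iff indicator_J T'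
    unfolding J by (simp add: ac_simps)
qed

lemma upper_image: "0 < Im w \<Longrightarrow> 0 < Im (of_real a * w + of_real t)"
  using a by simp

lemma \<phi>_ball: "z \<in> ball 0 1 \<Longrightarrow> \<phi> z \<in> ball 0 1"
  using ball_cayley_inv[of z] upper_image by (metis \<phi>_cayley_inv dist_0_norm mem_ball norm_cayley_inv_less_1)

lemma \<phi>_holomorphic: "\<phi> holomorphic_on ball 0 1"
proof -
  have "(\<lambda>z. cayley_inv (of_real a * cayley z + of_real t)) holomorphic_on ball 0 1"
  proof -
    have "of_real a * (\<i> * (1 + z) / (1 - z)) + of_real t + \<i> \<noteq> 0" if z: "z \<in> ball 0 1" for z
    proof -
      obtain w where "0 < Im w" "z = cayley_inv w" using ball_cayley_inv[OF z] .
      then have "cayley z = w" by (metis cayley_cayley_inv upper_ne(2))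
      then show ?thesis
        using upper_ne(2)[OF upper_image[OF \<open>0 < Im w\<close>]] by (simp add: cayley_def)
    qed
    then show ?thesis
      unfolding cayley_inv_def cayley_def by (intro holomorphic_intros) auto
  qed
  moreover have "cayley_inv (of_real a * cayley z + of_real t) = \<phi> z" if z: "z \<in> ball 0 1" for z
  proof -
    obtain w where "0 < Im w" "z = cayley_inv w" using ball_cayley_inv[OF z] .
    then show ?thesis by (metis \<phi>_cayley_inv cayley_cayley_inv upper_ne(2))
  qed
  ultimately show ?thesis by (rule holomorphic_transform)
qed

text \<open>The Poisson integral of \<open>u\<close> at \<open>\<phi>(z)\<close> is the Poisson integral of \<open>u \<circ> \<phi>\<close> at \<open>z\<close>.\<close>

lemma poisson_shift:
  assumes w: "0 < Im w" and u: "integrable lebesgue (\<lambda>x. cauchy_weight x * u x)"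
  shows "integrable lebesgue (\<lambda>x. hp_poisson w x * u (iter 1 x))"
    and "(LINT x|lebesgue. hp_poisson (of_real a * w + of_real t) x * u x) = (LINT x|lebesgue. hp_poisson w x * u (iter 1 x))"
proof -
  let ?w = "of_real a * w + of_real t"
  have eq: "a * (hp_poisson ?w (t + a * x) * u (t + a * x)) = hp_poisson w x * u (iter 1 x)" for x
    using hp_poisson_affine[OF a, of w t x] by (simp add: iter_1 mult.assoc[symmetric])
  have "integrable lebesgue (\<lambda>x. hp_poisson ?w x * u x)"
    by (rule integrable_hp_herglotz(2)[OF upper_image[OF w] u])
  then have "integrable lebesgue (\<lambda>x. hp_poisson ?w (t + a * x) * u (t + a * x))"
    using lebesgue_integrable_real_affine_iff[of a "\<lambda>x. hp_poisson ?w x * u x" t] a by simp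
  from integrable_mult_right[OF this, of a] show "integrable lebesgue (\<lambda>x. hp_poisson w x * u (iter 1 x))"
    by (simp add: eq)
  have "(LINT x|lebesgue. hp_poisson ?w x * u x) = a * (LINT x|lebesgue. hp_poisson ?w (t + a * x) * u (t + a * x))"
    using a by (subst lebesgue_integral_real_affine[of a _ t]) auto
  also have "\<dots> = (LINT x|lebesgue. a * (hp_poisson ?w (t + a * x) * u (t + a * x)))"
    by simp
  finally show "(LINT x|lebesgue. hp_poisson ?w x * u x) = (LINT x|lebesgue. hp_poisson w x * u (iter 1 x))"
    by (simp only: eq)
qed

text \<open>Both sides say that the Poisson integral of \<open>v = log f \<circ> \<phi> - log f - log \<mu>\<close> vanishes. On the left this
  is equality of the moduli of \<open>F \<circ> \<phi>\<close> and \<open>\<mu> F\<close>, from which the unimodular factor arises by the maximum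
  principle. On the right it is \<open>v = 0\<close> almost everywhere, by uniqueness of the Poisson integral.\<close>

lemma functional_equation_iff:
  assumes f: "log_in_L1 circle_measure f" and \<mu>: "0 < \<mu>"
  shows "(\<exists>\<gamma>\<in>sphere 0 1. \<forall>z\<in>ball 0 1. outer_fun f (\<phi> z) = \<gamma> * of_real \<mu> * outer_fun f z) \<longleftrightarrow>
         (AE x in lebesgue. f (bdry (iter 1 x)) = \<mu> * f (bdry x))"
proof -
  define u where "u x = ln (f (bdry x))" for x
  have pos: "AE x in lebesgue. 0 < f (bdry x)" and ui: "integrable lebesgue (\<lambda>x. cauchy_weight x * u x)"
    using f by (auto simp: log_in_L1_circle_iff u_def)
  have pos': "AE x in lebesgue. 0 < f (bdry (iter 1 x))"
    by (rule AE_affine_iter[OF a pos])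
  have norm_eq: "norm (outer_fun f (cayley_inv w)) = exp (LINT x|lebesgue. hp_poisson w x * u x)" if "0 < Im w" for w
    using norm_outer_fun_cayley_inv[OF that] ui by (simp add: u_def)
  define v where "v x = u (iter 1 x) - u x - ln \<mu>" for x
  have hv: "(LINT x|lebesgue. hp_poisson w x * v x) =
      (LINT x|lebesgue. hp_poisson (of_real a * w + of_real t) x * u x) - (LINT x|lebesgue. hp_poisson w x * u x) - ln \<mu>"
    and hvi: "integrable lebesgue (\<lambda>x. hp_poisson w x * v x)" if w: "0 < Im w" for w
    using poisson_shift[OF w ui] integrable_hp_herglotz(2)[OF w ui] integral_hp_poisson[OF w]
    by (simp_all add: v_def right_diff_distrib)
  \<comment> \<open>The weight itself is a multiple of the Poisson kernel at \<open>\<i>\<close>.\<close>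
  have vi: "integrable lebesgue (\<lambda>x. cauchy_weight x * v x)"
    using integrable_mult_right[OF hvi[of \<i>], of "2 * pi"] by (simp add: hp_poisson_i)
  have v0: "(AE x in lebesgue. v x = 0) \<longleftrightarrow> (AE x in lebesgue. f (bdry (iter 1 x)) = \<mu> * f (bdry x))"
  proof
    assume "AE x in lebesgue. v x = 0"
    with pos pos' show "AE x in lebesgue. f (bdry (iter 1 x)) = \<mu> * f (bdry x)"
    proof eventually_elim
      case (elim x)
      then have "ln (f (bdry (iter 1 x))) = ln (\<mu> * f (bdry x))" using \<mu> by (simp add: v_def u_def ln_mult)
      then show ?case using elim \<mu> by simp
    qed
  next
    assume "AE x in lebesgue. f (bdry (iter 1 x)) = \<mu> * f (bdry x)"
    with pos show "AE x in lebesgue. v x = 0"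
      by eventually_elim (use \<mu> in \<open>simp add: v_def u_def ln_mult\<close>)
  qed
  have modulus: "norm (outer_fun f (\<phi> (cayley_inv w))) = \<mu> * norm (outer_fun f (cayley_inv w))
      \<longleftrightarrow> (LINT x|lebesgue. hp_poisson w x * v x) = 0" if w: "0 < Im w" for w
  proof -
    have "\<mu> * norm (outer_fun f (cayley_inv w)) = exp (ln \<mu> + (LINT x|lebesgue. hp_poisson w x * u x))"
      using \<mu> by (simp add: exp_add norm_eq[OF w])
    then show ?thesis
      unfolding \<phi>_cayley_inv[OF w] norm_eq[OF upper_image[OF w]] hv[OF w] by auto
  qed
  have hol: "outer_fun f holomorphic_on ball 0 1"
    using ui angle_integrable[of "\<lambda>\<zeta>. ln (f \<zeta>)"] by (intro outer_fun_holomorphic) (simp add: u_def)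
  show ?thesis
    unfolding v0[symmetric]
  proof
    assume "\<exists>\<gamma>\<in>sphere 0 1. \<forall>z\<in>ball 0 1. outer_fun f (\<phi> z) = \<gamma> * of_real \<mu> * outer_fun f z"
    then have "norm (outer_fun f (\<phi> z)) = \<mu> * norm (outer_fun f z)" if "z \<in> ball 0 1" for z
      using that \<mu> by (auto simp: norm_mult)
    then have "(LINT x|lebesgue. hp_poisson w x * v x) = 0" if "0 < Im w" for w
      using modulus[OF that] norm_cayley_inv_less_1[OF that] by simp
    then show "AE x in lebesgue. v x = 0"
      by (rule poisson_integral_zero_imp_AE_zero[OF vi])
  next
    assume v: "AE x in lebesgue. v x = 0"
    have "norm (outer_fun f (\<phi> z)) = norm (of_real \<mu> * outer_fun f z)" if z: "z \<in> ball 0 1" for z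
    proof -
      obtain w where w: "0 < Im w" "z = cayley_inv w" using ball_cayley_inv[OF z] .
      have "(LINT x|lebesgue. hp_poisson w x * v x) = 0"
        by (rule integral_eq_zero_AE) (use v in \<open>auto elim: eventually_mono\<close>)
      then show ?thesis using modulus[OF w(1)] w(2) \<mu> by (simp add: norm_mult)
    qed
    moreover have "(\<lambda>z. outer_fun f (\<phi> z)) holomorphic_on ball 0 1"
      using holomorphic_on_compose_gen[OF \<phi>_holomorphic hol image_subsetI[OF \<phi>_ball]] by (simp add: comp_def)
    ultimately have "\<exists>\<gamma>\<in>sphere 0 1. \<forall>z\<in>ball 0 1. outer_fun f (\<phi> z) = \<gamma> * (of_real \<mu> * outer_fun f z)"
    proof (intro equal_modulus_imp_unimodular_multiple)
      show "(\<lambda>z. of_real \<mu> * outer_fun f z) holomorphic_on ball 0 1"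
        by (intro holomorphic_intros hol)
      show "of_real \<mu> * outer_fun f z \<noteq> 0" for z using \<mu> by (simp add: outer_fun_def)
    qed auto
    then show "\<exists>\<gamma>\<in>sphere 0 1. \<forall>z\<in>ball 0 1. outer_fun f (\<phi> z) = \<gamma> * of_real \<mu> * outer_fun f z"
      by (simp add: mult.assoc)
  qed
qed

text \<open>The equation \<open>f \<circ> \<phi> = \<mu> f\<close> holds almost everywhere along whole orbits, so that \<open>f\<close> is determined by its
  restriction to \<open>J\<close>, which can serve as \<open>f\<^sub>0\<close>.\<close>

lemma functional_equation_imp_orbit_sum:
  assumes eq: "AE x in lebesgue. f (bdry (iter 1 x)) = \<mu> * f (bdry x)" and \<mu>: "0 < \<mu>"
  shows "AE x in lebesgue. f (bdry x) = orbit_sum \<phi> J \<mu> f (bdry x)"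
proof -
  have "AE x in lebesgue. f (bdry (iter 1 (iter n x))) = \<mu> * f (bdry (iter n x))" for n
    by (rule AE_affine_iter[OF a eq])
  then have "AE x in lebesgue. \<forall>n. f (bdry (iter 1 (iter n x))) = \<mu> * f (bdry (iter n x))"
    unfolding AE_all_countable by blast
  then show ?thesis using AE_tiled
  proof eventually_elim
    case (elim x)
    have step: "f (bdry (iter (n + 1) x)) = \<mu> * f (bdry (iter n x))" for n
      using elim(1)[rule_format, of n] by (simp add: iter_iter add.commute)
    have "f (bdry (iter n x)) = \<mu> powi n * f (bdry x)" for n
    proof (induction n rule: int_induct[where k = 0])
      case (step1 i)
      then show ?case using step[of i] \<mu> by (simp add: power_int_add)
    next
      case (step2 i)
      then show ?case using step[of "i - 1"] \<mu> by (simp add: power_int_diff field_simps)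
    qed simp
    then show ?case
      using elim(2) \<mu> by (simp add: orbit_sum_bdry line_orbit_sum_def power_int_minus)
  qed
qed

lemma functional_equation_iff_orbit_sum:
  assumes f: "\<And>z. z \<in> sphere 0 1 \<Longrightarrow> 0 \<le> f z" "in_Lp p circle_measure f" "log_in_L1 circle_measure f"
    and \<mu>: "0 < \<mu>"
  shows "(AE x in lebesgue. f (bdry (iter 1 x)) = \<mu> * f (bdry x)) \<longleftrightarrow>
     (\<exists>f\<^sub>0. admissible_datum p J f\<^sub>0 \<and> (AE z in circle_measure. f z = orbit_sum \<phi> J \<mu> f\<^sub>0 z))"
proof
  assume eq: "AE x in lebesgue. f (bdry (iter 1 x)) = \<mu> * f (bdry x)"
  have [measurable]: "(indicator T :: real \<Rightarrow> real) \<in> borel_measurable lebesgue"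
    by (rule borel_imp_lebesgue_measurable) (use T in measurable)
  have Tl: "T \<in> sets lebesgue" using T by auto
  have f': "(\<lambda>x. f (bdry x)) \<in> borel_measurable lebesgue"
     "integrable lebesgue (\<lambda>x. cauchy_weight x * \<bar>f (bdry x)\<bar> powr p)"
     "AE x in lebesgue. 0 < f (bdry x)" "integrable lebesgue (\<lambda>x. cauchy_weight x * ln (f (bdry x)))"
    using f by (auto simp: in_Lp_circle_iff log_in_L1_circle_iff)
  have "admissible_datum p J f"
    unfolding admissible_datum_iff
    using f(1) f'(1,3) integrable_mult_indicator[OF Tl f'(2)] integrable_mult_indicator[OF Tl f'(4)]
    by (auto simp: norm_bdry elim: eventually_mono)
  moreover have "AE z in circle_measure. f z = orbit_sum \<phi> J \<mu> f z"
    unfolding circle_AE_iff by (rule functional_equation_imp_orbit_sum[OF eq \<mu>])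
  ultimately show "\<exists>f\<^sub>0. admissible_datum p J f\<^sub>0 \<and> (AE z in circle_measure. f z = orbit_sum \<phi> J \<mu> f\<^sub>0 z)"
    by blast
next
  assume "\<exists>f\<^sub>0. admissible_datum p J f\<^sub>0 \<and> (AE z in circle_measure. f z = orbit_sum \<phi> J \<mu> f\<^sub>0 z)"
  then obtain f\<^sub>0 where "AE x in lebesgue. f (bdry x) = line_orbit_sum \<mu> (\<lambda>x. f\<^sub>0 (bdry x)) x"
    by (auto simp: circle_AE_iff orbit_sum_bdry)
  moreover from this have "AE x in lebesgue. f (bdry (iter 1 x)) = line_orbit_sum \<mu> (\<lambda>x. f\<^sub>0 (bdry x)) (iter 1 x)"
    by (rule AE_affine_iter[OF a])
  ultimately show "AE x in lebesgue. f (bdry (iter 1 x)) = \<mu> * f (bdry x)"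
    by eventually_elim (use \<mu> line_orbit_sum_iter[of \<mu> _ 1] in simp)
qed

end

section \<open>Orbit sums as boundary functions and the unimodular factor\<close>

lemma ln_power_int: "0 < (x::real) \<Longrightarrow> ln (x powi n) = of_int n * ln x"
  by (auto simp: power_int_def ln_realpow ln_inverse)

context circle_tiling begin

lemma line_orbit_sum_nonneg:
  assumes "\<And>x. x \<in> T \<Longrightarrow> 0 \<le> f (bdry x)" "0 < \<mu>"
  shows "0 \<le> line_orbit_sum \<mu> (\<lambda>x. f (bdry x)) x"
  using assms iter_tile_index[of x] by (auto simp: line_orbit_sum_def indicator_def)

text \<open>Nonnegativity is required at every point of the circle, including the fixed point \<open>1\<close>, which has no
  half-plane coordinate.\<close>

lemma sphere_cases:
  assumes "z \<in> sphere 0 1" obtains "z = 1" | x where "z = bdry x"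
proof (cases "z = 1")
  case False
  then have "Im (cayley z) = 0" using assms by (simp add: Im_cayley)
  then have "cayley z = of_real (Re (cayley z))" by (simp add: complex_eq_iff)
  then have "z = bdry (Re (cayley z))" unfolding bdry_def by (metis False cayley_inv_cayley)
  then show ?thesis using that by blast
qed (use that in blast)

lemma orbit_sum_sphere_nonneg:
  assumes f: "\<And>x. x \<in> T \<Longrightarrow> 0 \<le> f (bdry x)" and \<mu>: "0 < \<mu>" and z: "z \<in> sphere 0 1"
  shows "0 \<le> orbit_sum \<phi> J \<mu> f z"
  using z
proof (cases rule: sphere_cases)
  case 1
  have "1 \<notin> int_iter \<phi> n ` J" for n
    using bdry_ne_1 by (auto simp: J int_iter_bdry)
  then show ?thesis by (simp add: orbit_sum_def 1)
next
  case (2 x)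
  then show ?thesis using line_orbit_sum_nonneg[of f \<mu> x] f \<mu> by (simp add: orbit_sum_bdry)
qed

lemma AE_line_orbit_sum_pos:
  assumes "AE x in lebesgue. x \<in> T \<longrightarrow> 0 < f (bdry x)" "0 < \<mu>"
  shows "AE x in lebesgue. 0 < line_orbit_sum \<mu> (\<lambda>x. f (bdry x)) x"
proof -
  have "AE x in lebesgue. iter n x \<in> T \<longrightarrow> 0 < f (bdry (iter n x))" for n
    by (rule AE_affine_iter[OF a assms(1)])
  then have "AE x in lebesgue. \<forall>n. iter n x \<in> T \<longrightarrow> 0 < f (bdry (iter n x))"
    unfolding AE_all_countable by blast
  then show ?thesis using AE_tiled
    by eventually_elim (use assms(2) in \<open>simp add: line_orbit_sum_def iter_tile_index\<close>)
qed

lemma integrable_weight_on_T: "integrable lebesgue (\<lambda>x. indicator T x * cauchy_weight x)"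
  using integrable_mult_indicator[OF _ integrable_cauchy_weight, of T] T by auto

text \<open>On the \<open>n\<close>-th tile the \<open>p\<close>-th power of the orbit sum is \<open>\<mu>\<^sup>p\<^sup>n f\<^sub>0\<^sup>p\<close> and its logarithm is
  \<open>n log \<mu> + log f\<^sub>0\<close>. This explains the series: the first governs membership in \<open>L\<^sup>p\<close>, the others
  integrability of the logarithm, where the one with the factor \<open>\<bar>n\<bar>\<close> matters only if \<open>log \<mu> \<noteq> 0\<close>.\<close>

lemma is_outer_orbit_sum:
  assumes f: "admissible_datum p J f" and \<mu>: "0 < \<mu>"
    and sum_p: "integrable (count_space UNIV) (\<lambda>n. (\<mu> powi n) powr p * \<rho> n)"
    and sum_log: "integrable (count_space UNIV) \<rho>"
      "\<mu> = 1 \<or> integrable (count_space UNIV) (\<lambda>n. \<bar>of_int n\<bar> * \<rho> n)"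
  shows "is_outer p (outer_fun (orbit_sum \<phi> J \<mu> f)) (orbit_sum \<phi> J \<mu> f)"
proof -
  let ?F = "line_orbit_sum \<mu> (\<lambda>x. f (bdry x))"
  have f0: "\<And>x. x \<in> T \<Longrightarrow> 0 \<le> f (bdry x)" and fm: "(\<lambda>x. indicator T x * f (bdry x)) \<in> borel_measurable lebesgue"
    and fp: "integrable lebesgue (\<lambda>x. indicator T x * (cauchy_weight x * \<bar>f (bdry x)\<bar> powr p))"
    and fpos: "AE x in lebesgue. x \<in> T \<longrightarrow> 0 < f (bdry x)"
    and fl: "integrable lebesgue (\<lambda>x. indicator T x * (cauchy_weight x * ln (f (bdry x))))"
    using f by (auto simp: admissible_datum_iff)
  have Fm[measurable]: "?F \<in> borel_measurable lebesgue"
    by (rule line_orbit_sum_measurable[OF fm])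
  have F_iter: "?F (iter n x) = \<mu> powi n * f (bdry x)" if "x \<in> T" for n x
    using \<mu> by (simp add: line_orbit_sum_iter line_orbit_sum_T[OF that])
  have Lp: "in_Lp p circle_measure (orbit_sum \<phi> J \<mu> f)"
    unfolding in_Lp_circle_iff orbit_sum_bdry
  proof (intro conjI Fm integrable_weight_if_dominated[OF _ _ fp _ sum_p])
    show "\<bar>\<bar>?F (iter n x)\<bar> powr p\<bar> \<le> (\<mu> powi n) powr p * \<bar>f (bdry x)\<bar> powr p" if "x \<in> T" for n x
      using \<mu> by (simp add: F_iter[OF that] abs_mult powr_mult)
  qed auto
  have log: "log_in_L1 circle_measure (orbit_sum \<phi> J \<mu> f)"
    unfolding log_in_L1_circle_iff orbit_sum_bdry
  proof (intro conjI AE_line_orbit_sum_pos fpos \<mu>)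
    \<comment> \<open>Bounds \<open>\<bar>n log \<mu> + log f\<^sub>0\<bar>\<close> by the product of \<open>s n\<close> with \<open>1 + \<bar>log f\<^sub>0\<bar>\<close>.\<close>
    define s where "s n = 1 + \<bar>of_int n\<bar> * \<bar>ln \<mu>\<bar>" for n :: int
    have "integrable (count_space UNIV) (\<lambda>n. \<rho> n + \<bar>ln \<mu>\<bar> * (\<bar>of_int n\<bar> * \<rho> n))"
      using sum_log by auto
    then have s: "integrable (count_space UNIV) (\<lambda>n. s n * \<rho> n)"
      by (simp add: s_def algebra_simps)
    have h: "integrable lebesgue (\<lambda>x. indicator T x * (cauchy_weight x * (1 + \<bar>ln (f (bdry x))\<bar>)))"
      using Bochner_Integration.integrable_add[OF integrable_weight_on_T integrable_abs[OF fl]]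
      by (simp add: abs_mult algebra_simps)
    show "integrable lebesgue (\<lambda>x. cauchy_weight x * ln (?F x))"
    proof (rule integrable_weight_if_dominated[OF _ _ h _ s])
      show "(\<lambda>x. ln (?F x)) \<in> borel_measurable lebesgue" by measurable
      fix n x assume x: "x \<in> T"
      show "\<bar>ln (?F (iter n x))\<bar> \<le> s n * (1 + \<bar>ln (f (bdry x))\<bar>)"
      \<comment> \<open>Points with \<open>f\<^sub>0 = 0\<close> form a null set, but the bound is needed at all points; there \<open>ln 0 = 0\<close>.\<close>
      proof (cases "f (bdry x) = 0")
        case True
        then show ?thesis by (simp add: F_iter[OF x] s_def)
      next
        case False
        then have "ln (?F (iter n x)) = of_int n * ln \<mu> + ln (f (bdry x))"
          using f0[OF x] \<mu> by (simp add: F_iter[OF x] ln_mult ln_power_int)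
        then have "\<bar>ln (?F (iter n x))\<bar> \<le> \<bar>of_int n\<bar> * \<bar>ln \<mu>\<bar> + \<bar>ln (f (bdry x))\<bar>"
          by (metis abs_mult abs_triangle_ineq)
        also have "\<dots> \<le> s n * (1 + \<bar>ln (f (bdry x))\<bar>)"
          by (simp add: s_def algebra_simps)
        finally show ?thesis .
      qed
    qed (auto simp: s_def)
  qed
  show ?thesis
    unfolding is_outer_def
    using Lp log outer_fun_hardy[OF log Lp] orbit_sum_sphere_nonneg[of f \<mu>] f0 \<mu> by auto
qed

text \<open>The given function is replaced by the orbit sum to which it is equal almost everywhere: for the latter
  the functional equation holds at every point.\<close>

lemma summable_if_functional_equation:
  assumes f: "in_Lp p circle_measure f" "log_in_L1 circle_measure f" and \<mu>: "0 < \<mu>"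
    and eq: "AE x in lebesgue. f (bdry (iter 1 x)) = \<mu> * f (bdry x)"
  shows "integrable (count_space UNIV) (\<lambda>n. (\<mu> powi n) powr p * \<rho> n)"
proof -
  let ?F = "line_orbit_sum \<mu> (\<lambda>x. f (bdry x))"
  have f': "(\<lambda>x. f (bdry x)) \<in> borel_measurable lebesgue"
     "integrable lebesgue (\<lambda>x. cauchy_weight x * \<bar>f (bdry x)\<bar> powr p)"
     "AE x in lebesgue. 0 < f (bdry x)"
    using f by (auto simp: in_Lp_circle_iff log_in_L1_circle_iff)
  note [measurable] = f'(1)
  have [measurable]: "(indicator T :: real \<Rightarrow> real) \<in> borel_measurable lebesgue"
    by (rule borel_imp_lebesgue_measurable) (use T in measurable)
  have [measurable]: "cauchy_weight \<in> borel_measurable lebesgue" by (auto intro: borel_imp_lebesgue_measurable)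
  have [measurable]: "?F \<in> borel_measurable lebesgue"
    by (intro line_orbit_sum_measurable) measurable
  have "AE x in lebesgue. f (bdry x) = ?F x"
    using functional_equation_imp_orbit_sum[OF eq \<mu>] by (simp add: orbit_sum_bdry)
  then have "AE x in lebesgue. cauchy_weight x * \<bar>f (bdry x)\<bar> powr p = cauchy_weight x * \<bar>?F x\<bar> powr p"
    by eventually_elim simp
  then have "integrable lebesgue (\<lambda>x. cauchy_weight x * \<bar>?F x\<bar> powr p)"
    by (intro integrable_cong_AE_imp[OF f'(2)]) measurable
  then show ?thesis
  proof (rule summable_if_integrable_weight)
    show "(\<mu> powi n) powr p * \<bar>f (bdry x)\<bar> powr p \<le> \<bar>\<bar>?F (iter n x)\<bar> powr p\<bar>" if "x \<in> T" for n x
      using \<mu> by (simp add: line_orbit_sum_iter line_orbit_sum_T[OF that] abs_mult powr_mult)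
    show "AE x in lebesgue. x \<in> T \<longrightarrow> 0 < \<bar>f (bdry x)\<bar> powr p"
      using f'(3) by eventually_elim auto
  qed auto
qed

text \<open>The unimodular part of the value of an outer function at \<open>\<phi>(0)\<close>: the point \<open>0\<close> of the disc has the
  coordinate \<open>\<i>\<close> in the half-plane.\<close>

definition phase :: "(complex \<Rightarrow> real) \<Rightarrow> complex" where
  "phase f = cis (Im (LINT x|lebesgue. hp_herglotz (of_real a * \<i> + of_real t) x * of_real (ln (f (bdry x)))))"

text \<open>An outer function is positive at \<open>0\<close>, since the kernel is real there. So the functional equation at the
  point \<open>0\<close> determines \<open>\<gamma>\<close> as the unimodular part of the value at \<open>\<phi>(0)\<close>.\<close>

lemma functional_equation_factor:
  assumes \<gamma>: "\<gamma> \<in> sphere 0 1" and \<mu>: "0 < \<mu>"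
    and eq: "\<And>z. z \<in> ball 0 1 \<Longrightarrow> outer_fun f (\<phi> z) = \<gamma> * of_real \<mu> * outer_fun f z"
  shows "\<gamma> = phase f"
proof -
  define L where "L w = (LINT x|lebesgue. hp_herglotz w x * of_real (ln (f (bdry x))))" for w
  have "hp_herglotz \<i> x = of_real (cauchy_weight x / (2 * pi))" for x
  proof -
    have "\<i> * (1 + of_real x * \<i>) = \<i> - of_real x" by (simp add: algebra_simps)
    moreover have "\<i> - of_real x \<noteq> 0" by (simp add: complex_eq_iff)
    ultimately show ?thesis by (simp add: hp_herglotz_def cauchy_weight_def mult.commute)
  qed
  then have "L \<i> = (LINT x|lebesgue. of_real (cauchy_weight x / (2 * pi) * ln (f (bdry x))))"
    unfolding L_def by simp
  also have "\<dots> = of_real (LINT x|lebesgue. cauchy_weight x / (2 * pi) * ln (f (bdry x)))"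
    by (rule integral_complex_of_real)
  finally obtain r where r: "L \<i> = of_real r" by blast
  have "exp (L (of_real a * \<i> + of_real t)) = \<gamma> * of_real \<mu> * exp (L \<i>)"
    using eq[of "cayley_inv \<i>"] upper_image[of \<i>] norm_cayley_inv_less_1[of \<i>]
    by (simp add: \<phi>_cayley_inv outer_fun_cayley_inv L_def)
  then have e: "exp (L (of_real a * \<i> + of_real t)) = \<gamma> * of_real (\<mu> * exp r)"
    by (simp add: r exp_of_real)
  then have "norm (exp (L (of_real a * \<i> + of_real t))) = \<mu> * exp r"
    using \<gamma> \<mu> by (simp add: norm_mult)
  then have "exp (L (of_real a * \<i> + of_real t)) = of_real (\<mu> * exp r) * phase f"
    using exp_eq_polar[of "L (of_real a * \<i> + of_real t)"] by (simp add: phase_def L_def)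
  then show ?thesis using e \<mu> by simp
qed

lemma tile_index_reflect:
  assumes t: "t = 0" and sym: "\<And>x. x \<in> T \<longleftrightarrow> - x \<in> T"
  shows "tile_index (- x) = tile_index x"
proof -
  have m: "iter n (- x) = - iter n x" for n x using t by (simp add: affine_iter_def)
  have "(\<lambda>n. iter (-n) (-x) \<in> T) = (\<lambda>n. iter (-n) x \<in> T)"
    unfolding m using sym by blast
  then show ?thesis unfolding tile_index_def tiled_def by simp
qed

text \<open>Changing the eigenvalue from \<open>1\<close> to \<open>\<mu>\<close> adds \<open>log \<mu>\<close> times the tile index to the logarithm of the orbit
  sum. For a dilation and a symmetric tile the index is an even function, and \<open>\<phi>(0)\<close> lies on the imaginary
  axis, where the imaginary part of the kernel is odd. So this term does not contribute to the argument.\<close>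

lemma phase_orbit_sum:
  assumes t: "t = 0" and sym: "\<And>x. x \<in> T \<longleftrightarrow> - x \<in> T" and \<mu>: "0 < \<mu>"
    and sum: "integrable (count_space UNIV) (\<lambda>n. \<bar>of_int n\<bar> * \<rho> n)"
    and f: "admissible_datum p J f" and l1: "log_in_L1 circle_measure (orbit_sum \<phi> J 1 f)"
  shows "phase (orbit_sum \<phi> J \<mu> f) = phase (orbit_sum \<phi> J 1 f)"
proof -
  let ?K = "hp_herglotz (of_real a * \<i> + of_real t)"
  have w: "0 < Im (of_real a * \<i> + of_real t)" "Re (of_real a * \<i> + of_real t) = 0" using a t by auto
  let ?F = "\<lambda>\<mu>. line_orbit_sum \<mu> (\<lambda>x. f (bdry x))"
  have fpos: "AE x in lebesgue. x \<in> T \<longrightarrow> 0 < f (bdry x)" and fm: "(\<lambda>x. indicator T x * f (bdry x)) \<in> borel_measurable lebesgue"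
    using f by (auto simp: admissible_datum_iff)
  have [measurable]: "?F \<nu> \<in> borel_measurable lebesgue" for \<nu>
    by (rule line_orbit_sum_measurable[OF fm])
  define N where "N x = (of_int (tile_index x) :: real)" for x
  have Nm[measurable]: "N \<in> borel_measurable lebesgue"
    unfolding N_def by (rule measurable_compose[OF tile_index_measurable]) simp
  have Ni: "integrable lebesgue (\<lambda>x. cauchy_weight x * N x)"
  proof (rule integrable_weight_if_dominated[OF Nm, of _ "\<lambda>_. 1", OF _ _ _ sum])
    show "\<bar>N (iter n x)\<bar> \<le> \<bar>of_int n\<bar> * 1" if "x \<in> T" for n x
      using that by (simp add: N_def tile_index_iter T_tiled tile_index_T)
  qed (use integrable_weight_on_T in auto)
  have KN: "integrable lebesgue (\<lambda>x. ?K x * of_real (N x))"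
    by (rule integrable_hp_herglotz(1)[OF w(1) Ni])
  have "Im (LINT x|lebesgue. ?K x * of_real (N x)) = (LINT x|lebesgue. Im (?K x) * N x)"
    using KN by (subst integral_Im[symmetric]) auto
  also have "\<dots> = 0"
  proof -
    have "(LINT x|lebesgue. Im (?K x) * N x) = (LINT x|lebesgue. Im (?K (- x)) * N (- x))"
      by (subst lebesgue_integral_real_affine[of "-1" _ 0]) auto
    also have "\<dots> = - (LINT x|lebesgue. Im (?K x) * N x)"
      using tile_index_reflect[OF t sym] by (simp add: hp_herglotz_reflect[OF w(2)] N_def)
    finally show ?thesis by simp
  qed
  finally have odd: "Im (LINT x|lebesgue. ?K x * of_real (N x)) = 0" .
  have K1: "integrable lebesgue (\<lambda>x. ?K x * of_real (ln (?F 1 x)))"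
    using l1 by (intro integrable_hp_herglotz(1)[OF w(1)]) (simp add: log_in_L1_circle_iff orbit_sum_bdry)
  have [measurable]: "?K \<in> borel_measurable lebesgue" by (auto intro: borel_imp_lebesgue_measurable)
  have "AE x in lebesgue. ln (?F \<mu> x) = ln \<mu> * N x + ln (?F 1 x)"
    using AE_line_orbit_sum_pos[OF fpos, of 1, simplified]
  proof eventually_elim
    case (elim x)
    have "?F \<mu> x = \<mu> powi tile_index x * ?F 1 x"
      by (simp add: line_orbit_sum_def)
    then show ?case using elim \<mu> by (simp add: ln_mult ln_power_int N_def mult.commute)
  qed
  then have "(LINT x|lebesgue. ?K x * of_real (ln (?F \<mu> x))) = (LINT x|lebesgue. of_real (ln \<mu>) * (?K x * of_real (N x)) + ?K x * of_real (ln (?F 1 x)))"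
  proof (intro integral_cong_AE)
    assume ae: "AE x in lebesgue. ln (?F \<mu> x) = ln \<mu> * N x + ln (?F 1 x)"
    then show "AE x in lebesgue. ?K x * of_real (ln (?F \<mu> x)) = of_real (ln \<mu>) * (?K x * of_real (N x)) + ?K x * of_real (ln (?F 1 x))"
      by eventually_elim (simp add: algebra_simps)
  qed measurable
  also have "\<dots> = of_real (ln \<mu>) * (LINT x|lebesgue. ?K x * of_real (N x)) + (LINT x|lebesgue. ?K x * of_real (ln (?F 1 x)))"
    using KN K1 by simp
  finally show ?thesis
    using odd by (simp add: phase_def orbit_sum_bdry)
qed

lemma is_outer_eq_outer_fun:
  "is_outer p F f \<Longrightarrow> z \<in> ball 0 1 \<Longrightarrow> F z = outer_fun f z"
  by (simp add: is_outer_def)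

lemma outer_eigen_iff:
  assumes F: "is_outer p F f" and \<mu>: "0 < \<mu>"
  shows "(\<exists>\<gamma>\<in>sphere 0 1. \<forall>z\<in>ball 0 1. F (\<phi> z) = \<gamma> * of_real \<mu> * F z) \<longleftrightarrow>
         (AE x in lebesgue. f (bdry (iter 1 x)) = \<mu> * f (bdry x))"
  using functional_equation_iff[OF _ \<mu>, of f] F \<phi>_ball
  by (simp add: is_outer_def)

lemma outer_fun_cong_AE:
  assumes "log_in_L1 circle_measure f" "log_in_L1 circle_measure g"
    and "AE z in circle_measure. f z = g z" and z: "z \<in> ball 0 1"
  shows "outer_fun f z = outer_fun g z"
proof -
  obtain w where w: "0 < Im w" "z = cayley_inv w" using ball_cayley_inv[OF z] .
  have [measurable]: "(\<lambda>x. ln (f (bdry x))) \<in> borel_measurable lebesgue" "(\<lambda>x. ln (g (bdry x))) \<in> borel_measurable lebesgue"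
    using assms(1,2) lebesgue_weight_measurable_iff[of "\<lambda>x. ln (f (bdry x))"] lebesgue_weight_measurable_iff[of "\<lambda>x. ln (g (bdry x))"]
    by (auto simp: log_in_L1_circle_iff)
  have [measurable]: "hp_herglotz w \<in> borel_measurable lebesgue" by (auto intro: borel_imp_lebesgue_measurable)
  show ?thesis
    unfolding w(2) outer_fun_cayley_inv[OF w(1)]
    using assms(3) by (intro arg_cong[where f = exp] integral_cong_AE) (auto simp: circle_AE_iff elim: eventually_mono)
qed

lemma admissible_datum_one: "admissible_datum p J (\<lambda>_. 1)"
  unfolding admissible_datum_iff
  using integrable_weight_on_T T by (auto intro!: borel_imp_lebesgue_measurable)

text \<open>The statement for both kinds of automorphism at once. The admissible eigenvalues are those for which the
  series of the \<open>p\<close>-th powers converges; independence of the unimodular factor is either void, because only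
  one eigenvalue occurs, or a consequence of the reflection symmetry.\<close>

theorem eigenvalue_description:
  assumes p: "0 < p"
    and \<Lambda>: "\<And>\<mu>. \<mu> \<in> \<Lambda> \<longleftrightarrow> 0 < \<mu> \<and> integrable (count_space UNIV) (\<lambda>n. (\<mu> powi n) powr p * \<rho> n)"
    and sum0: "integrable (count_space UNIV) \<rho>"
    and sym: "\<Lambda> = {1} \<or> t = 0 \<and> (\<forall>x. x \<in> T \<longleftrightarrow> - x \<in> T) \<and> integrable (count_space UNIV) (\<lambda>n. \<bar>of_int n\<bar> * \<rho> n)"
  shows
    "(\<forall>\<mu>>0.
        (\<exists>F f. is_outer p F f \<and>
           (\<exists>\<gamma>\<in>sphere 0 1. \<forall>z\<in>ball 0 1. F (\<phi> z) = \<gamma> * of_real \<mu> * F z)) \<longleftrightarrow> \<mu> \<in> \<Lambda>) \<and>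
     (\<forall>\<mu>>0. \<forall>F f. is_outer p F f \<longrightarrow>
        ((\<exists>\<gamma>\<in>sphere 0 1. \<forall>z\<in>ball 0 1. F (\<phi> z) = \<gamma> * of_real \<mu> * F z) \<longleftrightarrow>
         (\<exists>f\<^sub>0. admissible_datum p J f\<^sub>0 \<and>
            (AE z in circle_measure. f z = orbit_sum \<phi> J \<mu> f\<^sub>0 z)))) \<and>
     (\<forall>f\<^sub>0. admissible_datum p J f\<^sub>0 \<longrightarrow>
        (\<exists>\<gamma>\<in>sphere 0 1. \<forall>\<mu>\<in>\<Lambda>.
           is_outer p (outer_fun (orbit_sum \<phi> J \<mu> f\<^sub>0)) (orbit_sum \<phi> J \<mu> f\<^sub>0) \<and>
           (\<forall>F f. is_outer p F f \<and>
              (AE z in circle_measure. f z = orbit_sum \<phi> J \<mu> f\<^sub>0 z) \<longrightarrow>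
              (\<forall>z\<in>ball 0 1. F (\<phi> z) = \<gamma> * of_real \<mu> * F z))))"
proof -
  have description: "(\<exists>\<gamma>\<in>sphere 0 1. \<forall>z\<in>ball 0 1. F (\<phi> z) = \<gamma> * of_real \<mu> * F z) \<longleftrightarrow>
         (\<exists>f\<^sub>0. admissible_datum p J f\<^sub>0 \<and> (AE z in circle_measure. f z = orbit_sum \<phi> J \<mu> f\<^sub>0 z))"
    if \<mu>: "0 < \<mu>" and F: "is_outer p F f" for \<mu> F f
    using outer_eigen_iff[OF F \<mu>] functional_equation_iff_orbit_sum[of f p \<mu>] F \<mu> by (simp add: is_outer_def)
  have outer: "is_outer p (outer_fun (orbit_sum \<phi> J \<mu> g)) (orbit_sum \<phi> J \<mu> g)"
    if g: "admissible_datum p J g" and \<mu>: "\<mu> \<in> \<Lambda>" for \<mu> g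
    using is_outer_orbit_sum[OF g] \<mu> \<Lambda>[of \<mu>] sum0 sym by auto
  have 1: "1 \<in> \<Lambda>" using sum0 by (simp add: \<Lambda>)
  have ph: "phase (orbit_sum \<phi> J \<mu> g) = phase (orbit_sum \<phi> J 1 g)" if g: "admissible_datum p J g" and \<mu>: "\<mu> \<in> \<Lambda>" for g \<mu>
    using sym
  proof (elim disjE conjE)
    assume "\<Lambda> = {1}" then show ?thesis using \<mu> by simp
  next
    assume s: "t = 0" "\<forall>x. x \<in> T \<longleftrightarrow> - x \<in> T" "integrable (count_space UNIV) (\<lambda>n. \<bar>of_int n\<bar> * \<rho> n)"
    show ?thesis
      using phase_orbit_sum[OF s(1) _ _ s(3) g, of \<mu>] s(2) outer[OF g 1] \<mu> \<Lambda>[of \<mu>] by (simp add: is_outer_def)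
  qed
  have eigen: "F (\<phi> z) = phase (orbit_sum \<phi> J 1 g) * of_real \<mu> * F z"
    if g: "admissible_datum p J g" and \<mu>: "\<mu> \<in> \<Lambda>" and F: "is_outer p F f"
      and ae: "AE z in circle_measure. f z = orbit_sum \<phi> J \<mu> g z" and z: "z \<in> ball 0 1" for F f g \<mu> z
  proof -
    let ?g = "orbit_sum \<phi> J \<mu> g"
    have \<mu>0: "0 < \<mu>" using \<mu> \<Lambda> by blast
    note og = outer[OF g \<mu>]
    have "\<exists>\<gamma>\<in>sphere 0 1. \<forall>z\<in>ball 0 1. outer_fun ?g (\<phi> z) = \<gamma> * of_real \<mu> * outer_fun ?g z"
      using description[OF \<mu>0 og] g by auto
    then obtain \<gamma> where \<gamma>: "\<gamma> \<in> sphere 0 1" "\<And>z. z \<in> ball 0 1 \<Longrightarrow> outer_fun ?g (\<phi> z) = \<gamma> * of_real \<mu> * outer_fun ?g z"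
      by blast
    have "\<gamma> = phase (orbit_sum \<phi> J 1 g)"
      using functional_equation_factor[OF \<gamma>(1) \<mu>0 \<gamma>(2)] ph[OF g \<mu>] by simp
    moreover have "F z = outer_fun ?g z" if "z \<in> ball 0 1" for z
      using is_outer_eq_outer_fun[OF F that] outer_fun_cong_AE[OF _ _ ae that] F og by (simp add: is_outer_def)
    ultimately show ?thesis using \<gamma>(2)[OF z] z \<phi>_ball[OF z] by simp
  qed
  have necessary: "\<mu> \<in> \<Lambda>" if \<mu>: "0 < \<mu>" and F: "is_outer p F f"
    and e: "\<exists>\<gamma>\<in>sphere 0 1. \<forall>z\<in>ball 0 1. F (\<phi> z) = \<gamma> * of_real \<mu> * F z" for \<mu> F f
    using summable_if_functional_equation[of p f \<mu>] outer_eigen_iff[OF F \<mu>] e \<mu> F \<Lambda>[of \<mu>] by (simp add: is_outer_def)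
  have sufficient: "\<exists>F f. is_outer p F f \<and> (\<exists>\<gamma>\<in>sphere 0 1. \<forall>z\<in>ball 0 1. F (\<phi> z) = \<gamma> * of_real \<mu> * F z)"
    if \<mu>: "\<mu> \<in> \<Lambda>" for \<mu>
  proof (intro exI conjI)
    show o: "is_outer p (outer_fun (orbit_sum \<phi> J \<mu> (\<lambda>_. 1))) (orbit_sum \<phi> J \<mu> (\<lambda>_. 1))"
      by (rule outer[OF admissible_datum_one \<mu>])
    show "\<exists>\<gamma>\<in>sphere 0 1. \<forall>z\<in>ball 0 1. outer_fun (orbit_sum \<phi> J \<mu> (\<lambda>_. 1)) (\<phi> z)
        = \<gamma> * of_real \<mu> * outer_fun (orbit_sum \<phi> J \<mu> (\<lambda>_. 1)) z"
    proof (subst description[OF _ o])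
      show "0 < \<mu>" using \<mu> \<Lambda> by blast
      show "\<exists>f\<^sub>0. admissible_datum p J f\<^sub>0 \<and>
          (AE z in circle_measure. orbit_sum \<phi> J \<mu> (\<lambda>_. 1) z = orbit_sum \<phi> J \<mu> f\<^sub>0 z)"
        by (intro exI[of _ "\<lambda>_. 1"] conjI admissible_datum_one) simp
    qed
  qed
  show ?thesis
  proof (intro conjI allI impI iffI)
    fix \<mu> :: real assume "0 < \<mu>"
    assume "\<exists>F f. is_outer p F f \<and> (\<exists>\<gamma>\<in>sphere 0 1. \<forall>z\<in>ball 0 1. F (\<phi> z) = \<gamma> * of_real \<mu> * F z)"
    then show "\<mu> \<in> \<Lambda>" using necessary[OF \<open>0 < \<mu>\<close>] by blast
  next
    fix \<mu> :: real assume "\<mu> \<in> \<Lambda>"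
    then show "\<exists>F f. is_outer p F f \<and> (\<exists>\<gamma>\<in>sphere 0 1. \<forall>z\<in>ball 0 1. F (\<phi> z) = \<gamma> * of_real \<mu> * F z)"
      by (rule sufficient)
  next
    fix \<mu> :: real and F f assume h: "0 < \<mu>" "is_outer p F f"
    assume "\<exists>\<gamma>\<in>sphere 0 1. \<forall>z\<in>ball 0 1. F (\<phi> z) = \<gamma> * of_real \<mu> * F z"
    then show "\<exists>f\<^sub>0. admissible_datum p J f\<^sub>0 \<and> (AE z in circle_measure. f z = orbit_sum \<phi> J \<mu> f\<^sub>0 z)"
      by (rule description[OF h, THEN iffD1])
  next
    fix \<mu> :: real and F f assume h: "0 < \<mu>" "is_outer p F f"
    assume "\<exists>f\<^sub>0. admissible_datum p J f\<^sub>0 \<and> (AE z in circle_measure. f z = orbit_sum \<phi> J \<mu> f\<^sub>0 z)"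
    then show "\<exists>\<gamma>\<in>sphere 0 1. \<forall>z\<in>ball 0 1. F (\<phi> z) = \<gamma> * of_real \<mu> * F z"
      by (rule description[OF h, THEN iffD2])
  next
    fix g assume g: "admissible_datum p J g"
    show "\<exists>\<gamma>\<in>sphere 0 1. \<forall>\<mu>\<in>\<Lambda>.
           is_outer p (outer_fun (orbit_sum \<phi> J \<mu> g)) (orbit_sum \<phi> J \<mu> g) \<and>
           (\<forall>F f. is_outer p F f \<and> (AE z in circle_measure. f z = orbit_sum \<phi> J \<mu> g z) \<longrightarrow>
              (\<forall>z\<in>ball 0 1. F (\<phi> z) = \<gamma> * of_real \<mu> * F z))"
    proof (intro bexI[of _ "phase (orbit_sum \<phi> J 1 g)"] ballI conjI allI impI; (elim conjE)?)
      show "phase (orbit_sum \<phi> J 1 g) \<in> sphere 0 1" by (simp add: phase_def)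
      show "is_outer p (outer_fun (orbit_sum \<phi> J \<mu> g)) (orbit_sum \<phi> J \<mu> g)" if "\<mu> \<in> \<Lambda>" for \<mu>
        by (rule outer[OF g that])
      show "F (\<phi> z) = phase (orbit_sum \<phi> J 1 g) * of_real \<mu> * F z"
        if "\<mu> \<in> \<Lambda>" "z \<in> ball 0 1" "is_outer p F f" "AE z in circle_measure. f z = orbit_sum \<phi> J \<mu> g z" for \<mu> F f z
        by (rule eigen[OF g that(1,3,4,2)])
    qed
  qed
qed

end

section \<open>Hyperbolic and parabolic automorphisms\<close>

text \<open>The two halves of the series overlap in the term for \<open>0\<close>, which is harmless for convergence.\<close>

lemma integrable_count_space_int:
  fixes g :: "int \<Rightarrow> real"
  assumes "\<And>n. 0 \<le> g n"
  shows "integrable (count_space UNIV) g \<longleftrightarrow> summable (\<lambda>k. g (int k)) \<and> summable (\<lambda>k. g (- int k))"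
proof -
  have nat: "g summable_on range f \<longleftrightarrow> summable (\<lambda>k. g (f k))" if f: "inj f" for f :: "nat \<Rightarrow> int"
  proof -
    have "g summable_on range f \<longleftrightarrow> (g \<circ> f) summable_on UNIV"
      by (rule summable_on_reindex[OF f])
    also have "\<dots> \<longleftrightarrow> summable (g \<circ> f)"
      using assms by (intro summable_on_UNIV_nonneg_real_iff) simp
    finally show ?thesis by (simp add: comp_def)
  qed
  have "range int \<union> range (\<lambda>k. - int k) = UNIV"
    by (auto simp: image_iff) (metis int_cases2)
  then have "g summable_on UNIV \<longleftrightarrow> g summable_on range int \<and> g summable_on range (\<lambda>k. - int k)"
    by (metis sup_ge1 sup_ge2 summable_on_subset_banach summable_on_union)
  also have "\<dots> \<longleftrightarrow> summable (\<lambda>k. g (int k)) \<and> summable (\<lambda>k. g (- int k))"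
    by (simp add: nat inj_on_def)
  finally show ?thesis
    unfolding Infinite_Set_Sum.abs_summable_on_def[symmetric] abs_summable_equivalent
      summable_on_iff_abs_summable_on_real .
qed

lemma disc_conj_bdry: "disc_conj \<tau> (bdry x) = cayley_inv (\<tau> (of_real x))"
  by (simp add: disc_conj_def bdry_ne_1 cayley_bdry)

lemma disc_conj_cayley_inv:
  assumes "0 < Im w" shows "disc_conj \<tau> (cayley_inv w) = cayley_inv (\<tau> w)"
proof -
  have "cayley_inv w \<noteq> 1" using norm_cayley_inv_less_1[OF assms] by auto
  then show ?thesis by (simp add: disc_conj_def cayley_cayley_inv upper_ne(2)[OF assms])
qed

lemma disc_conj_inj:
  assumes inj: "inj \<tau>" and upper: "\<And>w. 0 \<le> Im w \<Longrightarrow> 0 \<le> Im (\<tau> w)"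
  shows "inj_on (disc_conj \<tau>) (cball 0 1)"
proof (rule inj_onI)
  have ne: "\<tau> (cayley z) + \<i> \<noteq> 0" if "z \<in> cball 0 1" for z
  proof -
    have "0 \<le> Im (cayley z)" using that by (simp add: Im_cayley power_le_one)
    from upper[OF this] show ?thesis by (auto simp: complex_eq_iff)
  qed
  have ne1: "cayley_inv v \<noteq> 1" if "v + \<i> \<noteq> 0" for v
  proof
    assume "cayley_inv v = 1"
    then have "v - \<i> = v + \<i>" using that by (simp add: cayley_inv_def)
    then show False by (simp add: complex_eq_iff)
  qed
  fix z w assume z: "z \<in> cball 0 1" and w: "w \<in> cball 0 1" and eq: "disc_conj \<tau> z = disc_conj \<tau> w"
  show "z = w"
  proof (cases "z = 1 \<or> w = 1")
    case True
    then show ?thesis using eq ne1[OF ne[OF z]] ne1[OF ne[OF w]] by (auto simp: disc_conj_def split: if_splits)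
  next
    case False
    then have "cayley_inv (\<tau> (cayley z)) = cayley_inv (\<tau> (cayley w))" using eq by (simp add: disc_conj_def)
    then have "\<tau> (cayley z) = \<tau> (cayley w)" by (metis cayley_cayley_inv ne z w)
    then have "cayley z = cayley w" using inj by (simp add: inj_eq)
    then show ?thesis using False by (metis cayley_inv_cayley)
  qed
qed

lemma bdry_image_of_cayley_image:
  assumes "cayley ` J = of_real ` T" "1 \<notin> J" shows "J = bdry ` T"
proof -
  have "cayley_inv (cayley z) = z" if "z \<in> J" for z
    using assms(2) that by (intro cayley_inv_cayley) auto
  then have "J = cayley_inv ` cayley ` J" by (simp add: image_image)
  also have "\<dots> = bdry ` T" unfolding assms(1) image_image bdry_def ..
  finally show ?thesis .
qed

lemma disc_conj_circle_tiling:
  assumes "line_tiling a t T \<rho> c C" and J: "cayley ` J = of_real ` T" "1 \<notin> J"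
  shows "circle_tiling a t T \<rho> c C (disc_conj (\<lambda>w. of_real a * w + of_real t)) J"
proof -
  interpret line_tiling a t T \<rho> c C by fact
  show ?thesis
  proof
    show "disc_conj (\<lambda>w. of_real a * w + of_real t) (bdry x) = bdry (affine_iter a t 1 x)" for x
      unfolding disc_conj_bdry by (simp add: affine_iter_def bdry_def add.commute)
    show "disc_conj (\<lambda>w. of_real a * w + of_real t) (cayley_inv w) = cayley_inv (of_real a * w + of_real t)"
      if "0 < Im w" for w by (rule disc_conj_cayley_inv[OF that])
    show "inj_on (disc_conj (\<lambda>w. of_real a * w + of_real t)) (cball 0 1)"
      using a by (intro disc_conj_inj injI) auto
    show "J = bdry ` T" by (rule bdry_image_of_cayley_image[OF J])
  qed
qed

text \<open>With \<open>b = \<alpha>\<^sup>n\<close> the contraction factor of arc length is \<open>b (1 + x\<^sup>2)/(1 + b\<^sup>2 x\<^sup>2)\<close>. For \<open>1 \<le> x\<^sup>2 \<le> \<alpha>\<^sup>2\<close> it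
  is comparable with \<open>min b (1/b) = \<alpha>\<^sup>-\<^sup>\<bar>\<^sup>n\<^sup>\<bar>\<close>.\<close>

lemma hyperbolic_line_tiling:
  assumes \<alpha>: "1 < \<alpha>"
  shows "line_tiling \<alpha> 0 ({-\<alpha><..-1} \<union> {1..<\<alpha>}) (\<lambda>n. min (\<alpha> powi n) (\<alpha> powi (-n))) 1 (1 + \<alpha>\<^sup>2)"
proof
  let ?T = "{-\<alpha><..-1} \<union> {1..<\<alpha>}"
  have T: "x \<in> ?T \<longleftrightarrow> 1 \<le> \<bar>x\<bar> \<and> \<bar>x\<bar> < \<alpha>" for x by auto
  have iter: "\<bar>affine_iter \<alpha> 0 n x\<bar> = \<alpha> powi n * \<bar>x\<bar>" for n x
    using \<alpha> by (simp add: affine_iter_def abs_mult power_int_abs)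
  show "0 < \<alpha>" "\<alpha> = 1 \<or> (0::real) = 0" "?T \<in> sets borel" using \<alpha> by auto
  have "\<not> negligible {1<..<\<alpha>}" using \<alpha> by (intro open_not_negligible) auto
  then show "\<not> negligible ?T" by (rule contrapos_nn, elim negligible_subset) auto
  show "\<exists>n. affine_iter \<alpha> 0 (- n) x \<in> ?T" if "x \<noteq> 0" for x
  proof (intro exI[of _ "\<lfloor>log \<alpha> \<bar>x\<bar>\<rfloor>"])
    define n where "n = \<lfloor>log \<alpha> \<bar>x\<bar>\<rfloor>"
    have "of_int n \<le> log \<alpha> \<bar>x\<bar>" "log \<alpha> \<bar>x\<bar> < of_int n + 1" by (auto simp: n_def)
    then have "\<alpha> powr of_int n \<le> \<bar>x\<bar>" "\<bar>x\<bar> < \<alpha> powr (of_int n + 1)"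
      using \<alpha> that by (simp_all add: le_log_iff log_less_iff)
    then have "\<alpha> powi n \<le> \<bar>x\<bar>" "\<bar>x\<bar> < \<alpha> powi n * \<alpha>"
      using \<alpha> by (simp_all add: powr_add powr_real_of_int')
    then show "affine_iter \<alpha> 0 (- \<lfloor>log \<alpha> \<bar>x\<bar>\<rfloor>) x \<in> ?T"
      unfolding T iter n_def[symmetric] using \<alpha> by (simp add: power_int_minus field_simps)
  qed
  show "m = n" if "affine_iter \<alpha> 0 m x \<in> ?T" "affine_iter \<alpha> 0 n x \<in> ?T" for m n x
  proof -
    have False if mn: "m < n" and "1 \<le> \<alpha> powi m * \<bar>x\<bar>" "\<alpha> powi n * \<bar>x\<bar> < \<alpha>" for m n
    proof -
      have "\<alpha> powi (m + 1) \<le> \<alpha> powi n" using mn \<alpha> by (intro power_int_increasing) auto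
      then have "\<alpha> powi (m + 1) * \<bar>x\<bar> \<le> \<alpha> powi n * \<bar>x\<bar>" by (intro mult_right_mono) auto
      moreover have "\<alpha> powi (m + 1) * \<bar>x\<bar> = \<alpha> * (\<alpha> powi m * \<bar>x\<bar>)" using \<alpha> by (simp add: power_int_add)
      moreover have "\<alpha> * 1 \<le> \<alpha> * (\<alpha> powi m * \<bar>x\<bar>)" using that(2) \<alpha> by (intro mult_left_mono) auto
      ultimately show False using that(3) by linarith
    qed
    from this[of m n] this[of n m] that show ?thesis unfolding T iter by (meson linorder_neqE)
  qed
  fix n x assume x: "x \<in> ?T"
  define b where "b = \<alpha> powi n"
  have b: "0 < b" "\<alpha> powi (-n) = 1 / b" using \<alpha> by (auto simp: b_def power_int_minus divide_inverse)
  have y: "1 \<le> x\<^sup>2" "x\<^sup>2 \<le> \<alpha>\<^sup>2"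
    using x power_mono[of 1 "\<bar>x\<bar>" 2] power_mono[of "\<bar>x\<bar>" \<alpha> 2] unfolding T by auto
  have w: "cauchy_weight (affine_iter \<alpha> 0 n x) = 2 / (1 + b\<^sup>2 * x\<^sup>2)"
    by (simp add: cauchy_weight_def affine_iter_def b_def power_mult_distrib)
  have pos: "0 < 1 + b\<^sup>2 * x\<^sup>2" by (simp add: add_pos_nonneg)
  show "1 * min (\<alpha> powi n) (\<alpha> powi - n) * cauchy_weight x \<le> \<alpha> powi n * cauchy_weight (affine_iter \<alpha> 0 n x)"
  proof (cases "b \<le> 1")
    case True
    then have "b\<^sup>2 * x\<^sup>2 \<le> 1 * x\<^sup>2" using b by (intro mult_right_mono) (auto simp: power_le_one)
    then have "b * (2 / (1 + x\<^sup>2)) \<le> b * (2 / (1 + b\<^sup>2 * x\<^sup>2))"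
      using b pos by (intro mult_left_mono divide_left_mono) auto
    moreover have "min b (1 / b) * (2 / (1 + x\<^sup>2)) \<le> b * (2 / (1 + x\<^sup>2))" by (intro mult_right_mono) auto
    ultimately show ?thesis unfolding w b(2) b_def[symmetric] by (simp add: cauchy_weight_def)
  next
    case False
    then have "1 \<le> b\<^sup>2" by (simp add: one_le_power)
    have "1 / b * (2 / (1 + x\<^sup>2)) = b * (2 / (b\<^sup>2 * (1 + x\<^sup>2)))" using b by (simp add: power2_eq_square)
    also have "\<dots> \<le> b * (2 / (1 + b\<^sup>2 * x\<^sup>2))"
    proof (intro mult_left_mono divide_left_mono mult_pos_pos)
      show "1 + b\<^sup>2 * x\<^sup>2 \<le> b\<^sup>2 * (1 + x\<^sup>2)" using \<open>1 \<le> b\<^sup>2\<close> by (simp add: distrib_left)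
    qed (use b pos in auto)
    also have "min b (1 / b) * (2 / (1 + x\<^sup>2)) \<le> 1 / b * (2 / (1 + x\<^sup>2))" by (intro mult_right_mono) auto
    ultimately show ?thesis unfolding w b(2) b_def[symmetric] by (simp add: cauchy_weight_def)
  qed
  have \<alpha>2: "1 + x\<^sup>2 \<le> 1 + \<alpha>\<^sup>2" "2 \<le> 1 + \<alpha>\<^sup>2" using y by auto
  show "\<alpha> powi n * cauchy_weight (affine_iter \<alpha> 0 n x) \<le> (1 + \<alpha>\<^sup>2) * min (\<alpha> powi n) (\<alpha> powi - n) * cauchy_weight x"
  proof -
    have 1: "b * (2 / (1 + b\<^sup>2 * x\<^sup>2)) \<le> (1 + \<alpha>\<^sup>2) * b * (2 / (1 + x\<^sup>2))"
    proof -
      have "b * (2 / (1 + b\<^sup>2 * x\<^sup>2)) \<le> b * (2 / 1)"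
        using b pos by (intro mult_left_mono divide_left_mono) auto
      also have "\<dots> = (1 + x\<^sup>2) * (b * (2 / (1 + x\<^sup>2)))"
      proof -
        have "1 + x\<^sup>2 \<noteq> 0" using one_plus_square_pos[of x] by linarith
        then show ?thesis by simp
      qed
      also have "\<dots> \<le> (1 + \<alpha>\<^sup>2) * (b * (2 / (1 + x\<^sup>2)))" using \<alpha>2 b by (intro mult_right_mono) auto
      finally show ?thesis by (simp add: mult.assoc)
    qed
    have 2: "b * (2 / (1 + b\<^sup>2 * x\<^sup>2)) \<le> (1 + \<alpha>\<^sup>2) * (1 / b) * (2 / (1 + x\<^sup>2))"
    proof -
      have "b * (2 / (1 + b\<^sup>2 * x\<^sup>2)) \<le> b * (2 / (b\<^sup>2 * x\<^sup>2))"
        using b y pos by (intro mult_left_mono divide_left_mono mult_pos_pos) auto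
      also have "\<dots> = 1 / b * (2 / x\<^sup>2)" using b by (simp add: power2_eq_square)
      also have "\<dots> \<le> 1 / b * (2 * (2 / (1 + x\<^sup>2)))"
        using b y by (intro mult_left_mono) (auto simp: divide_simps)
      also have "\<dots> = 2 * (1 / b * (2 / (1 + x\<^sup>2)))" by simp
      also have "\<dots> \<le> (1 + \<alpha>\<^sup>2) * (1 / b * (2 / (1 + x\<^sup>2)))" using \<alpha>2 b by (intro mult_right_mono) auto
      finally show ?thesis by (simp add: mult.assoc)
    qed
    show ?thesis
      using 1 2 unfolding w b(2) b_def[symmetric] by (simp add: cauchy_weight_def min_def)
  qed
qed (use \<alpha> in auto)

lemma min_power_inverse_power:
  assumes \<alpha>: "1 < (\<alpha>::real)"
  shows "min (\<alpha> ^ k) (\<alpha> powi - int k) = (1/\<alpha>) ^ k" "min (\<alpha> powi - int k) (\<alpha> ^ k) = (1/\<alpha>) ^ k"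
proof -
  have m: "\<alpha> powi - int k = (1/\<alpha>) ^ k"
    by (simp add: power_int_minus power_one_over inverse_eq_divide)
  have "(1/\<alpha>) ^ k \<le> 1" "1 \<le> \<alpha> ^ k" using \<alpha> by (auto intro!: power_le_one one_le_power)
  then show "min (\<alpha> ^ k) (\<alpha> powi - int k) = (1/\<alpha>) ^ k" "min (\<alpha> powi - int k) (\<alpha> ^ k) = (1/\<alpha>) ^ k"
    unfolding m by (simp_all add: min_def)
qed

lemma power_int_powr: "0 < (\<mu>::real) \<Longrightarrow> (\<mu> powi n) powr p = (\<mu> powr p) powi n"
  by (simp add: powr_real_of_int'[symmetric] powr_powr mult.commute)

lemma powr_less_powr_iff: "0 < p \<Longrightarrow> 0 \<le> x \<Longrightarrow> 0 \<le> y \<Longrightarrow> x powr p < y powr p \<longleftrightarrow> x < (y::real)"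
  by (meson linorder_not_le order_less_imp_le powr_less_mono2 powr_mono2)

text \<open>With \<open>m = \<mu>\<^sup>p\<close> this is a pair of geometric series, with ratios \<open>m/\<alpha>\<close> for \<open>n \<ge> 0\<close> and \<open>1/(m\<alpha>)\<close> for
  \<open>n \<le> 0\<close>; the two bounds for \<open>\<mu>\<close> come from the two ends.\<close>

lemma hyperbolic_summable_iff:
  fixes \<alpha> p \<mu> :: real
  assumes \<alpha>: "1 < \<alpha>" and p: "0 < p" and \<mu>: "0 < \<mu>"
  shows "integrable (count_space UNIV) (\<lambda>n. (\<mu> powi n) powr p * min (\<alpha> powi n) (\<alpha> powi (-n)))
    \<longleftrightarrow> \<alpha> powr (-1/p) < \<mu> \<and> \<mu> < \<alpha> powr (1/p)"
proof -
  define m where "m = \<mu> powr p"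
  have m: "0 < m" using \<mu> by (simp add: m_def)
  note min = min_power_inverse_power[OF \<alpha>]
  have "integrable (count_space UNIV) (\<lambda>n. (\<mu> powi n) powr p * min (\<alpha> powi n) (\<alpha> powi (-n)))
      \<longleftrightarrow> summable (\<lambda>k. (m / \<alpha>) ^ k) \<and> summable (\<lambda>k. (1 / (m * \<alpha>)) ^ k)"
  proof -
    have "m powi int k * min (\<alpha> powi int k) (\<alpha> powi - int k) = (m / \<alpha>) ^ k" for k
      by (simp add: min power_divide)
    moreover have "m powi - int k * min (\<alpha> powi - int k) (\<alpha> powi - (- int k)) = (1 / (m * \<alpha>)) ^ k" for k
      by (simp add: min) (simp add: power_int_minus power_divide power_mult_distrib inverse_eq_divide)
    ultimately show ?thesis
      unfolding power_int_powr[OF \<mu>] m_def[symmetric] using m \<alpha>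
      by (subst integrable_count_space_int) (simp_all only: min_def split: if_split, auto)
  qed
  also have "\<dots> \<longleftrightarrow> m < \<alpha> \<and> 1 / \<alpha> < m"
    using m \<alpha> by (simp add: summable_geometric_iff) (auto simp: divide_simps mult.commute)
  also have "m < \<alpha> \<longleftrightarrow> \<mu> < \<alpha> powr (1/p)"
  proof -
    have "m < \<alpha> \<longleftrightarrow> \<mu> powr p < (\<alpha> powr (1/p)) powr p" using p \<alpha> by (simp add: m_def powr_powr)
    also have "\<dots> \<longleftrightarrow> \<mu> < \<alpha> powr (1/p)" using p \<mu> by (intro powr_less_powr_iff) auto
    finally show ?thesis .
  qed
  also have "1 / \<alpha> < m \<longleftrightarrow> \<alpha> powr (-1/p) < \<mu>"
  proof -
    have "(\<alpha> powr (-1/p)) powr p = \<alpha> powr -1" using p by (simp only: powr_powr) simp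
    then have "1 / \<alpha> < m \<longleftrightarrow> (\<alpha> powr (-1/p)) powr p < \<mu> powr p"
      using \<alpha> by (simp add: m_def powr_minus_divide)
    also have "\<dots> \<longleftrightarrow> \<alpha> powr (-1/p) < \<mu>" using p \<mu> by (intro powr_less_powr_iff) auto
    finally show ?thesis .
  qed
  finally show ?thesis by auto
qed

lemma hyperbolic_index_summable:
  assumes \<alpha>: "1 < (\<alpha>::real)"
  shows "integrable (count_space UNIV) (\<lambda>n. \<bar>of_int n\<bar> * min (\<alpha> powi n) (\<alpha> powi (-n)))"
proof -
  note min = min_power_inverse_power[OF \<alpha>]
  have "summable (\<lambda>k. real (Suc k) * (1/\<alpha>) ^ k)"
    using geometric_deriv_sums[of "1/\<alpha>"] \<alpha> by (auto simp: sums_iff)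
  then have "summable (\<lambda>k. real k * (1/\<alpha>) ^ k)"
    by (rule summable_comparison_test'[of _ 0]) (use \<alpha> in \<open>auto intro!: mult_right_mono\<close>)
  then show ?thesis
    using \<alpha> by (subst integrable_count_space_int) (simp_all add: min)
qed

text \<open>The contraction factor \<open>(1 + x\<^sup>2)/(1 + (nt + x)\<^sup>2)\<close> is comparable with \<open>1/(1 + n\<^sup>2)\<close> for \<open>0 \<le> x < t\<close>; the
  constants come from \<open>(u + v)\<^sup>2 \<le> 2u\<^sup>2 + 2v\<^sup>2\<close>.\<close>

lemma parabolic_line_tiling:
  assumes t: "0 < t"
  shows "line_tiling 1 t {0..<t} (\<lambda>n. 1 / (1 + (of_int n)\<^sup>2)) (1 / (1 + 2 * t\<^sup>2)) ((1 + t\<^sup>2) * (3 + 2 / t\<^sup>2))"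
proof
  have iter: "affine_iter 1 t n x = of_int n * t + x" for n x by (simp add: affine_iter_def)
  have "\<not> negligible {0<..<t}" using t by (intro open_not_negligible) auto
  then show "\<not> negligible {0..<t}" by (rule contrapos_nn, elim negligible_subset) auto
  show "\<exists>n. affine_iter 1 t (- n) x \<in> {0..<t}" for x
  proof (intro exI[of _ "\<lfloor>x / t\<rfloor>"])
    have "of_int \<lfloor>x / t\<rfloor> * t \<le> x" "x < (of_int \<lfloor>x / t\<rfloor> + 1) * t"
      using of_int_floor_le[of "x / t"] floor_correct[of "x / t"] t
      by (simp_all only: pos_le_divide_eq pos_divide_less_eq of_int_add of_int_1 conj_absorb)
    then show "affine_iter 1 t (- \<lfloor>x / t\<rfloor>) x \<in> {0..<t}" unfolding iter using t by (simp add: field_simps)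
  qed
  show "m = n" if "affine_iter 1 t m x \<in> {0..<t}" "affine_iter 1 t n x \<in> {0..<t}" for m n x
  proof -
    have "\<bar>of_int (m - n) * t\<bar> < 1 * t" using that unfolding iter by (auto simp: algebra_simps abs_less_iff)
    then have "\<bar>of_int (m - n)\<bar> < (1::real)" using t unfolding abs_mult by simp
    then show ?thesis by linarith
  qed
  show "0 < 1 / (1 + 2 * t\<^sup>2)" using zero_le_power2[of t] by (intro divide_pos_pos add_pos_nonneg) auto
  fix n x assume x: "x \<in> {0..<t}"
  define y where "y = of_int n * t + x"
  define k where "k = (of_int n :: real)"
  have x2: "x\<^sup>2 \<le> t\<^sup>2" using x by (intro power_mono) auto
  have up: "1 + y\<^sup>2 \<le> (1 + 2 * t\<^sup>2) * (1 + k\<^sup>2)"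
  proof -
    \<comment> \<open>This is \<open>(kt + x)\<^sup>2 \<le> 2 k\<^sup>2 t\<^sup>2 + 2 x\<^sup>2\<close>.\<close>
    have "0 \<le> (k * t - x)\<^sup>2" by simp
    then have "y\<^sup>2 \<le> 2 * (k\<^sup>2 * t\<^sup>2) + 2 * x\<^sup>2" by (simp add: y_def k_def power2_eq_square algebra_simps)
    then show ?thesis using x2 by (simp add: algebra_simps, use zero_le_power2[of k] in linarith)
  qed
  have low: "1 + k\<^sup>2 \<le> (3 + 2 / t\<^sup>2) * (1 + y\<^sup>2)"
  proof -
    \<comment> \<open>As \<open>kt = y - x\<close>, this is \<open>k\<^sup>2 t\<^sup>2 \<le> 2 y\<^sup>2 + 2 x\<^sup>2\<close>.\<close>
    have "0 \<le> (y + x)\<^sup>2" by simp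
    then have "k\<^sup>2 * t\<^sup>2 \<le> 2 * y\<^sup>2 + 2 * x\<^sup>2" by (simp add: y_def k_def power2_eq_square algebra_simps)
    also have "\<dots> \<le> 2 * y\<^sup>2 + 2 * t\<^sup>2" using x2 by simp
    finally have "k\<^sup>2 \<le> 2 / t\<^sup>2 * y\<^sup>2 + 2" using t by (simp add: field_simps)
    moreover have "(3 + 2 / t\<^sup>2) * (1 + y\<^sup>2) = 3 + 2 / t\<^sup>2 + 3 * y\<^sup>2 + 2 / t\<^sup>2 * y\<^sup>2"
      unfolding distrib_left distrib_right by simp
    moreover have "0 \<le> 2 / t\<^sup>2" "0 \<le> y\<^sup>2" by simp_all
    ultimately show ?thesis by linarith
  qed
  show "1 / (1 + 2 * t\<^sup>2) * (1 / (1 + (of_int n)\<^sup>2)) * cauchy_weight x \<le> 1 powi n * cauchy_weight (affine_iter 1 t n x)"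
  proof -
    have "1 / ((1 + 2 * t\<^sup>2) * (1 + k\<^sup>2)) \<le> 1 / (1 + y\<^sup>2)"
      using up by (intro divide_left_mono) (auto simp: add_pos_nonneg)
    moreover have "1 / (1 + x\<^sup>2) \<le> 1 / 1" by (intro divide_left_mono) auto
    ultimately have "1 / ((1 + 2 * t\<^sup>2) * (1 + k\<^sup>2)) * (1 / (1 + x\<^sup>2)) \<le> 1 / (1 + y\<^sup>2) * (1 / 1)"
      by (intro mult_mono) auto
    then show ?thesis by (simp add: iter y_def k_def cauchy_weight_def)
  qed
  show "1 powi n * cauchy_weight (affine_iter 1 t n x) \<le> (1 + t\<^sup>2) * (3 + 2 / t\<^sup>2) * (1 / (1 + (of_int n)\<^sup>2)) * cauchy_weight x"
  proof -
    have "1 / (1 + y\<^sup>2) \<le> (3 + 2 / t\<^sup>2) / (1 + k\<^sup>2)"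
      using low by (simp add: divide_simps mult.commute)
    moreover have "1 \<le> (1 + t\<^sup>2) / (1 + x\<^sup>2)" using x2 by simp
    ultimately have "1 / (1 + y\<^sup>2) * 1 \<le> (3 + 2 / t\<^sup>2) / (1 + k\<^sup>2) * ((1 + t\<^sup>2) / (1 + x\<^sup>2))"
      by (intro mult_mono) auto
    moreover have "1 powi n * (2 / Y) \<le> A * K * (1 / B) * (2 / X)" if "1 / Y * 1 \<le> K / B * (A / X)" for A B K X Y :: real
      using mult_left_mono[OF that, of 2] by (simp add: ac_simps)
    ultimately show ?thesis
      unfolding iter cauchy_weight_def y_def k_def by blast
  qed
qed auto

lemma parabolic_summable: "integrable (count_space UNIV) (\<lambda>n::int. 1 / (1 + (of_int n :: real)\<^sup>2))"
proof -
  have "summable (\<lambda>k. inverse (real k ^ 2))" by (rule inverse_power_summable) simp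
  then have "summable (\<lambda>k. 1 / (1 + (real k)\<^sup>2))"
    by (rule summable_comparison_test'[of _ 1]) (auto simp: inverse_eq_divide intro!: divide_left_mono)
  then show ?thesis by (subst integrable_count_space_int) auto
qed

text \<open>Geometric growth at either end beats the quadratic decay of \<open>\<rho>\<close>, so that both \<open>\<mu>\<^sup>p \<le> 1\<close> and
  \<open>\<mu>\<^sup>-\<^sup>p \<le> 1\<close> are necessary.\<close>

lemma parabolic_summable_iff:
  fixes p \<mu> :: real
  assumes p: "0 < p" and \<mu>: "0 < \<mu>"
  shows "integrable (count_space UNIV) (\<lambda>n. (\<mu> powi n) powr p * (1 / (1 + (of_int n)\<^sup>2))) \<longleftrightarrow> \<mu> = 1"
proof
  define m where "m = \<mu> powr p"
  have le1: "b \<le> 1" if "0 < b" "summable (\<lambda>k. b ^ k * (1 / (1 + (real k)\<^sup>2)))" for b :: real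
  proof (rule ccontr)
    assume "\<not> b \<le> 1"
    then have b: "1 < b" by simp
    have "filterlim (\<lambda>k. b ^ k * (1 / (1 + (real k)\<^sup>2))) at_top sequentially" using b by real_asymp
    moreover have "(\<lambda>k. b ^ k * (1 / (1 + (real k)\<^sup>2))) \<longlonglongrightarrow> 0" by (rule summable_LIMSEQ_zero[OF that(2)])
    ultimately show False using not_tendsto_and_filterlim_at_infinity filterlim_at_top_imp_at_infinity
      by (metis sequentially_bot)
  qed
  assume "integrable (count_space UNIV) (\<lambda>n. (\<mu> powi n) powr p * (1 / (1 + (of_int n)\<^sup>2)))"
  then have "summable (\<lambda>k. m ^ k * (1 / (1 + (real k)\<^sup>2)))" "summable (\<lambda>k. (1 / m) ^ k * (1 / (1 + (real k)\<^sup>2)))"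
    unfolding power_int_powr[OF \<mu>] m_def[symmetric]
    by (subst (asm) integrable_count_space_int;
        simp add: m_def power_int_minus power_one_over inverse_eq_divide)+
  from this[THEN le1[rotated]] have "m = 1" using \<mu> by (simp add: m_def)
  moreover have "\<mu> = m powr (1/p)" using \<mu> p by (simp add: m_def powr_powr)
  ultimately show "\<mu> = 1" by simp
qed (simp add: parabolic_summable[simplified])

text \<open>The half-plane coordinate alone does not show this: \<open>cayley 1 = 0\<close> by convention, and \<open>0\<close> is the coordinate
  of \<open>-1\<close>, which belongs to the arc.\<close>

lemma one_notin_parabolic_arc: "0 < t \<Longrightarrow> 1 \<notin> parabolic_arc t"
proof
  assume t: "0 < t" and "1 \<in> parabolic_arc t"
  then obtain \<theta> where \<theta>: "-pi \<le> \<theta>" "\<theta> < Arg (parabolic_aut t (-1))" "cis \<theta> = 1"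
    by (auto simp: parabolic_arc_def)
  have "parabolic_aut t (-1) = cis (2 * arctan (-1/t))"
    using t cis_2_arctan[of "-1/t"] by (auto simp: parabolic_aut_def disc_conj_def cayley_def)
  then have "Arg (parabolic_aut t (-1)) = 2 * arctan (-1/t)" by (simp only: Arg_cis_2_arctan)
  moreover have "arctan (-1/t) < 0" using t by simp
  ultimately have "\<theta> < 0" using \<theta>(2) by linarith
  moreover have "sin \<theta> = 0" "cos \<theta> = 1" using \<theta>(3) by (auto simp: complex_eq_iff)
  moreover have "\<theta> \<noteq> - pi" using \<open>cos \<theta> = 1\<close> by auto
  ultimately show False using sin_eq_0_pi[of \<theta>] \<theta>(1) pi_gt_zero by linarith
qed

theorem theorem3p4:
  fixes p \<alpha> t :: real and \<phi> :: "complex \<Rightarrow> complex" and J :: "complex set" and \<Lambda> :: "real set"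
  assumes "1 \<le> p"
    and "(1 < \<alpha> \<and> \<phi> = hyperbolic_aut \<alpha> \<and> J = hyperbolic_arcs \<alpha> \<and>
            \<Lambda> = {\<mu>. \<alpha> powr (-1 / p) < \<mu> \<and> \<mu> < \<alpha> powr (1 / p)}) \<or>
         (0 < t \<and> \<phi> = parabolic_aut t \<and> J = parabolic_arc t \<and> \<Lambda> = {1})"
  shows
    "(\<forall>\<mu>>0.
        (\<exists>F f. is_outer p F f \<and>
           (\<exists>\<gamma>\<in>sphere 0 1. \<forall>z\<in>ball 0 1. F (\<phi> z) = \<gamma> * of_real \<mu> * F z)) \<longleftrightarrow> \<mu> \<in> \<Lambda>) \<and>
     (\<forall>\<mu>>0. \<forall>F f. is_outer p F f \<longrightarrow>
        ((\<exists>\<gamma>\<in>sphere 0 1. \<forall>z\<in>ball 0 1. F (\<phi> z) = \<gamma> * of_real \<mu> * F z) \<longleftrightarrow>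
         (\<exists>f\<^sub>0. admissible_datum p J f\<^sub>0 \<and>
            (AE z in circle_measure. f z = orbit_sum \<phi> J \<mu> f\<^sub>0 z)))) \<and>
     (\<forall>f\<^sub>0. admissible_datum p J f\<^sub>0 \<longrightarrow>
        (\<exists>\<gamma>\<in>sphere 0 1. \<forall>\<mu>\<in>\<Lambda>.
           is_outer p (outer_fun (orbit_sum \<phi> J \<mu> f\<^sub>0)) (orbit_sum \<phi> J \<mu> f\<^sub>0) \<and>
           (\<forall>F f. is_outer p F f \<and>
              (AE z in circle_measure. f z = orbit_sum \<phi> J \<mu> f\<^sub>0 z) \<longrightarrow>
              (\<forall>z\<in>ball 0 1. F (\<phi> z) = \<gamma> * of_real \<mu> * F z))))"
  using assms(2)
proof (elim disjE conjE)
  assume \<alpha>: "1 < \<alpha>" and \<phi>: "\<phi> = hyperbolic_aut \<alpha>" and J: "J = hyperbolic_arcs \<alpha>"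
    and \<Lambda>: "\<Lambda> = {\<mu>. \<alpha> powr (-1 / p) < \<mu> \<and> \<mu> < \<alpha> powr (1 / p)}"
  let ?T = "{-\<alpha><..-1} \<union> {1..<\<alpha>}"
  have "cayley 1 = 0" by (simp add: cayley_def)
  moreover have "0 \<notin> (of_real ` ?T :: complex set)" by auto
  ultimately have "1 \<notin> J" using cayley_hyperbolic_arcs[OF \<alpha>] unfolding J by (metis imageI)
  moreover have "\<phi> = disc_conj (\<lambda>w. of_real \<alpha> * w + of_real 0)" by (simp add: \<phi> hyperbolic_aut_def)
  ultimately interpret circle_tiling \<alpha> 0 ?T "\<lambda>n. min (\<alpha> powi n) (\<alpha> powi (-n))" 1 "1 + \<alpha>\<^sup>2" \<phi> J
    using disc_conj_circle_tiling[OF hyperbolic_line_tiling[OF \<alpha>]] cayley_hyperbolic_arcs[OF \<alpha>] J by simp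
  have p: "0 < p" using assms(1) by simp
  show ?thesis
  proof (rule eigenvalue_description[OF p])
    show "\<mu> \<in> \<Lambda> \<longleftrightarrow> 0 < \<mu> \<and> integrable (count_space UNIV) (\<lambda>n. (\<mu> powi n) powr p * min (\<alpha> powi n) (\<alpha> powi (-n)))" for \<mu>
    proof (cases "0 < \<mu>")
      case False
      have "0 \<le> \<alpha> powr (-1 / p)" by simp
      then show ?thesis using False unfolding \<Lambda> by (auto simp del: powr_ge_zero)
    qed (simp add: hyperbolic_summable_iff[OF \<alpha> p] \<Lambda>)
    show "integrable (count_space UNIV) (\<lambda>n. min (\<alpha> powi n) (\<alpha> powi (-n)))"
      using hyperbolic_summable_iff[OF \<alpha> p, of 1] \<alpha> p by (simp add: powr_less_one)
    show "\<Lambda> = {1} \<or> (0::real) = 0 \<and> (\<forall>x. x \<in> ?T \<longleftrightarrow> - x \<in> ?T) \<and>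
        integrable (count_space UNIV) (\<lambda>n. \<bar>of_int n\<bar> * min (\<alpha> powi n) (\<alpha> powi (-n)))"
      using hyperbolic_index_summable[OF \<alpha>] by auto
  qed
next
  assume t: "0 < t" and \<phi>: "\<phi> = parabolic_aut t" and J: "J = parabolic_arc t" and \<Lambda>: "\<Lambda> = {1}"
  have "1 \<notin> J" unfolding J by (rule one_notin_parabolic_arc[OF t])
  moreover have "\<phi> = disc_conj (\<lambda>w. of_real 1 * w + of_real t)" by (simp add: \<phi> parabolic_aut_def)
  ultimately interpret circle_tiling 1 t "{0..<t}" "\<lambda>n. 1 / (1 + (of_int n)\<^sup>2)" "1 / (1 + 2 * t\<^sup>2)" "(1 + t\<^sup>2) * (3 + 2 / t\<^sup>2)" \<phi> J
    using disc_conj_circle_tiling[OF parabolic_line_tiling[OF t]] cayley_parabolic_arc[OF t] J by simp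
  have p: "0 < p" using assms(1) by simp
  show ?thesis
  proof (rule eigenvalue_description[OF p])
    show "\<mu> \<in> \<Lambda> \<longleftrightarrow> 0 < \<mu> \<and> integrable (count_space UNIV) (\<lambda>n. (\<mu> powi n) powr p * (1 / (1 + (of_int n)\<^sup>2)))" for \<mu>
      using parabolic_summable_iff[OF p] by (cases "0 < \<mu>") (auto simp: \<Lambda>)
    show "integrable (count_space UNIV) (\<lambda>n::int. 1 / (1 + (of_int n :: real)\<^sup>2))" by (rule parabolic_summable)
  qed (simp add: \<Lambda>)
qed

end
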